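(* Let $\mathcal{T}$ be a geodesic triangle in the Poincaré disc, let $M$ be the closed three-manifold obtained from $\mathcal{T}$ by the construction described in the context, and let $Z$ be the smooth vector field on $M$ extending the vector field $Y=\rho X$ on $M^*$, as in the context. Then $Z$ has two hyperbolic singularities (equilibrium points) on each singular fiber $\gamma_\sigma$, $\sigma\in\mathcal{V}$.
   Context: **The surface $\mathcal{S}$.** Let $\mathbb{D}$ be the Poincaré disc with constant curvature $-1$ and $\mathcal{T}\subset\mathbb{D}$ a (compact, nondegenerate) triangle with geodesic sides. Let $\mathcal{S}$ be the double of $\mathcal{T}$: two disjoint isometric copies of $\mathcal{T}$ glued along their boundaries by $x\simeq\varphi(x)$ for $x\in\partial\mathcal{T}$, where $\varphi$ is an isometry from the first copy to the second. $\mathcal{S}$ is homeomorphic to the two-sphere. Let $\mathcal{V}\subset\mathcal{S}$ be the set of the three classes of vertices of $\mathcal{T}$ (the conical singularities) and $\mathcal{S}^*=\mathcal{S}\setminus\mathcal{V}$. Since the sides are geodesic, $\mathcal{S}^*$ has a natural smooth structure and Riemannian metric of curvature $-1$ inducing the given metric on each copy of $\mathcal{T}$; $\operatorname{dist}$ is the induced distance, extended to $\mathcal{S}$. Fix an orientation of $\mathcal{S}$. **Polar coordinates and charts of $\mathcal{S}$.** For $\tau>0$ put $B_\tau(\sigma)=\{p\in\mathcal{S}:\operatorname{dist}(p,\sigma)<\tau\}$ and $B^*_\tau(\sigma)=B_\tau(\sigma)\setminus\{\sigma\}$. Fix $\tau>0$ such that for every $\sigma\in\mathcal{V}$ the closure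 of $B_\tau(\sigma)$ is homeomorphic to a compact disc and $B_\tau(\sigma)\cap\mathcal{V}=\{\sigma\}$. For $\sigma\in\mathcal{V}$ let $\theta$ be the angle of $\mathcal{T}$ at $\sigma$ (the cone angle at $\sigma$ is $2\theta$), $\mathbb{S}^1_\theta=\mathbb{R}/2\theta\mathbb{Z}$, $\mathbb{S}^1=\mathbb{R}/2\pi\mathbb{Z}$, and $\zeta_\theta:\mathbb{S}^1_\theta\to\mathbb{S}^1$ the isomorphism induced by $x\mapsto x\pi/\theta$. Let $r(p)=\operatorname{dist}(p,\sigma)$, fix a geodesic $l$ starting at $\sigma$, and let $\alpha(p)\in\mathbb{S}^1_\theta$ be the angle, measured positively with respect to the orientation, from $l$ to the geodesic segment from $\sigma$ to $p$. Let $D_\tau=\{(x,y)\in\mathbb{R}^2:\sqrt{x^2+y^2}<\sinh\tau\}$ and $\phi_\sigma:B_\tau(\sigma)\to D_\tau$, $\phi_\sigma(p)=\sinh(r(p))\,(\cos\zeta_\theta(\alpha(p)),\sin\zeta_\theta(\alpha(p)))$ for $p\ne\sigma$, $\phi_\sigma(\sigma)=(0,0)$. The maps $\phi_\sigma$, together with the charts of $\mathcal{S}^*$, define the smooth structure of $\mathcal{S}$. **The manifold $M$.** Let $M^*=T^1\mathcal{S}^*$ be the unit tangent bundle with projection $\Pi:M^*\to\mathcal{S}^*$. For $\sigma\in\mathcal{V}$ let $U^*_\tau(\sigma)=\Pi^{-1}(B^*_\tau(\sigma))$, and for $v\in U_\tau^*(\sigma)$ with base point $x$ let $\beta(v)\in\mathbb{S}^1$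 be the oriented angle from the outward velocity at $x$ of the geodesic from $\sigma$ to $x$, to $v$. Let $\gamma_\sigma=\{\sigma\}\times\mathbb{S}^1$ (singular fiber), $U_\tau(\sigma)=U^*_\tau(\sigma)\cup\gamma_\sigma$, and $\Phi_\sigma:U_\tau(\sigma)\to D_\tau\times\mathbb{S}^1$, $\Phi_\sigma(v)=(\phi_\sigma(\Pi(v)),\beta(v))$ on $U^*_\tau(\sigma)$, $\Phi_\sigma(\sigma,\beta)=(0,0,\beta)$ on $\gamma_\sigma$. Put $M=M^*\cup\bigcup_{\sigma\in\mathcal{V}}\gamma_\sigma$, with the smooth structure for which $M^*$ is an open submanifold and each $\Phi_\sigma$ is a diffeomorphism. $M$ is a closed three-manifold. **The vector field.** $X$ is the velocity field of the geodesic flow of $\mathcal{S}^*$ on $M^*$. Let $\varepsilon>0$ and let $\rho:M^*\to\mathbb{R}$ be a positive smooth function such that $\rho(v)=\sinh(\operatorname{dist}(\Pi(v),\sigma))$ whenever $\sigma\in\mathcal{V}$ and $\operatorname{dist}(\Pi(v),\sigma)<\varepsilon$. The field $Y=\rho X$ on $M^*$ has a smooth extension to $M$ (unique, since $M^*$ is dense), denoted $Z$. A zero of $Z$ is hyperbolic if the linearization of $Z$ there has no eigenvalue with zero real part. *)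

theory Defs
  imports "HOL-Complex_Analysis.Riemann_Mapping" "HOL-Library.Numeral_Type"
begin

section \<open>Smooth structures given by atlases\<close>

primrec Ck_on :: "nat \<Rightarrow> 'a::real_normed_vector set \<Rightarrow> ('a \<Rightarrow> 'b::real_normed_vector) \<Rightarrow> bool" where
  "Ck_on 0 S f \<longleftrightarrow> continuous_on S f"
| "Ck_on (Suc k) S f \<longleftrightarrow> (\<forall>x\<in>S. f differentiable (at x)) \<and>
     (\<forall>v. Ck_on k S (\<lambda>x. frechet_derivative f (at x) v))"

text \<open>Meant for open \<open>S\<close>.\<close>

definition smooth_on :: "'a::real_normed_vector set \<Rightarrow> ('a \<Rightarrow> 'b::real_normed_vector) \<Rightarrow> bool" where
  "smooth_on S f \<longleftrightarrow> (\<forall>k. Ck_on k S f)"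

text \<open>A chart is its domain together with the coordinate map; the values of the coordinate map
  outside the domain are irrelevant.\<close>

type_synonym ('p, 'e) chart = "'p set \<times> ('p \<Rightarrow> 'e)"

definition from_chart :: "('p, 'e) chart \<Rightarrow> 'e \<Rightarrow> 'p" where
  "from_chart \<kappa> = inv_into (fst \<kappa>) (snd \<kappa>)"

text \<open>A tangent vector at \<open>q\<close> is the family of its coordinate expressions in all charts around
  \<open>q\<close>, related by the differentials of the transition maps, and \<open>0\<close> on all other charts.\<close>

definition tangent_space ::
  "('p, 'e::real_normed_vector) chart set \<Rightarrow> 'p \<Rightarrow> (('p, 'e) chart \<Rightarrow> 'e) set" where
  "tangent_space A q = {\<xi>.
     (\<forall>\<kappa>. \<not> (\<kappa> \<in> A \<and> q \<in> fst \<kappa>) \<longrightarrow> \<xi> \<kappa> = 0) \<and>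
     (\<forall>\<kappa>\<in>A. \<forall>\<kappa>'\<in>A. q \<in> fst \<kappa> \<and> q \<in> fst \<kappa>' \<longrightarrow>
        \<xi> \<kappa>' = frechet_derivative (snd \<kappa>' \<circ> from_chart \<kappa>) (at (snd \<kappa> q)) (\<xi> \<kappa>))}"

definition velocity ::
  "('p, 'e::real_normed_vector) chart set \<Rightarrow> (real \<Rightarrow> 'p) \<Rightarrow> real \<Rightarrow> ('p, 'e) chart \<Rightarrow> 'e" where
  "velocity A c t = (\<lambda>\<kappa>. if \<kappa> \<in> A \<and> c t \<in> fst \<kappa> then vector_derivative (snd \<kappa> \<circ> c) (at t) else 0)"

definition smooth_function :: "('p, 'e::real_normed_vector) chart set \<Rightarrow> ('p \<Rightarrow> real) \<Rightarrow> bool" where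
  "smooth_function A f \<longleftrightarrow> (\<forall>\<kappa>\<in>A. smooth_on (snd \<kappa> ` fst \<kappa>) (f \<circ> from_chart \<kappa>))"

definition in_chart ::
  "('p \<Rightarrow> ('p, 'e) chart \<Rightarrow> 'e) \<Rightarrow> ('p, 'e) chart \<Rightarrow> 'e \<Rightarrow> 'e" where
  "in_chart Z \<kappa> x = Z (from_chart \<kappa> x) \<kappa>"

definition smooth_vector_field ::
  "'p set \<Rightarrow> ('p, 'e::real_normed_vector) chart set \<Rightarrow> ('p \<Rightarrow> ('p, 'e) chart \<Rightarrow> 'e) \<Rightarrow> bool" where
  "smooth_vector_field N A Z \<longleftrightarrow>
     (\<forall>q\<in>N. Z q \<in> tangent_space A q) \<and>
     (\<forall>\<kappa>\<in>A. smooth_on (snd \<kappa> ` fst \<kappa>) (in_chart Z \<kappa>))"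

text \<open>\<open>\<mu>\<close> is an eigenvalue of the complexification of \<open>L\<close>: there is \<open>u + \<i>v \<noteq> 0\<close> with
  \<open>L u + \<i> L v = \<mu> (u + \<i>v)\<close>.\<close>

definition complex_eigenvalue :: "('e::real_vector \<Rightarrow> 'e) \<Rightarrow> complex \<Rightarrow> bool" where
  "complex_eigenvalue L \<mu> \<longleftrightarrow> (\<exists>u v. (u, v) \<noteq> (0, 0) \<and>
     L u = Re \<mu> *\<^sub>R u - Im \<mu> *\<^sub>R v \<and> L v = Im \<mu> *\<^sub>R u + Re \<mu> *\<^sub>R v)"

definition is_zero_of :: "('p \<Rightarrow> ('p, 'e) chart \<Rightarrow> 'e::real_normed_vector) \<Rightarrow> 'p \<Rightarrow> bool" where
  "is_zero_of Z q \<longleftrightarrow> Z q = (\<lambda>_. 0)"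

text \<open>At a zero of a vector field the linearization is an endomorphism of the tangent space; in a
  chart it is the derivative of the coordinate expression, so its eigenvalues do not depend on the
  chart.\<close>

definition hyperbolic_zero ::
  "('p, 'e::real_normed_vector) chart set \<Rightarrow> ('p \<Rightarrow> ('p, 'e) chart \<Rightarrow> 'e) \<Rightarrow> 'p \<Rightarrow> bool" where
  "hyperbolic_zero A Z q \<longleftrightarrow> is_zero_of Z q \<and>
     (\<forall>\<kappa>\<in>A. q \<in> fst \<kappa> \<longrightarrow>
        (\<forall>\<mu>. complex_eigenvalue (frechet_derivative (in_chart Z \<kappa>) (at (snd \<kappa> q))) \<mu> \<longrightarrow> Re \<mu> \<noteq> 0))"


section \<open>The Poincare disc\<close>

text \<open>The disc is \<open>ball 0 1\<close> with the metric \<open>4 \<bar>dz\<bar>\<^sup>2 / (1 - \<bar>z\<bar>\<^sup>2)\<^sup>2\<close>. \<open>mob a\<close> is the isometry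
  \<open>z \<mapsto> (z - a) / (1 - cnj a * z)\<close> taking \<open>a\<close> to \<open>0\<close>; its inverse is \<open>mob (- a)\<close>.\<close>

abbreviation mob :: "complex \<Rightarrow> complex \<Rightarrow> complex" where
  "mob a \<equiv> Moebius_function 0 a"

text \<open>The unit speed geodesic through \<open>a\<close> with initial direction \<open>u\<close>, where \<open>cmod u = 1\<close>: the
  isometry \<open>mob (- a)\<close> applied to the unit speed parametrization \<open>t \<mapsto> tanh (t / 2) u\<close> of a
  diameter. (The derivative of \<open>mob (- a)\<close> at \<open>0\<close> is a positive real, so \<open>u\<close> is also the
  direction at \<open>a\<close>.)\<close>

definition pgeod :: "complex \<Rightarrow> complex \<Rightarrow> real \<Rightarrow> complex" where
  "pgeod a u t = mob (- a) (of_real (tanh (t / 2)) * u)"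

definition pseg :: "complex \<Rightarrow> complex \<Rightarrow> complex set" where
  "pseg a b = {mob (- a) (of_real s * mob a b) | s. 0 \<le> s \<and> s \<le> 1}"

text \<open>The reflection in the geodesic line through \<open>a\<close> and \<open>b\<close>, where \<open>a \<noteq> b\<close>.\<close>

definition preflect :: "complex \<Rightarrow> complex \<Rightarrow> complex \<Rightarrow> complex" where
  "preflect a b z = mob (- a) ((sgn (mob a b))\<^sup>2 * cnj (mob a z))"

definition pconvex :: "complex set \<Rightarrow> bool" where
  "pconvex C \<longleftrightarrow> C \<subseteq> ball 0 1 \<and> (\<forall>a\<in>C. \<forall>b\<in>C. pseg a b \<subseteq> C)"

text \<open>Vertices are indexed by the three-element type \<open>3\<close>, in which \<open>i\<close>, \<open>i + 1\<close>, \<open>i + 2\<close> are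
  the three elements.\<close>

definition nondegenerate :: "(3 \<Rightarrow> complex) \<Rightarrow> bool" where
  "nondegenerate V \<longleftrightarrow> (\<forall>i. cmod (V i) < 1) \<and>
     \<not> (\<exists>a u. cmod a < 1 \<and> cmod u = 1 \<and> range V \<subseteq> range (pgeod a u))"

definition triangle :: "(3 \<Rightarrow> complex) \<Rightarrow> complex set" where
  "triangle V = pconvex hull (range V)"

text \<open>The side opposite to vertex \<open>i\<close>.\<close>

definition side :: "(3 \<Rightarrow> complex) \<Rightarrow> 3 \<Rightarrow> complex set" where
  "side V i = pseg (V (i + 1)) (V (i + 2))"

definition angle_at :: "(3 \<Rightarrow> complex) \<Rightarrow> 3 \<Rightarrow> real" where
  "angle_at V i = \<bar>Arg (mob (V i) (V (i + 2)) / mob (V i) (V (i + 1)))\<bar>"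


section \<open>The double of the triangle\<close>

text \<open>The two copies of the triangle are \<open>{True} \<times> triangle V\<close> and \<open>{False} \<times> triangle V\<close>;
  points of the double are equivalence classes.\<close>

type_synonym spoint = "(bool \<times> complex) set"

definition glue :: "(3 \<Rightarrow> complex) \<Rightarrow> ((bool \<times> complex) \<times> (bool \<times> complex)) set" where
  "glue V = {((s, z), (s', z')). z \<in> triangle V \<and> z' = z \<and> (s' = s \<or> z \<in> (\<Union>i. side V i))}"

definition proj :: "(3 \<Rightarrow> complex) \<Rightarrow> bool \<Rightarrow> complex \<Rightarrow> spoint" where
  "proj V s z = glue V `` {(s, z)}"

definition surface :: "(3 \<Rightarrow> complex) \<Rightarrow> spoint set" where
  "surface V = (UNIV \<times> triangle V) // glue V"

text \<open>The quotient topology.\<close>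

definition surface_top :: "(3 \<Rightarrow> complex) \<Rightarrow> spoint topology" where
  "surface_top V = topology (\<lambda>U. U \<subseteq> surface V \<and>
     openin (top_of_set (UNIV \<times> triangle V)) {x \<in> UNIV \<times> triangle V. glue V `` {x} \<in> U})"

lemma openin_surface_top:
  "openin (surface_top V) U \<longleftrightarrow> U \<subseteq> surface V \<and>
     openin (top_of_set (UNIV \<times> triangle V)) {x \<in> UNIV \<times> triangle V. glue V `` {x} \<in> U}"
proof -
  let ?pre = "\<lambda>U. {x \<in> UNIV \<times> triangle V. glue V `` {x} \<in> U}"
  have int: "?pre (S \<inter> T) = ?pre S \<inter> ?pre T" for S T by blast
  have un: "?pre (\<Union>K) = \<Union>(?pre ` K)" for K by blast
  have "istopology (\<lambda>U. U \<subseteq> surface V \<and> openin (top_of_set (UNIV \<times> triangle V)) (?pre U))"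
    unfolding istopology_def int un by (intro conjI allI impI openin_Int openin_Union) auto
  then show ?thesis by (simp add: surface_top_def topology_inverse')
qed

definition vertex :: "(3 \<Rightarrow> complex) \<Rightarrow> 3 \<Rightarrow> spoint" where
  "vertex V i = proj V True (V i)"

definition surface_reg :: "(3 \<Rightarrow> complex) \<Rightarrow> spoint set" where
  "surface_reg V = surface V - range (vertex V)"

text \<open>\<open>footprint\<close> maps the class of \<open>(s, z)\<close> to \<open>z\<close>, and \<open>sheet p\<close> is one of the copies in which \<open>p\<close>
  has a representative (\<open>True\<close> on the common boundary).\<close>

definition footprint :: "spoint \<Rightarrow> complex" where
  "footprint p = the_elem (snd ` p)"

definition sheet :: "spoint \<Rightarrow> bool" where
  "sheet p \<longleftrightarrow> True \<in> fst ` p"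

text \<open>Developing the second copy across the open side \<open>i\<close>, these charts are isometries onto open
  subsets of the disc. They cover the complement of the vertices, have isometric orientation
  preserving transition maps, and thereby define the smooth structure, the Riemannian metric and
  the two orientations of \<open>surface_reg V\<close>.\<close>

definition side_chart :: "(3 \<Rightarrow> complex) \<Rightarrow> 3 \<Rightarrow> (spoint, complex) chart" where
  "side_chart V i =
     ({p \<in> surface V. footprint p \<notin> side V (i + 1) \<union> side V (i + 2)},
      \<lambda>p. if sheet p then footprint p else preflect (V (i + 1)) (V (i + 2)) (footprint p))"

definition surface_atlas :: "(3 \<Rightarrow> complex) \<Rightarrow> (spoint, complex) chart set" where
  "surface_atlas V = range (side_chart V)"

text \<open>Norms and angles of tangent vectors can be computed in any chart around the base point.\<close>

definition chart_at :: "(3 \<Rightarrow> complex) \<Rightarrow> spoint \<Rightarrow> (spoint, complex) chart" where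
  "chart_at V p = (SOME \<kappa>. \<kappa> \<in> surface_atlas V \<and> p \<in> fst \<kappa>)"

type_synonym stangent = "(spoint, complex) chart \<Rightarrow> complex"

definition riem_norm :: "(3 \<Rightarrow> complex) \<Rightarrow> spoint \<Rightarrow> stangent \<Rightarrow> real" where
  "riem_norm V p \<xi> = (let \<kappa> = chart_at V p in 2 * cmod (\<xi> \<kappa>) / (1 - (cmod (snd \<kappa> p))\<^sup>2))"

text \<open>The orientation of the surface is a parameter: \<open>True\<close> is the one for which the charts
  \<open>side_chart V i\<close> preserve orientation. Elements of \<open>\<real> / 2\<pi>\<int>\<close> are represented by unit complex
  numbers, so changing the sign of an angle is conjugation.\<close>

definition orient :: "bool \<Rightarrow> complex \<Rightarrow> complex" where
  "orient ori w = (if ori then w else cnj w)"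

definition oriented_angle ::
  "(3 \<Rightarrow> complex) \<Rightarrow> bool \<Rightarrow> spoint \<Rightarrow> stangent \<Rightarrow> stangent \<Rightarrow> complex" where
  "oriented_angle V ori p \<xi> \<eta> = (let \<kappa> = chart_at V p in orient ori (sgn (\<eta> \<kappa> / \<xi> \<kappa>)))"

text \<open>The induced distance is the infimum of the Riemannian lengths. Allowing curves to meet the
  vertices at finitely many times extends it to the whole surface.\<close>

definition is_curve :: "(3 \<Rightarrow> complex) \<Rightarrow> (real \<Rightarrow> spoint) \<Rightarrow> bool" where
  "is_curve V c \<longleftrightarrow> continuous_map (top_of_set {0..1}) (surface_top V) c \<and>
     (\<exists>F. finite F \<and> (\<forall>t\<in>{0..1} - F. \<exists>\<kappa>\<in>surface_atlas V. \<exists>\<delta>>0.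
        c ` ball t \<delta> \<subseteq> fst \<kappa> \<and> (snd \<kappa> \<circ> c) C1_differentiable_on ball t \<delta>)) \<and>
     (\<lambda>t. riem_norm V (c t) (velocity (surface_atlas V) c t)) integrable_on {0..1}"

definition curve_length :: "(3 \<Rightarrow> complex) \<Rightarrow> (real \<Rightarrow> spoint) \<Rightarrow> real" where
  "curve_length V c =
     integral {0..1} (\<lambda>t. riem_norm V (c t) (velocity (surface_atlas V) c t))"

definition sdist :: "(3 \<Rightarrow> complex) \<Rightarrow> spoint \<Rightarrow> spoint \<Rightarrow> real" where
  "sdist V p q = Inf {curve_length V c | c. is_curve V c \<and> c 0 = p \<and> c 1 = q}"

definition sball :: "(3 \<Rightarrow> complex) \<Rightarrow> real \<Rightarrow> 3 \<Rightarrow> spoint set" where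
  "sball V \<tau> i = {p \<in> surface V. sdist V p (vertex V i) < \<tau>}"


section \<open>Polar coordinates at the vertices\<close>

text \<open>The direction at vertex \<open>i\<close> of the geodesic from the vertex to \<open>p\<close>, as an angle measured
  from the side towards vertex \<open>i + 1\<close>, positive for the orientation \<open>True\<close>. The sector at the
  vertex in the second copy is the mirror image of the one in the first, hence the sign. The two
  values \<open>\<plusminus> angle_at V i\<close> on the side towards vertex \<open>i + 2\<close> agree modulo the cone angle
  \<open>2 * angle_at V i\<close>.\<close>

definition direction :: "(3 \<Rightarrow> complex) \<Rightarrow> 3 \<Rightarrow> spoint \<Rightarrow> real" where
  "direction V i p = (if sheet p then 1 else -1) *
     Arg (mob (V i) (footprint p) / mob (V i) (V (i + 1)))"

text \<open>A real representative of the angle \<open>\<alpha>(p)\<close>, an element of \<open>\<real> / 2\<theta>\<int>\<close> with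
  \<open>\<theta> = angle_at V i\<close>, from the geodesic \<open>l\<close> to the geodesic to \<open>p\<close>. The geodesic \<open>l\<close> is given by a point
  \<open>l i\<close> on it.\<close>

definition polar_angle :: "(3 \<Rightarrow> complex) \<Rightarrow> (3 \<Rightarrow> spoint) \<Rightarrow> bool \<Rightarrow> 3 \<Rightarrow> spoint \<Rightarrow> real" where
  "polar_angle V l ori i p =
     (if ori then 1 else -1) * (direction V i p - direction V i (l i))"

text \<open>\<open>cis (x * pi / \<theta>)\<close> depends only on \<open>x\<close> modulo \<open>2\<theta>\<close>; it renders \<open>\<zeta>\<^sub>\<theta>\<close>. The plane is
  identified with the complex numbers.\<close>

definition vertex_coord :: "(3 \<Rightarrow> complex) \<Rightarrow> (3 \<Rightarrow> spoint) \<Rightarrow> bool \<Rightarrow> 3 \<Rightarrow> spoint \<Rightarrow> complex" where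
  "vertex_coord V l ori i p = (if p = vertex V i then 0 else
     of_real (sinh (sdist V p (vertex V i))) *
     cis (polar_angle V l ori i p * pi / angle_at V i))"

text \<open>The unit speed geodesic from vertex \<open>i\<close> passing through \<open>p\<close>, and its velocity at \<open>p\<close>.\<close>

definition radial :: "(3 \<Rightarrow> complex) \<Rightarrow> 3 \<Rightarrow> spoint \<Rightarrow> real \<Rightarrow> spoint" where
  "radial V i p t = proj V (sheet p) (pgeod (V i) (sgn (mob (V i) (footprint p))) t)"

definition outward :: "(3 \<Rightarrow> complex) \<Rightarrow> 3 \<Rightarrow> spoint \<Rightarrow> stangent" where
  "outward V i p = velocity (surface_atlas V) (radial V i p) (sdist V p (vertex V i))"


section \<open>The three-manifold and the geodesic field\<close>

text \<open>\<open>Reg p \<xi>\<close> is the tangent vector \<open>\<xi>\<close> at \<open>p\<close>; \<open>Fib i b\<close>, with \<open>cmod b = 1\<close>, is the point of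
  the singular fiber over vertex \<open>i\<close> whose angle is the argument of \<open>b\<close>.\<close>

datatype mpoint = Reg spoint stangent | Fib 3 complex

definition M_reg :: "(3 \<Rightarrow> complex) \<Rightarrow> mpoint set" where
  "M_reg V = {Reg p \<xi> | p \<xi>. p \<in> surface_reg V \<and> \<xi> \<in> tangent_space (surface_atlas V) p \<and>
     riem_norm V p \<xi> = 1}"

definition sing_fiber :: "3 \<Rightarrow> mpoint set" where
  "sing_fiber i = Fib i ` sphere 0 1"

definition M_space :: "(3 \<Rightarrow> complex) \<Rightarrow> mpoint set" where
  "M_space V = M_reg V \<union> (\<Union>i. sing_fiber i)"

text \<open>The chart \<open>cis b \<mapsto> b\<close> of the circle with \<open>b \<in> {b0 - pi<..<b0 + pi}\<close>; it is defined for those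
  \<open>w\<close> with \<open>w * cis (- b0) \<notin> \<real>\<^sub>\<le>\<^sub>0\<close>.\<close>

definition arg_near :: "real \<Rightarrow> complex \<Rightarrow> real" where
  "arg_near b0 w = b0 + Arg (w * cis (- b0))"

definition reg_chart :: "(3 \<Rightarrow> complex) \<Rightarrow> (spoint, complex) chart \<Rightarrow> real \<Rightarrow>
    (mpoint, complex \<times> real) chart" where
  "reg_chart V \<kappa> b0 =
     ({Reg p \<xi> | p \<xi>. Reg p \<xi> \<in> M_reg V \<and> p \<in> fst \<kappa> \<and> \<xi> \<kappa> * cis (- b0) \<notin> \<real>\<^sub>\<le>\<^sub>0},
      \<lambda>q. case q of Reg p \<xi> \<Rightarrow> (snd \<kappa> p, arg_near b0 (\<xi> \<kappa>)) | Fib i b \<Rightarrow> (0, 0))"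

definition M_reg_atlas :: "(3 \<Rightarrow> complex) \<Rightarrow> (mpoint, complex \<times> real) chart set" where
  "M_reg_atlas V = {reg_chart V \<kappa> b0 | \<kappa> b0. \<kappa> \<in> surface_atlas V}"

definition U_nbhd :: "(3 \<Rightarrow> complex) \<Rightarrow> real \<Rightarrow> 3 \<Rightarrow> mpoint set" where
  "U_nbhd V \<tau> i = {Reg p \<xi> | p \<xi>. Reg p \<xi> \<in> M_reg V \<and> p \<in> sball V \<tau> i - {vertex V i}} \<union> sing_fiber i"

text \<open>The map \<open>\<Phi>\<close> at vertex \<open>i\<close>, with values in \<open>\<complex>\<close> times the unit circle.\<close>

definition Phi :: "(3 \<Rightarrow> complex) \<Rightarrow> (3 \<Rightarrow> spoint) \<Rightarrow> bool \<Rightarrow> 3 \<Rightarrow> mpoint \<Rightarrow> complex \<times> complex" where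
  "Phi V l ori i q = (case q of
     Reg p \<xi> \<Rightarrow> (vertex_coord V l ori i p, oriented_angle V ori p (outward V i p) \<xi>)
   | Fib j b \<Rightarrow> (0, b))"

definition sing_chart :: "(3 \<Rightarrow> complex) \<Rightarrow> real \<Rightarrow> (3 \<Rightarrow> spoint) \<Rightarrow> bool \<Rightarrow> 3 \<Rightarrow> real \<Rightarrow>
    (mpoint, complex \<times> real) chart" where
  "sing_chart V \<tau> l ori i b0 =
     ({q \<in> U_nbhd V \<tau> i. snd (Phi V l ori i q) * cis (- b0) \<notin> \<real>\<^sub>\<le>\<^sub>0},
      \<lambda>q. (fst (Phi V l ori i q), arg_near b0 (snd (Phi V l ori i q))))"

definition M_atlas :: "(3 \<Rightarrow> complex) \<Rightarrow> real \<Rightarrow> (3 \<Rightarrow> spoint) \<Rightarrow> bool \<Rightarrow>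
    (mpoint, complex \<times> real) chart set" where
  "M_atlas V \<tau> l ori = M_reg_atlas V \<union> {sing_chart V \<tau> l ori i b0 | i b0. True}"

text \<open>Unit speed geodesics of the regular part, defined (at least) on \<open>{-\<delta><..<\<delta>}\<close>: curves that
  are locally unit speed geodesics of the disc in the isometric charts.\<close>

definition is_geodesic :: "(3 \<Rightarrow> complex) \<Rightarrow> real \<Rightarrow> (real \<Rightarrow> spoint) \<Rightarrow> bool" where
  "is_geodesic V \<delta> c \<longleftrightarrow> (\<forall>t\<in>{-\<delta><..<\<delta>}. \<exists>\<kappa>\<in>surface_atlas V. \<exists>a u. cmod a < 1 \<and> cmod u = 1 \<and>
     (\<forall>\<^sub>F s in nhds t. c s \<in> fst \<kappa> \<and> snd \<kappa> (c s) = pgeod a u (s - t)))"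

text \<open>The geodesic flow moves \<open>Reg p \<xi>\<close> along \<open>\<lambda>t. vel_lift V c t\<close>, where \<open>c\<close> is the geodesic with
  initial velocity \<open>\<xi>\<close>; its germ at \<open>0\<close>, and hence the velocity field, do not depend on the choice.\<close>

definition geodesic_of :: "(3 \<Rightarrow> complex) \<Rightarrow> spoint \<Rightarrow> stangent \<Rightarrow> real \<Rightarrow> spoint" where
  "geodesic_of V p \<xi> = (SOME c. (\<exists>\<delta>>0. is_geodesic V \<delta> c) \<and> c 0 = p \<and>
     velocity (surface_atlas V) c 0 = \<xi>)"

definition vel_lift :: "(3 \<Rightarrow> complex) \<Rightarrow> (real \<Rightarrow> spoint) \<Rightarrow> real \<Rightarrow> mpoint" where
  "vel_lift V c t = Reg (c t) (velocity (surface_atlas V) c t)"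

definition geodesic_field :: "(3 \<Rightarrow> complex) \<Rightarrow> (mpoint, complex \<times> real) chart set \<Rightarrow>
    spoint \<Rightarrow> stangent \<Rightarrow> (mpoint, complex \<times> real) chart \<Rightarrow> complex \<times> real" where
  "geodesic_field V A p \<xi> = velocity A (vel_lift V (geodesic_of V p \<xi>)) 0"

end

theory Submission
  imports Defs
begin

text \<open>In the chart around the fiber over a vertex put \<open>w = sinh r * cis (\<pi> \<alpha> / \<theta>)\<close> for the base point in
  polar coordinates and let \<open>b\<close> be the angle of the vector with the outward radial direction. The
  geodesic equations of the metric \<open>dr\<^sup>2 + sinh\<^sup>2 r d\<alpha>\<^sup>2\<close> are \<open>r' = cos b\<close>, \<open>\<alpha>' = sin b / sinh r\<close>,
  \<open>b' = - coth r sin b\<close>, so multiplying by \<open>\<rho> = sinh r\<close> gives the field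
  \<open>w' = w (sqrt (1 + \<bar>w\<bar>\<^sup>2) cos b + \<i> (\<pi> / \<theta>) sin b)\<close>, \<open>b' = - sqrt (1 + \<bar>w\<bar>\<^sup>2) sin b\<close>.
  On the fiber it is \<open>(0, - sin b)\<close>, with the two zeros \<open>b = 0\<close> and \<open>b = \<pi>\<close>, where the linearization is
  \<open>(w, s) \<mapsto> \<plusminus> (w, - s)\<close>.

  As the field is known to be differentiable along the fiber, it suffices to compute it on two rays
  in the interior of the first copy of the triangle, where all charts of the surface agree. The
  distance to a vertex is the hyperbolic distance in the triangle because folding the double onto
  the triangle does not increase length. Convexity in the disc is reduced to linear algebra by
  lifting to the hyperboloid.\<close>

section \<open>The disc model\<close>

text \<open>Several notions rest on choice: \<open>in_chart\<close> reads a field through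
  \<open>from_chart\<close>, an inverse picked by \<open>inv_into\<close>, while
  \<open>chart_at\<close> and \<open>geodesic_of\<close> pick a chart and a geodesic. Each value
  must therefore be traced to a known point. Near a fiber this is \<open>vertex_coord_inj\<close>: a
  chart value over a ray strictly inside the first copy has only one base point on the whole double.
  Two rays suffice because they leave the vertex at \<theta>/3 and 2\<theta>/3. The chart stretches
  angles by pi/\<theta>, so their images are pi/3 apart, hence independent over the reals for every
  triangle, and together with the fiber direction they span the tangent space. Norms in different
  charts are compared through the metric speed, the limit of \<open>hdist\<close> over elapsed time.
  Folding preserves it even where the folded curve has a corner on a side, and the derivatives of
  the transition maps are never evaluated there. Hyperbolicity follows without computing
  eigenvalues: the linearization squares to the identity, which excludes the imaginary axis.\<close>

lemma mob_denom_nz: "1 - cnj a * z \<noteq> 0" if "cmod a < 1" "cmod z < 1"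
proof -
  have "cmod (cnj a * z) < 1" using that norm_mult_less[of "cnj a" 1 z 1] by simp
  then show ?thesis by (metis norm_one order.irrefl right_minus_eq)
qed

lemma mob_denom_nz': "1 + cnj a * z \<noteq> 0" if "cmod a < 1" "cmod z < 1"
  using mob_denom_nz[of "-a" z] that by simp

lemma mob_eq: "mob a z = (z - a) / (1 - cnj a * z)"
  by (rule Moebius_function_simple)

lemma mob_minus_eq: "mob (- a) z = (z + a) / (1 + cnj a * z)"
  by (simp add: mob_eq)

lemma mob_lt_1: "cmod (mob a z) < 1" if "cmod a < 1" "cmod z < 1"
  using Moebius_function_norm_lt_1 that by blast

lemma mob_minus_mob: "mob (- a) (mob a z) = z" if "cmod a < 1" "cmod z < 1"
  using Moebius_function_compose[of "-a" a z] that by simp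

lemma mob_mob_minus: "mob a (mob (- a) z) = z" if "cmod a < 1" "cmod z < 1"
  using Moebius_function_compose[of a "-a" z] that by simp

lemma cmod_scale_lt_1:
  fixes m :: complex
  assumes "cmod m < 1" "0 \<le> s" "s \<le> 1"
  shows "cmod (of_real s * m) < 1"
proof -
  have "cmod (of_real s * m) \<le> 1 * cmod m"
    unfolding norm_mult by (rule mult_right_mono) (use assms in auto)
  then show ?thesis using assms(1) by simp
qed

text \<open>This is |1 - cnj a z|^2 - |z - a|^2 = (1 - |a|^2)(1 - |z|^2) divided by the first term.
  It carries the conformal factor of the metric through \<open>mob a\<close>, and both the unit
  speed of \<open>pgeod\<close> and the triangle inequality use it.\<close>

lemma one_minus_mob:
  assumes "cmod a < 1" "cmod z < 1"
  shows "1 - (cmod (mob a z))\<^sup>2 = (1 - (cmod a)\<^sup>2) * (1 - (cmod z)\<^sup>2) / (cmod (1 - cnj a * z))\<^sup>2"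
proof -
  have nz: "(cmod (1 - cnj a * z))\<^sup>2 \<noteq> 0" using mob_denom_nz[OF assms] by simp
  have e: "(cmod (mob a z))\<^sup>2 = (cmod (z - a))\<^sup>2 / (cmod (1 - cnj a * z))\<^sup>2"
    by (simp add: mob_eq norm_divide power_divide)
  have "(cmod (1 - cnj a * z))\<^sup>2 - (cmod (z - a))\<^sup>2 = (1 - (cmod a)\<^sup>2) * (1 - (cmod z)\<^sup>2)"
    by (simp add: cmod_power2) (simp add: power2_eq_square algebra_simps)
  then show ?thesis unfolding e using nz by (simp add: field_simps)
qed

lemma mob_eq_0_iff: "mob a z = 0 \<longleftrightarrow> z = a" if "cmod a < 1" "cmod z < 1"
  using mob_denom_nz[OF that] by (simp add: mob_eq)

lemma cmod_mob_commute: "cmod (mob a z) = cmod (mob z a)"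
proof -
  have "cmod (1 - cnj a * z) = cmod (1 - cnj z * a)"
    by (metis complex_cnj_cnj complex_cnj_diff complex_cnj_mult complex_cnj_one complex_mod_cnj mult.commute)
  then show ?thesis by (simp add: mob_eq norm_divide norm_minus_commute)
qed

text \<open>The hyperboloid lift of \<open>z\<close> is the ray through \<open>(1 + \<bar>z\<bar>\<^sup>2, z)\<close>; \<open>tdet\<close> is the determinant of
  three lifts, hence vanishes exactly on triples lying on a common geodesic.\<close>

definition tdet :: "complex \<Rightarrow> complex \<Rightarrow> complex \<Rightarrow> real" where
  "tdet p q z = (1 + (cmod p)\<^sup>2) * Im (cnj q * z) + (1 + (cmod q)\<^sup>2) * Im (cnj z * p)
     + (1 + (cmod z)\<^sup>2) * Im (cnj p * q)"

lemma tdet_cyclic: "tdet q z p = tdet p q z"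
  by (simp add: tdet_def)

lemma tdet_same [simp]: "tdet p q p = 0" "tdet p q q = 0" "tdet p p q = 0"
  by (simp_all add: tdet_def algebra_simps)

text \<open>The lift of z enters \<open>tdet\<close> linearly through 1 + |z|^2, Re z and Im z, so
  linear relations between lifts pass to determinants.\<close>

lemma tdet_linear:
  assumes "K * (1 + (cmod z)\<^sup>2) = \<kappa> * (1 + (cmod a)\<^sup>2) + \<mu> * (1 + (cmod b)\<^sup>2)"
    and "of_real K * z = of_real \<kappa> * a + of_real \<mu> * b"
  shows "K * tdet p q z = \<kappa> * tdet p q a + \<mu> * tdet p q b"
proof -
  have re: "K * Re z = \<kappa> * Re a + \<mu> * Re b" and im: "K * Im z = \<kappa> * Im a + \<mu> * Im b"
    using arg_cong[OF assms(2), of Re] arg_cong[OF assms(2), of Im] by simp_all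
  have lin: "tdet p q x = (1 + (cmod p)\<^sup>2) * (Re q * Im x - Im q * Re x)
      + (1 + (cmod q)\<^sup>2) * (Re x * Im p - Im x * Re p)
      + (1 + (cmod x)\<^sup>2) * Im (cnj p * q)" for x by (simp add: tdet_def)
  have "K * tdet p q z = (1 + (cmod p)\<^sup>2) * (Re q * (K * Im z) - Im q * (K * Re z))
      + (1 + (cmod q)\<^sup>2) * ((K * Re z) * Im p - (K * Im z) * Re p)
      + (K * (1 + (cmod z)\<^sup>2)) * Im (cnj p * q)" unfolding lin by algebra
  also have "\<dots> = \<kappa> * tdet p q a + \<mu> * tdet p q b" unfolding re im assms(1) lin by algebra
  finally show ?thesis .
qed

text \<open>After \<open>mob p\<close> the geodesic from p to q is a diameter, and the imaginary
  part tells on which side of it z lies. The link to \<open>tdet\<close> lets linear statements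
  about lifts be read as statements about angles at p.\<close>

lemma Im_mob_mob:
  assumes "cmod p < 1" "cmod q < 1" "cmod z < 1"
  shows "\<exists>k>0. Im (cnj (mob p q) * mob p z) = k * tdet p q z"
proof -
  define d where "d = 1 - cnj p * q"
  define e where "e = 1 - cnj p * z"
  have nz: "d \<noteq> 0" "e \<noteq> 0" using mob_denom_nz assms by (auto simp: d_def e_def)
  have 1: "cnj (mob p q) * mob p z
      = (cnj (q - p) * d) * ((z - p) * cnj e) / of_real ((cmod d)\<^sup>2 * (cmod e)\<^sup>2)"
  proof -
    have "of_real ((cmod d)\<^sup>2 * (cmod e)\<^sup>2) = d * cnj d * (e * cnj e)"
      by (simp only: of_real_mult complex_norm_square)
    moreover have "cnj (mob p q) * mob p z = cnj (q - p) * (z - p) / (cnj d * e)"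
      by (simp add: mob_eq d_def e_def)
    moreover have "X / (cnj d * e) = (X * (d * cnj e)) / (d * cnj d * (e * cnj e))" for X
      using nz by (simp add: divide_simps)
    ultimately show ?thesis by (simp only: mult_ac)
  qed
  have 2: "Im ((cnj (q - p) * d) * ((z - p) * cnj e)) = (1 - (cmod p)\<^sup>2) * tdet p q z"
    unfolding d_def e_def tdet_def
    by (simp add: cmod_power2) (simp add: power2_eq_square algebra_simps)
  have "Im (cnj (mob p q) * mob p z)
      = ((1 - (cmod p)\<^sup>2) / ((cmod d)\<^sup>2 * (cmod e)\<^sup>2)) * tdet p q z"
    unfolding 1 Im_divide_of_real 2 by simp
  moreover have "(1 - (cmod p)\<^sup>2) / ((cmod d)\<^sup>2 * (cmod e)\<^sup>2) > 0"
    using nz assms(1) by (simp add: power_less_one_iff abs_square_less_1)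
  ultimately show ?thesis by blast
qed

section \<open>Geodesic segments as chords of the hyperboloid\<close>

definition psegpt :: "complex \<Rightarrow> complex \<Rightarrow> real \<Rightarrow> complex" where
  "psegpt a b s = mob (- a) (of_real s * mob a b)"

text \<open>Geodesic segments are the projections of chords of the hyperboloid: clearing the denominators
  in \<open>mob (- a) (s * mob a b)\<close> gives these coefficients.\<close>

definition lift_fst :: "complex \<Rightarrow> complex \<Rightarrow> real \<Rightarrow> real" where
  "lift_fst a b s = (1 - s) * ((1 - s * (cmod a)\<^sup>2 - s * (cmod b)\<^sup>2 + (cmod a)\<^sup>2 * (cmod b)\<^sup>2)
      - 2 * (1 - s) * Re (a * cnj b))"

definition lift_snd :: "complex \<Rightarrow> real \<Rightarrow> real" where
  "lift_snd a s = s * (1 - (cmod a)\<^sup>2)\<^sup>2"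

lemma pseg_psegpt: "pseg a b = psegpt a b ` {0..1}"
  by (auto simp: pseg_def psegpt_def)

lemma psegpt_in_disc:
  assumes "cmod a < 1" "cmod b < 1" "0 \<le> s" "s \<le> 1"
  shows "cmod (psegpt a b s) < 1"
  unfolding psegpt_def using assms by (intro mob_lt_1 cmod_scale_lt_1) auto

lemma psegpt_lift:
  assumes "cmod a < 1" "cmod b < 1" "0 \<le> s" "s \<le> 1"
  obtains K where "K > 0"
    "K * (1 + (cmod (psegpt a b s))\<^sup>2)
       = lift_fst a b s * (1 + (cmod a)\<^sup>2) + lift_snd a s * (1 + (cmod b)\<^sup>2)"
    "of_real K * psegpt a b s = of_real (lift_fst a b s) * a + of_real (lift_snd a s) * b"
proof
  define d where "d = 1 - cnj a * b"
  define m where "m = mob a b"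
  \<comment> \<open>With m = (b - a) / d, multiplying numerator and denominator of
    \<open>mob (- a) (s * m)\<close> by d gives N / D. Multiplying further by cnj D makes the
    denominator real, so K is |D|^2.\<close>
  define D where "D = (1 - of_real (s * (cmod a)\<^sup>2)) - of_real (1 - s) * cnj a * b"
  define N where "N = of_real (1 - s) * a + of_real (s - (cmod a)\<^sup>2) * b"
  have nd: "d \<noteq> 0" using mob_denom_nz assms by (auto simp: d_def)
  have m: "m = (b - a) / d" by (simp add: m_def mob_eq d_def)
  have n1: "1 + cnj a * (of_real s * m) \<noteq> 0"
    unfolding m_def using assms by (intro mob_denom_nz' cmod_scale_lt_1 mob_lt_1)
  have aa: "of_real ((cmod a)\<^sup>2) = cnj a * a" by (simp only: complex_norm_square mult.commute)
  have dm: "d * m = b - a" using nd by (simp add: m)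
  have D: "D = d * (1 + cnj a * (of_real s * m))"
  proof -
    have "d * (1 + cnj a * (of_real s * m)) = d + cnj a * of_real s * (d * m)" by algebra
    also have "\<dots> = D" unfolding dm unfolding D_def of_real_mult aa d_def by (simp add: algebra_simps)
    finally show ?thesis ..
  qed
  have N: "N = d * (of_real s * m + a)"
  proof -
    have "d * (of_real s * m + a) = of_real s * (d * m) + d * a" by algebra
    also have "\<dots> = N" unfolding dm unfolding N_def of_real_diff aa d_def by (simp add: algebra_simps)
    finally show ?thesis ..
  qed
  have nD: "D \<noteq> 0" using D nd n1 by simp
  have z: "psegpt a b s = N / D"
    using nd n1 by (simp add: psegpt_def mob_minus_eq N D flip: m_def)
  show "(cmod D)\<^sup>2 > 0" using nD by simp
  have zD: "of_real ((cmod D)\<^sup>2) * psegpt a b s = N * cnj D"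
    unfolding complex_norm_square z using nD by simp
  have "N * cnj D = of_real (lift_fst a b s) * a + of_real (lift_snd a s) * b"
    unfolding N_def D_def lift_fst_def lift_snd_def complex_eq_iff
    by (simp add: cmod_power2) (simp add: power2_eq_square algebra_simps)
  with zD show "of_real ((cmod D)\<^sup>2) * psegpt a b s = of_real (lift_fst a b s) * a + of_real (lift_snd a s) * b"
    by simp
  have "(cmod D)\<^sup>2 * (1 + (cmod (psegpt a b s))\<^sup>2) = (cmod D)\<^sup>2 + (cmod N)\<^sup>2"
    using nD by (simp add: z norm_divide power_divide field_simps)
  also have "\<dots> = lift_fst a b s * (1 + (cmod a)\<^sup>2) + lift_snd a s * (1 + (cmod b)\<^sup>2)"
    unfolding N_def D_def lift_fst_def lift_snd_def
    by (simp add: cmod_power2) (simp add: power2_eq_square algebra_simps)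
  finally show "(cmod D)\<^sup>2 * (1 + (cmod (psegpt a b s))\<^sup>2)
       = lift_fst a b s * (1 + (cmod a)\<^sup>2) + lift_snd a s * (1 + (cmod b)\<^sup>2)" .
qed

lemma lift_snd_nonneg: "0 \<le> s \<Longrightarrow> lift_snd a s \<ge> 0"
  and lift_snd_pos: "cmod a < 1 \<Longrightarrow> 0 < s \<Longrightarrow> lift_snd a s > 0"
  using power_strict_mono[of "cmod a" 1 2] by (auto simp: lift_snd_def)

text \<open>Bounding Re (a cnj b) by A B leaves a convex combination of (1 - A B)^2 and (1 - A^2)(1
  - B^2), in which the first has the positive weight 1 - s.\<close>

lemma lift_fst_pos:
  assumes "cmod a < 1" "cmod b < 1" "0 \<le> s" "s < 1"
  shows "lift_fst a b s > 0"
proof -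
  define A where "A = cmod a"
  define B where "B = cmod b"
  have AB: "0 \<le> A" "A < 1" "0 \<le> B" "B < 1" using assms by (auto simp: A_def B_def)
  have "Re (a * cnj b) \<le> A * B"
    using complex_Re_le_cmod[of "a * cnj b"] by (simp add: A_def B_def norm_mult)
  then have "2 * (1 - s) * Re (a * cnj b) \<le> 2 * (1 - s) * (A * B)"
    using assms by (intro mult_left_mono) auto
  moreover have "A * B < 1" using AB mult_strict_mono'[of A 1 B 1] by simp
  then have "(1 - s) * (1 - A * B)\<^sup>2 > 0" using assms by simp
  moreover have "s * ((1 - A\<^sup>2) * (1 - B\<^sup>2)) \<ge> 0"
    using AB assms by (intro mult_nonneg_nonneg) (auto simp: abs_square_le_1)
  moreover have "(1 - s) * (1 - A * B)\<^sup>2 + s * ((1 - A\<^sup>2) * (1 - B\<^sup>2))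
      = (1 - s * A\<^sup>2 - s * B\<^sup>2 + A\<^sup>2 * B\<^sup>2) - 2 * (1 - s) * (A * B)"
    by (simp add: power2_eq_square algebra_simps)
  ultimately have "(1 - s * A\<^sup>2 - s * B\<^sup>2 + A\<^sup>2 * B\<^sup>2) - 2 * (1 - s) * Re (a * cnj b) > 0"
    by linarith
  then show ?thesis using assms by (simp add: lift_fst_def A_def B_def)
qed

lemma lift_fst_nonneg: "cmod a < 1 \<Longrightarrow> cmod b < 1 \<Longrightarrow> 0 \<le> s \<Longrightarrow> s \<le> 1 \<Longrightarrow> lift_fst a b s \<ge> 0"
  using lift_fst_pos[of a b s] by (cases "s = 1") (auto simp: lift_fst_def)

text \<open>Different points of the disc lift to different rays: x / (1 + x^2) is injective on [0,
  1), as (x - y)(1 - x y) = 0 forces x = y. Equal moduli give equal factors, hence equal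
  points.\<close>

lemma lift_inject:
  assumes "k * (1 + (cmod z)\<^sup>2) = k' * (1 + (cmod z')\<^sup>2)" "of_real k * z = of_real k' * z'"
    and "cmod z < 1" "cmod z' < 1" "k > 0" "k' > 0"
  shows "z = z'"
proof -
  have m: "k * cmod z = k' * cmod z'" using arg_cong[OF assms(2), of cmod] assms(5,6) by (simp add: norm_mult)
  define x where "x = cmod z"
  define y where "y = cmod z'"
  have xy: "0 \<le> x" "x < 1" "0 \<le> y" "y < 1" using assms by (auto simp: x_def y_def)
  have "k * k' * ((1 + x\<^sup>2) * y) = k' * ((k * (1 + x\<^sup>2)) * y)" by algebra
  also have "\<dots> = k' * (1 + y\<^sup>2) * (k' * y)" using assms(1) by (simp add: x_def y_def)
  also have "\<dots> = k * k' * ((1 + y\<^sup>2) * x)" using m by (simp add: x_def y_def)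
  finally have "(1 + x\<^sup>2) * y = (1 + y\<^sup>2) * x" using assms(5,6) by simp
  then have "(x - y) * (1 - x * y) = 0" by (simp add: power2_eq_square algebra_simps)
  moreover have "x * y < 1" using xy mult_strict_mono'[of x 1 y 1] by simp
  ultimately have "x = y" by simp
  then have "k = k'" using assms(1) by (simp add: x_def y_def add_pos_nonneg) (smt (verit) zero_le_power2)
  then show ?thesis using assms by simp
qed

text \<open>Converse of \<open>psegpt_lift\<close>. As s runs from 0 to 1 the ratio of
  \<open>lift_snd\<close> to \<open>lift_fst\<close> runs from 0 to infinity, so some s realises the
  ratio of \<beta> to \<alpha>; the factor c then matches the coefficients themselves.\<close>

lemma pseg_lift_surj:
  assumes a: "cmod a < 1" and b: "cmod b < 1" and al: "\<alpha> \<ge> 0" "\<beta> \<ge> 0" "\<alpha> + \<beta> > 0"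
  obtains z K where "z \<in> pseg a b" "K > 0"
    "K * (1 + (cmod z)\<^sup>2) = \<alpha> * (1 + (cmod a)\<^sup>2) + \<beta> * (1 + (cmod b)\<^sup>2)"
    "of_real K * z = of_real \<alpha> * a + of_real \<beta> * b"
proof -
  define f where "f s = \<beta> * lift_fst a b s - \<alpha> * lift_snd a s" for s
  have f0: "f 0 \<ge> 0" using lift_fst_pos[OF a b, of 0] al by (simp add: f_def lift_snd_def)
  have f1: "f 1 \<le> 0" using lift_snd_nonneg[of 1 a] al by (simp add: f_def lift_fst_def)
  have "continuous_on {0..1} f" unfolding f_def lift_fst_def lift_snd_def by (intro continuous_intros)
  then obtain s where s: "0 \<le> s" "s \<le> 1" "f s = 0"
    using IVT2'[of f 1 0 0] f0 f1 by auto
  obtain k where k: "k > 0"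
    "k * (1 + (cmod (psegpt a b s))\<^sup>2)
       = lift_fst a b s * (1 + (cmod a)\<^sup>2) + lift_snd a s * (1 + (cmod b)\<^sup>2)"
    "of_real k * psegpt a b s = of_real (lift_fst a b s) * a + of_real (lift_snd a s) * b"
    using psegpt_lift[OF a b s(1,2)] by blast
  define S where "S = lift_fst a b s + lift_snd a s"
  have S: "S > 0"
    using lift_fst_pos[OF a b, of s] lift_fst_nonneg[OF a b, of s] lift_snd_pos[OF a, of s]
      lift_snd_nonneg[of s a] s by (cases "s < 1") (auto simp: S_def add_pos_nonneg add_nonneg_pos)
  define c where "c = (\<alpha> + \<beta>) / S"
  have c: "c > 0" using S al by (simp add: c_def)
  have c1: "c * lift_fst a b s = \<alpha>" and c2: "c * lift_snd a s = \<beta>"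
    using s(3) S by (simp_all add: c_def f_def S_def field_simps)
  show ?thesis
  proof (rule that[of "psegpt a b s" "c * k"])
    show "psegpt a b s \<in> pseg a b" using s by (auto simp: pseg_psegpt)
    show "c * k > 0" using c k by simp
    show "c * k * (1 + (cmod (psegpt a b s))\<^sup>2) = \<alpha> * (1 + (cmod a)\<^sup>2) + \<beta> * (1 + (cmod b)\<^sup>2)"
      using arg_cong[OF k(2), of "\<lambda>x. c * x"] by (simp add: algebra_simps flip: c1 c2)
    show "of_real (c * k) * psegpt a b s = of_real \<alpha> * a + of_real \<beta> * b"
      using arg_cong[OF k(3), of "\<lambda>x. of_real c * x"] by (simp add: algebra_simps flip: c1 c2)
  qed
qed

section \<open>Moebius maps as isometries and the hyperbolic distance\<close>

lemma tanh_artanh: "tanh (artanh x) = x" if "\<bar>x\<bar> < 1" for x :: real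
proof -
  define q where "q = (1 + x) / (1 - x)"
  have q: "q > 0" using that by (auto simp: q_def)
  have "exp (2 * artanh x) = q" using q by (simp add: artanh_def q_def)
  then have "exp (- 2 * artanh x) = inverse q" by (simp add: exp_minus)
  then have "tanh (artanh x) = (1 - inverse q) / (1 + inverse q)" by (simp add: tanh_real_altdef)
  also have "\<dots> = ((1 - inverse q) * q) / ((1 + inverse q) * q)" using q by simp
  also have "(1 - inverse q) * q = q - 1" using q by (simp add: left_diff_distrib)
  also have "(1 + inverse q) * q = q + 1" using q by (simp add: distrib_right)
  also have "(q - 1) / (q + 1) = (2 * x / (1 - x)) / (2 / (1 - x))"
    using that by (intro arg_cong2[of _ _ _ _ "(/)"]) (auto simp: q_def field_simps)
  finally show ?thesis using that by auto
qed

text \<open>An automorphism of the disc taking 0 to \<open>mob A z\<close> is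
  \<open>mob (- mob A z)\<close> preceded by a rotation. The rotation is made explicit because it
  records how \<open>mob A\<close> turns the direction of a geodesic.\<close>

lemma mob_mob:
  assumes A: "cmod A < 1" and z: "cmod z < 1" and x: "cmod x < 1"
  shows "mob A (mob (- z) x) = mob (- mob A z) ((1 - A * cnj z) / (1 - cnj A * z) * x)"
proof -
  define d where "d = 1 - cnj A * z"
  define e where "e = 1 + cnj z * x"
  define g where "g = d + x * (cnj z - cnj A)"
  have d: "d \<noteq> 0" and e: "e \<noteq> 0" using mob_denom_nz[OF A z] mob_denom_nz'[OF z x] by (auto simp: d_def e_def)
  have d': "cnj d = 1 - A * cnj z" by (simp add: d_def)
  have w: "cmod (mob (- z) x) < 1" using z x by (intro mob_lt_1) auto
  have mz: "mob (- z) x = (x + z) / e" by (simp add: mob_minus_eq e_def)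
  have g1: "1 - cnj A * ((x + z) / e) = g / e"
    using e by (simp add: field_simps) (simp add: g_def d_def e_def algebra_simps)
  have "1 - cnj A * mob (- z) x \<noteq> 0" by (rule mob_denom_nz[OF A w])
  then have g: "g \<noteq> 0" unfolding mz g1 by auto
  have "(x + z) / e - A = (x + z - A * e) / e" using e by (simp add: diff_divide_distrib)
  then have lhs: "mob A (mob (- z) x) = (x + z - A * e) / g"
    unfolding mob_eq[of A] mz g1 using e by simp
  have y: "mob A z = (z - A) / d" by (simp add: mob_eq d_def)
  have "(cnj d / d * x + (z - A) / d) = (x + z - A * e) / d"
    using d by (simp add: field_simps d' e_def) 
  moreover have "1 + cnj ((z - A) / d) * (cnj d / d * x) = g / d"
    using d by (simp add: field_simps g_def)
  ultimately have "mob (- mob A z) (cnj d / d * x) = (x + z - A * e) / g"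
    unfolding mob_minus_eq y using d g by simp
  then show ?thesis unfolding lhs d' by (simp add: d_def)
qed

lemma rotation_unit: "cmod ((1 - A * cnj z) / (1 - cnj A * z)) = 1" if "cmod A < 1" "cmod z < 1"
proof -
  have "1 - A * cnj z = cnj (1 - cnj A * z)" by simp
  then have "cmod (1 - A * cnj z) = cmod (1 - cnj A * z)" by (simp only: complex_mod_cnj)
  then show ?thesis using mob_denom_nz[OF that] by (simp add: norm_divide)
qed

text \<open>With w written as \<open>mob (- z) (mob z w)\<close>, \<open>mob_mob\<close> shows that
  the two sides differ by the unit factor c only.\<close>

lemma mob_isometry:
  assumes "cmod a < 1" "cmod z < 1" "cmod w < 1"
  shows "cmod (mob (mob a z) (mob a w)) = cmod (mob z w)"
proof -
  define c where "c = (1 - a * cnj z) / (1 - cnj a * z)"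
  have c: "cmod c = 1" unfolding c_def by (rule rotation_unit[OF assms(1,2)])
  have zw: "cmod (mob z w) < 1" using assms by (intro mob_lt_1)
  have "mob a w = mob (- mob a z) (c * mob z w)"
    using mob_mob[OF assms(1,2) zw] mob_minus_mob[OF assms(2,3)] by (simp add: c_def)
  then have "mob (mob a z) (mob a w) = c * mob z w"
    using zw c mob_lt_1[OF assms(1,2)] by (simp add: mob_mob_minus norm_mult)
  then show ?thesis using c by (simp add: norm_mult)
qed

text \<open>By \<open>one_minus_mob\<close> the modulus grows with |1 - cnj a z|, which is at most 1
  + |a| |z|. The resulting bound is the addition formula of tanh, so this is the triangle inequality
  through the origin.\<close>

lemma mob_add_bound:
  assumes "cmod a < 1" "cmod z < 1"
  shows "cmod (mob a z) \<le> (cmod a + cmod z) / (1 + cmod a * cmod z)"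
proof -
  define x where "x = cmod a"
  define y where "y = cmod z"
  have xy: "0 \<le> x" "x < 1" "0 \<le> y" "y < 1" using assms by (auto simp: x_def y_def)
  define D where "D = cmod (1 - cnj a * z)"
  have D: "D > 0" using mob_denom_nz[OF assms] by (simp add: D_def)
  have "D \<le> 1 + x * y" unfolding D_def x_def y_def
    using norm_triangle_ineq4[of 1 "cnj a * z"] by (simp add: norm_mult)
  then have "(1 - x\<^sup>2) * (1 - y\<^sup>2) / (1 + x * y)\<^sup>2 \<le> (1 - x\<^sup>2) * (1 - y\<^sup>2) / D\<^sup>2"
    using D xy by (intro divide_left_mono power_mono mult_nonneg_nonneg mult_pos_pos)
      (auto simp: abs_square_le_1 add_pos_nonneg)
  also have "\<dots> = 1 - (cmod (mob a z))\<^sup>2"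
    using one_minus_mob[OF assms] by (simp add: x_def y_def D_def)
  finally have "(cmod (mob a z))\<^sup>2 \<le> 1 - (1 - x\<^sup>2) * (1 - y\<^sup>2) / (1 + x * y)\<^sup>2" by simp
  also have "\<dots> = ((x + y) / (1 + x * y))\<^sup>2"
  proof -
    have "1 + x * y > 0" using xy by (simp add: add_pos_nonneg)
    moreover have "(1 + x * y)\<^sup>2 - (1 - x\<^sup>2) * (1 - y\<^sup>2) = (x + y)\<^sup>2"
      by (simp add: power2_eq_square algebra_simps)
    ultimately show ?thesis by (simp add: power_divide field_simps)
  qed
  finally show ?thesis unfolding x_def y_def
    by (rule power2_le_imp_le) (simp add: add_nonneg_nonneg)
qed

text \<open>Closed form of the distance for curvature -1. That it computes the infimum of lengths in
  the double is shown, for distances to a vertex, in \<open>sdist_eq\<close>.\<close>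

definition hdist :: "complex \<Rightarrow> complex \<Rightarrow> real" where
  "hdist a z = 2 * artanh (cmod (mob a z))"

lemma tanh_half_hdist: "tanh (hdist a z / 2) = cmod (mob a z)" if "cmod a < 1" "cmod z < 1"
  using mob_lt_1[OF that] by (simp add: hdist_def tanh_artanh)

lemma hdist_commute: "hdist a z = hdist z a"
  by (simp add: hdist_def cmod_mob_commute)

text \<open>The isometry \<open>mob w\<close> moves the middle point to the origin, where
  \<open>mob_add_bound\<close> applies.\<close>

lemma hdist_triangle:
  assumes "cmod a < 1" "cmod w < 1" "cmod z < 1"
  shows "hdist a z \<le> hdist a w + hdist w z"
proof -
  have m: "cmod (mob w a) < 1" "cmod (mob w z) < 1" using mob_lt_1 assms by auto
  have "tanh (hdist a z / 2) = cmod (mob (mob w a) (mob w z))"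
    using mob_isometry[of w a z] assms by (simp add: tanh_half_hdist)
  also have "\<dots> \<le> (cmod (mob w a) + cmod (mob w z)) / (1 + cmod (mob w a) * cmod (mob w z))"
    by (rule mob_add_bound[OF m])
  also have "\<dots> = tanh (hdist w a / 2 + hdist w z / 2)"
    using assms by (subst tanh_add) (auto simp: tanh_half_hdist cosh_real_pos less_imp_neq[symmetric])
  finally have "hdist a z / 2 \<le> hdist w a / 2 + hdist w z / 2" by (simp only: tanh_real_le_iff)
  then show ?thesis by (simp add: hdist_commute)
qed

text \<open>The hypotheses place \<zeta> in the closed sector from the positive real axis to \<eta>,
  on the side chosen by s. They fix the signs of the sines of A, B and B - A, and since
  \<open>Arg\<close> stays in one period these signs order the angles.\<close>

lemma Arg_sector:
  assumes s: "s = 1 \<or> s = -1" and e: "s * Im \<eta> > 0" and z: "\<zeta> \<noteq> 0"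
    and "s * Im \<zeta> \<ge> 0" "s * Im (cnj \<zeta> * \<eta>) \<ge> 0"
  shows "0 \<le> s * Arg \<zeta>" "s * Arg \<zeta> \<le> s * Arg \<eta>"
proof -
  define A where "A = Arg \<zeta>"
  define B where "B = Arg \<eta>"
  have AB: "-pi < A" "A \<le> pi" "-pi < B" "B \<le> pi" using Arg_bounded by (auto simp: A_def B_def)
  have e0: "\<eta> \<noteq> 0" using e by auto
  have iz: "Im \<zeta> = cmod \<zeta> * sin A" and ie: "Im \<eta> = cmod \<eta> * sin B"
    using z e0 by (simp_all add: A_def B_def sin_Arg)
  have "Re \<zeta> = cmod \<zeta> * cos A" "Re \<eta> = cmod \<eta> * cos B"
    using z e0 by (simp_all add: A_def B_def cos_Arg)
  then have ize: "Im (cnj \<zeta> * \<eta>) = cmod \<zeta> * cmod \<eta> * sin (B - A)"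
    using iz ie by (simp add: sin_diff algebra_simps)
  have 1: "s * sin A \<ge> 0"
    using assms(4) z s unfolding iz by (auto simp: zero_le_mult_iff mult_le_0_iff)
  have 2: "s * sin B > 0"
    using e e0 s unfolding ie by (auto simp: zero_less_mult_iff mult_less_0_iff)
  have 3: "s * sin (B - A) \<ge> 0"
    using assms(5) z e0 s unfolding ize by (auto simp: zero_le_mult_iff mult_le_0_iff)
  have nonneg: "x \<ge> 0" if "sin x \<ge> 0" "-pi < x" for x :: real
    using sin_gt_zero[of "-x"] that by (force simp: not_le[symmetric])
  show "0 \<le> s * Arg \<zeta>" "s * Arg \<zeta> \<le> s * Arg \<eta>"
  proof -
    from s have "0 \<le> s * A \<and> s * A \<le> s * B"
    proof
      assume [simp]: "s = 1"
      have "A \<ge> 0" "B \<ge> 0" using nonneg AB 1 2 by auto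
      moreover have "B > 0" using 2 \<open>B \<ge> 0\<close> by (cases "B = 0") auto
      ultimately show ?thesis using nonneg[of "B - A"] 3 AB by auto
    next
      assume [simp]: "s = -1"
      have "B < 0" using 2 AB sin_ge_zero[of B] by force
      \<comment> \<open>The value pi of \<open>Arg\<close> passes the sign test on sin A without
        being nonpositive; sin (B - A) rules it out.\<close>
      have "A \<noteq> pi"
      proof
        assume "A = pi"
        then have "sin (B - A) = - sin B" by (simp add: sin_diff)
        then show False using 2 3 by auto
      qed
      then have "A \<le> 0" using 1 AB sin_gt_zero[of A] by force
      then show ?thesis using nonneg[of "A - B"] 3 AB \<open>B < 0\<close> sin_minus[of "B - A"] by auto
    qed
    then show "0 \<le> s * Arg \<zeta>" "s * Arg \<zeta> \<le> s * Arg \<eta>" by (auto simp: A_def B_def)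
  qed
qed

section \<open>The geodesic triangle\<close>

lemma three_cases: "(i::3) = 0 \<or> i = 1 \<or> i = 2"
  using exhaust_3[of i] by auto

lemma num_3: "(3::3) = 0" "(4::3) = 1"
  by simp_all

lemma pconvex_hull_subset: "a \<in> pconvex hull S \<Longrightarrow> b \<in> pconvex hull S \<Longrightarrow> pseg a b \<subseteq> pconvex hull S"
  unfolding hull_def pconvex_def by blast

locale nondegenerate_triangle =
  fixes V :: "3 \<Rightarrow> complex"
  assumes nondeg: "nondegenerate V"
begin

lemma vertex_disc: "cmod (V i) < 1"
  using nondeg by (simp add: nondegenerate_def)

lemma tdet_vertices_nz: "tdet (V 0) (V 1) (V 2) \<noteq> 0"
proof
  assume 0: "tdet (V 0) (V 1) (V 2) = 0"
  define m where "m i = mob (V 0) (V i)" for i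
  \<comment> \<open>The common direction of the vertices seen from \<open>V 0\<close>; the case
    distinction also covers coinciding vertices.\<close>
  define u where "u = (if m 1 \<noteq> 0 then sgn (m 1) else if m 2 \<noteq> 0 then sgn (m 2) else 1)"
  have u: "cmod u = 1" by (simp add: u_def norm_sgn)
  have m0: "m 0 = 0" by (simp add: m_def mob_eq)
  have im: "Im (cnj (m 1) * m 2) = 0"
    using Im_mob_mob[of "V 0" "V 1" "V 2"] vertex_disc 0 by (auto simp: m_def)
  have m2: "\<exists>r::real. m 2 = of_real r * u"
  proof (cases "m 1 = 0")
    case True
    then show ?thesis by (intro exI[of _ "cmod (m 2)"]) (auto simp: u_def sgn_eq)
  next
    case False
    have "cnj (m 1) * m 2 = of_real (Re (cnj (m 1) * m 2))" using im by (simp add: complex_eq_iff)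
    then obtain k where k: "cnj (m 1) * m 2 = of_real k" by blast
    then have "m 2 * of_real ((cmod (m 1))\<^sup>2) = m 1 * of_real k"
      unfolding complex_norm_square by (simp add: mult_ac)
    then have "m 2 = of_real (k / cmod (m 1)) * sgn (m 1)"
      using False by (simp add: sgn_eq field_simps power2_eq_square)
    moreover have "u = sgn (m 1)" using False by (simp add: u_def)
    ultimately show ?thesis by blast
  qed
  have m1: "m 1 = of_real (cmod (m 1)) * u" by (auto simp: u_def sgn_eq)
  have "\<exists>r::real. m i = of_real r * u" for i
    using three_cases[of i] m0 m1 m2 by (metis mult_zero_left of_real_0)
  then obtain r where r: "\<And>i. m i = of_real (r i) * u" by metis
  have "V i \<in> range (pgeod (V 0) u)" for i
  proof -
    have "cmod (m i) < 1" using mob_lt_1 vertex_disc by (simp add: m_def)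
    then have "\<bar>r i\<bar> < 1" using u by (simp add: r norm_mult)
    then have "pgeod (V 0) u (2 * artanh (r i)) = mob (- V 0) (m i)"
      by (simp add: pgeod_def r tanh_artanh)
    also have "\<dots> = V i" using mob_minus_mob vertex_disc by (simp add: m_def)
    finally show ?thesis by (metis rangeI)
  qed
  then have "range V \<subseteq> range (pgeod (V 0) u)" by auto
  then show False using nondeg u vertex_disc unfolding nondegenerate_def by blast
qed

text \<open>The vertices may be listed in either orientation. This sign makes the coordinates below
  positive inside the triangle in both cases.\<close>

definition sg :: real where "sg = sgn (tdet (V 0) (V 1) (V 2))"

lemma sg_cases: "sg = 1 \<or> sg = -1"
  using tdet_vertices_nz by (auto simp: sg_def sgn_if)

text \<open>Up to positive factors, \<open>bary j z\<close> are the barycentric coordinates of the lift of \<open>z\<close> with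
  respect to the lifts of the vertices.\<close>

definition bary :: "3 \<Rightarrow> complex \<Rightarrow> real" where
  "bary j z = sg * tdet (V (j + 1)) (V (j + 2)) z"

lemma add_3: "(i::3) + 1 + 1 = i + 2" "(i::3) + 1 + 2 = i" "(i::3) + 2 + 1 = i" "(i::3) + 2 + 2 = i + 1"
  using three_cases[of i] by auto

lemma bary_vertex: "bary j (V j) > 0" "bary j (V (j + 1)) = 0" "bary j (V (j + 2)) = 0"
proof -
  have "bary j (V j) = sg * tdet (V 0) (V 1) (V 2)"
    using three_cases[of j] tdet_cyclic[of "V 1" "V 2" "V 0"] tdet_cyclic[of "V 2" "V 0" "V 1"]
    by (auto simp: bary_def num_3) 
  also have "\<dots> > 0" using tdet_vertices_nz by (auto simp: sg_def sgn_if)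
  finally show "bary j (V j) > 0" .
qed (simp_all add: bary_def)

lemma bary_vertex_nonneg: "bary j (V i) \<ge> 0"
proof -
  have "i = j \<or> i = j + 1 \<or> i = j + 2" using three_cases[of i] three_cases[of j] by auto
  then show ?thesis using bary_vertex[of j] by auto
qed

text \<open>One pair of coefficients serves all three coordinates, by linearity of
  \<open>tdet\<close> in the lift. Their strict positivity is what later keeps open radial segments
  off the sides.\<close>

lemma bary_psegpt:
  assumes "cmod a < 1" "cmod b < 1" "0 \<le> s" "s \<le> 1"
  shows "\<exists>\<kappa> \<mu>. \<kappa> \<ge> 0 \<and> \<mu> \<ge> 0 \<and> (s < 1 \<longrightarrow> \<kappa> > 0) \<and> (s > 0 \<longrightarrow> \<mu> > 0) \<and>
    (\<forall>j. bary j (psegpt a b s) = \<kappa> * bary j a + \<mu> * bary j b)"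
proof -
  obtain K where K: "K > 0"
    "K * (1 + (cmod (psegpt a b s))\<^sup>2)
       = lift_fst a b s * (1 + (cmod a)\<^sup>2) + lift_snd a s * (1 + (cmod b)\<^sup>2)"
    "of_real K * psegpt a b s = of_real (lift_fst a b s) * a + of_real (lift_snd a s) * b"
    using psegpt_lift[OF assms] by blast
  have "tdet p q (psegpt a b s) = lift_fst a b s / K * tdet p q a + lift_snd a s / K * tdet p q b" for p q
    using tdet_linear[OF K(2,3), of p q] K(1) by (simp add: field_simps)
  then have "bary j (psegpt a b s) = lift_fst a b s / K * bary j a + lift_snd a s / K * bary j b" for j
    by (simp add: bary_def algebra_simps)
  moreover have "lift_fst a b s \<ge> 0" "lift_snd a s \<ge> 0" "s < 1 \<longrightarrow> lift_fst a b s > 0" "s > 0 \<longrightarrow> lift_snd a s > 0"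
    using assms lift_fst_pos lift_fst_nonneg lift_snd_pos lift_snd_nonneg by auto
  ultimately show ?thesis
    using K(1) by (intro exI[of _ "lift_fst a b s / K"] exI[of _ "lift_snd a s / K"]) simp
qed

text \<open>The set C cut out by these inequalities is geodesically convex by
  \<open>bary_psegpt\<close> and contains the vertices, hence it contains the hull.\<close>

lemma triangle_bary:
  assumes "z \<in> triangle V"
  shows "cmod z < 1" "bary j z \<ge> 0"
proof -
  define C where "C = {z. cmod z < 1 \<and> (\<forall>j. bary j z \<ge> 0)}"
  have "pconvex C" unfolding pconvex_def
  proof (intro conjI ballI)
    show "C \<subseteq> ball 0 1" by (auto simp: C_def)
    fix a b assume ab: "a \<in> C" "b \<in> C"
    then have abs: "cmod a < 1" "cmod b < 1" by (auto simp: C_def)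
    have "psegpt a b s \<in> C" if s: "0 \<le> s" "s \<le> 1" for s
    proof -
      obtain \<kappa> \<mu> where "\<kappa> \<ge> 0" "\<mu> \<ge> 0" "\<And>j. bary j (psegpt a b s) = \<kappa> * bary j a + \<mu> * bary j b"
        using bary_psegpt[OF abs s(1,2)] by blast
      then show "psegpt a b s \<in> C" using psegpt_in_disc[OF abs s] ab by (auto simp: C_def)
    qed
    then show "pseg a b \<subseteq> C" by (auto simp: pseg_psegpt)
  qed
  moreover have "range V \<subseteq> C" using vertex_disc bary_vertex_nonneg by (auto simp: C_def)
  ultimately have "z \<in> C" using assms unfolding triangle_def hull_def by blast
  then show "cmod z < 1" "bary j z \<ge> 0" by (auto simp: C_def)
qed

lemma vertex_in_triangle: "V i \<in> triangle V"
  unfolding triangle_def by (auto simp: hull_def)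

lemma pseg_triangle: "a \<in> triangle V \<Longrightarrow> b \<in> triangle V \<Longrightarrow> pseg a b \<subseteq> triangle V"
  unfolding triangle_def by (rule pconvex_hull_subset)

lemma side_subset_triangle: "side V j \<subseteq> triangle V"
  unfolding side_def by (intro pseg_triangle vertex_in_triangle)

lemma side_bary:
  assumes "z \<in> side V j"
  shows "bary j z = 0"
proof -
  obtain s where s: "0 \<le> s" "s \<le> 1" "z = psegpt (V (j + 1)) (V (j + 2)) s"
    using assms by (auto simp: side_def pseg_psegpt)
  obtain \<kappa> \<mu> where "bary j z = \<kappa> * bary j (V (j + 1)) + \<mu> * bary j (V (j + 2))"
    unfolding s(3) using bary_psegpt[OF vertex_disc vertex_disc s(1,2)] by blast
  then show ?thesis by (simp add: bary_vertex)
qed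

lemma closed_side: "closed (side V j)"
proof -
  define a where "a = V (j + 1)"
  define b where "b = V (j + 2)"
  have ab: "cmod a < 1" "cmod b < 1" using vertex_disc by (auto simp: a_def b_def)
  have nz: "1 + cnj a * (of_real s * mob a b) \<noteq> 0" if "s \<in> {0..1}" for s
    using that ab by (intro mob_denom_nz' cmod_scale_lt_1 mob_lt_1) auto
  have "continuous_on {0..1} (psegpt a b)"
    unfolding psegpt_def mob_minus_eq by (intro continuous_intros) (use nz in auto)
  then have "compact (psegpt a b ` {0..1})" by (intro compact_continuous_image) auto
  then show ?thesis by (simp add: side_def pseg_psegpt a_def b_def compact_imp_closed)
qed

text \<open>Defined by inequalities, so that openness is immediate; that it lies in the hull then
  has to be proved.\<close>

definition open_triangle :: "complex set" where
  "open_triangle = {z. cmod z < 1 \<and> (\<forall>j. bary j z > 0)}"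

lemma open_triangleD: "z \<in> open_triangle \<Longrightarrow> cmod z < 1" "z \<in> open_triangle \<Longrightarrow> bary j z > 0"
  by (auto simp: open_triangle_def)

lemma continuous_on_bary: "continuous_on S (bary j)"
  unfolding bary_def tdet_def by (intro continuous_intros)

lemma open_open_triangle: "open open_triangle"
proof -
  have "open {z. bary j z > 0}" for j
    by (intro open_Collect_less continuous_on_bary continuous_intros)
  moreover have "open_triangle = ball 0 1 \<inter> (\<Inter>j. {z. bary j z > 0})"
    by (auto simp: open_triangle_def)
  ultimately show ?thesis by (metis open_INT open_Int open_ball finite)
qed

lemma open_triangle_not_side: "z \<in> open_triangle \<Longrightarrow> z \<notin> side V j"
  using side_bary[of z j] open_triangleD(2)[of z j] by auto

text \<open>Cramer's rule for the lift of z in terms of the lifts of p, q and r.\<close>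

lemma tdet_cramer:
  "tdet p q r * (1 + (cmod z)\<^sup>2) = tdet q r z * (1 + (cmod p)\<^sup>2) + tdet r p z * (1 + (cmod q)\<^sup>2)
     + tdet p q z * (1 + (cmod r)\<^sup>2)"
  "of_real (tdet p q r) * z = of_real (tdet q r z) * p + of_real (tdet r p z) * q
     + of_real (tdet p q z) * r"
  unfolding tdet_def complex_eq_iff by (simp_all add: algebra_simps)

lemma bary_cramer:
  obtains T where "T > 0"
    "T * (1 + (cmod z)\<^sup>2) = bary j z * (1 + (cmod (V j))\<^sup>2)
      + (bary (j + 1) z * (1 + (cmod (V (j + 1)))\<^sup>2) + bary (j + 2) z * (1 + (cmod (V (j + 2)))\<^sup>2))"
    "of_real T * z = of_real (bary j z) * V j
      + (of_real (bary (j + 1) z) * V (j + 1) + of_real (bary (j + 2) z) * V (j + 2))"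
proof
  define p where "p = V j"
  define q where "q = V (j + 1)"
  define r where "r = V (j + 2)"
  have T: "bary j p = sg * tdet p q r"
    unfolding bary_def p_def q_def r_def tdet_cyclic[of "V (j + 1)" "V (j + 2)" "V j"] ..
  have b: "bary j z = sg * tdet q r z" "bary (j + 1) z = sg * tdet r p z" "bary (j + 2) z = sg * tdet p q z"
    unfolding bary_def p_def q_def r_def add_3 by (rule refl)+
  show "bary j (V j) * (1 + (cmod z)\<^sup>2) = bary j z * (1 + (cmod (V j))\<^sup>2)
      + (bary (j + 1) z * (1 + (cmod (V (j + 1)))\<^sup>2) + bary (j + 2) z * (1 + (cmod (V (j + 2)))\<^sup>2))"
    unfolding p_def[symmetric] q_def[symmetric] r_def[symmetric] unfolding T b
    using arg_cong[OF tdet_cramer(1)[of p q r z], of "\<lambda>x. sg * x"]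
    by (simp add: algebra_simps)
  show "of_real (bary j (V j)) * z = of_real (bary j z) * V j
      + (of_real (bary (j + 1) z) * V (j + 1) + of_real (bary (j + 2) z) * V (j + 2))"
    unfolding p_def[symmetric] q_def[symmetric] r_def[symmetric] unfolding T b
    using arg_cong[OF tdet_cramer(2)[of p q r z], of "\<lambda>x. of_real sg * x"]
    by (simp add: algebra_simps)
qed (rule bary_vertex(1))

text \<open>Cramer's rule writes the lift of z as a positive combination of the vertex lifts. It is
  realised in two hull steps, a point w on the side opposite \<open>V 0\<close> and then a point x
  between \<open>V 0\<close> and w; x has the same ray as z.\<close>

lemma open_triangle_subset: "open_triangle \<subseteq> triangle V"
proof
  fix z assume z: "z \<in> open_triangle"
  have b: "bary j z > 0" for j using z by (simp add: open_triangle_def)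
  obtain T where T: "T > 0"
    and e1: "T * (1 + (cmod z)\<^sup>2) = bary 0 z * (1 + (cmod (V 0))\<^sup>2)
      + (bary (0 + 1) z * (1 + (cmod (V (0 + 1)))\<^sup>2) + bary (0 + 2) z * (1 + (cmod (V (0 + 2)))\<^sup>2))"
    and e2: "of_real T * z = of_real (bary 0 z) * V 0
      + (of_real (bary (0 + 1) z) * V (0 + 1) + of_real (bary (0 + 2) z) * V (0 + 2))"
    by (rule bary_cramer)
  obtain w K where w: "w \<in> pseg (V (0 + 1)) (V (0 + 2))" "K > 0"
    "K * (1 + (cmod w)\<^sup>2) = bary (0 + 1) z * (1 + (cmod (V (0 + 1)))\<^sup>2) + bary (0 + 2) z * (1 + (cmod (V (0 + 2)))\<^sup>2)"
    "of_real K * w = of_real (bary (0 + 1) z) * V (0 + 1) + of_real (bary (0 + 2) z) * V (0 + 2)"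
    using pseg_lift_surj[OF vertex_disc vertex_disc less_imp_le[OF b] less_imp_le[OF b] add_pos_pos[OF b b],
        of "0 + 1" "0 + 2" "0 + 1" "0 + 2"] by blast
  have wT: "w \<in> triangle V" using w(1) pseg_triangle vertex_in_triangle by blast
  obtain x L where x: "x \<in> pseg (V 0) w" "L > 0"
    "L * (1 + (cmod x)\<^sup>2) = bary 0 z * (1 + (cmod (V 0))\<^sup>2) + K * (1 + (cmod w)\<^sup>2)"
    "of_real L * x = of_real (bary 0 z) * V 0 + of_real K * w"
    using pseg_lift_surj[OF vertex_disc triangle_bary(1)[OF wT] less_imp_le[OF b] less_imp_le[OF w(2)] add_pos_pos[OF b w(2)], of 0 0]
    by blast
  have xT: "x \<in> triangle V" using x(1) pseg_triangle vertex_in_triangle wT by blast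
  have "z = x"
  proof (rule lift_inject[of T _ L])
    show "T * (1 + (cmod z)\<^sup>2) = L * (1 + (cmod x)\<^sup>2)" unfolding e1 x(3) w(3) ..
    show "of_real T * z = of_real L * x" unfolding e2 x(4) w(4) ..
  qed (use T x(2) z xT triangle_bary(1) open_triangleD in auto)
  then show "z \<in> triangle V" using xT by simp
qed

lemma bary_zero_vertex:
  assumes z: "z \<in> triangle V" and 0: "bary (j + 1) z = 0" "bary (j + 2) z = 0"
  shows "z = V j"
proof -
  obtain T where T: "T > 0" "T * (1 + (cmod z)\<^sup>2) = bary j z * (1 + (cmod (V j))\<^sup>2)"
    "of_real T * z = of_real (bary j z) * V j"
    using bary_cramer[of z j] unfolding 0 by (metis add.right_neutral mult_zero_left of_real_0)
  have "0 < T * (1 + (cmod z)\<^sup>2)" using T(1) by (simp add: add_pos_nonneg)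
  then have "bary j z > 0" unfolding T(2) using triangle_bary(2)[OF z, of j]
    by (metis less_eq_real_def less_irrefl mult_zero_left)
  then show ?thesis using lift_inject[OF T(2,3) triangle_bary(1)[OF z] vertex_disc T(1)] by blast
qed

text \<open>With one coefficient zero, Cramer's rule leaves a combination of two vertex lifts, and
  \<open>pseg_lift_surj\<close> puts the point of this ray on the side.\<close>

lemma bary_zero_side:
  assumes z: "z \<in> triangle V" and 0: "bary j z = 0"
  shows "z \<in> side V j"
proof -
  obtain T where T: "T > 0"
    "T * (1 + (cmod z)\<^sup>2) = bary (j + 1) z * (1 + (cmod (V (j + 1)))\<^sup>2) + bary (j + 2) z * (1 + (cmod (V (j + 2)))\<^sup>2)"
    "of_real T * z = of_real (bary (j + 1) z) * V (j + 1) + of_real (bary (j + 2) z) * V (j + 2)"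
    using bary_cramer[of z j] unfolding 0 by (metis add.left_neutral mult_zero_left of_real_0)
  have nn: "bary (j + 1) z \<ge> 0" "bary (j + 2) z \<ge> 0" using triangle_bary(2)[OF z] by auto
  have "0 < T * (1 + (cmod z)\<^sup>2)" using T(1) by (simp add: add_pos_nonneg)
  then have "bary (j + 1) z \<noteq> 0 \<or> bary (j + 2) z \<noteq> 0" unfolding T(2) by auto
  then have "bary (j + 1) z + bary (j + 2) z > 0" using nn by linarith
  then obtain w K where w: "w \<in> pseg (V (j + 1)) (V (j + 2))" "K > 0"
    "K * (1 + (cmod w)\<^sup>2) = bary (j + 1) z * (1 + (cmod (V (j + 1)))\<^sup>2) + bary (j + 2) z * (1 + (cmod (V (j + 2)))\<^sup>2)"
    "of_real K * w = of_real (bary (j + 1) z) * V (j + 1) + of_real (bary (j + 2) z) * V (j + 2)"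
    using pseg_lift_surj[OF vertex_disc vertex_disc nn] by blast
  have wS: "w \<in> side V j" using w(1) by (simp add: side_def)
  have "z = w"
  proof (rule lift_inject[of T _ K])
    show "T * (1 + (cmod z)\<^sup>2) = K * (1 + (cmod w)\<^sup>2)" unfolding T(2) w(3) ..
    show "of_real T * z = of_real K * w" unfolding T(3) w(4) ..
  qed (use T(1) w(2) z wS side_subset_triangle triangle_bary(1) in auto)
  then show ?thesis using wS by simp
qed

abbreviation R :: "3 \<Rightarrow> complex \<Rightarrow> complex" where
  "R j \<equiv> preflect (V (j + 1)) (V (j + 2))"

lemma vertices_distinct: "V (j + 1) \<noteq> V (j + 2)"
proof
  assume e: "V (j + 1) = V (j + 2)"
  have "bary j (V j) = 0" unfolding bary_def e by simp
  then show False using bary_vertex(1)[of j] by simp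
qed

end

section \<open>Reflections in geodesic lines\<close>

lemma preflect_disc:
  assumes "cmod a < 1" "cmod z < 1"
  shows "cmod (preflect a b z) < 1"
proof -
  have "cmod ((sgn (mob a b))\<^sup>2 * cnj (mob a z)) < 1"
    using mob_lt_1[OF assms] by (simp add: norm_mult norm_power norm_sgn)
  then show ?thesis using assms unfolding preflect_def by (intro mob_lt_1) auto
qed

lemma mob_preflect:
  assumes "cmod a < 1" "cmod z < 1"
  shows "mob a (preflect a b z) = (sgn (mob a b))\<^sup>2 * cnj (mob a z)"
proof -
  have "cmod ((sgn (mob a b))\<^sup>2 * cnj (mob a z)) < 1"
    using mob_lt_1[OF assms] by (simp add: norm_mult norm_power norm_sgn)
  then show ?thesis using assms unfolding preflect_def by (intro mob_mob_minus) auto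
qed

lemma mob_inj: "mob a z = mob a w \<Longrightarrow> cmod a < 1 \<Longrightarrow> cmod z < 1 \<Longrightarrow> cmod w < 1 \<Longrightarrow> z = w"
  using mob_minus_mob by metis

lemma sgn_mult_cnj_sgn: "sgn z * cnj (sgn z) = 1" if "z \<noteq> 0" for z :: complex
  using that by (simp add: complex_norm_square[symmetric] norm_sgn)

text \<open>Conjugation followed by the rotation by (sgn m)^2 is the reflection in the line through
  0 and m, which fixes m.\<close>

lemma sgn_square_mult_cnj: "(sgn m)\<^sup>2 * cnj m = m" for m :: complex
proof (cases "m = 0")
  case False
  then have "sgn m * cnj m = of_real (cmod m)"
    by (simp add: sgn_eq complex_norm_square[symmetric] power2_eq_square)
  then show ?thesis using False by (simp add: power2_eq_square mult.assoc) (simp add: sgn_eq)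
qed simp

lemma preflect_preflect:
  assumes "cmod a < 1" "cmod b < 1" "a \<noteq> b" "cmod z < 1"
  shows "preflect a b (preflect a b z) = z"
proof (rule mob_inj[of a])
  have m: "mob a b \<noteq> 0" using mob_eq_0_iff assms by auto
  have "(sgn (mob a b))\<^sup>2 * cnj ((sgn (mob a b))\<^sup>2 * cnj (mob a z))
      = (sgn (mob a b) * cnj (sgn (mob a b)))\<^sup>2 * mob a z" by (simp add: power2_eq_square)
  then show "mob a (preflect a b (preflect a b z)) = mob a z"
    using m assms by (simp add: mob_preflect preflect_disc sgn_mult_cnj_sgn)
qed (use assms preflect_disc in auto)

lemma preflect_pseg:
  assumes "cmod a < 1" "cmod b < 1" "a \<noteq> b" "z \<in> pseg a b"
  shows "preflect a b z = z"
proof (rule mob_inj[of a])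
  obtain s where s: "0 \<le> s" "s \<le> 1" "z = psegpt a b s" using assms(4) by (auto simp: pseg_psegpt)
  define m where "m = mob a b"
  have z: "cmod z < 1" using psegpt_in_disc assms s by simp
  have mz: "mob a z = of_real s * m" unfolding s(3) psegpt_def m_def
    using assms s by (intro mob_mob_minus cmod_scale_lt_1 mob_lt_1)
  from sgn_square_mult_cnj[of m] show "mob a (preflect a b z) = mob a z"
    using z assms by (simp add: mob_preflect mz flip: m_def)
  show "cmod (preflect a b z) < 1" "cmod z < 1" using z assms preflect_disc by auto
qed fact

lemma preflect_isometry:
  assumes "cmod a < 1" "cmod b < 1" "a \<noteq> b" "cmod z < 1" "cmod w < 1"
  shows "hdist (preflect a b z) (preflect a b w) = hdist z w"
proof -
  define c where "c = (sgn (mob a b))\<^sup>2"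
  have c: "c * cnj c = 1" "cmod c = 1"
    using mob_eq_0_iff[of a b] assms
    by (auto simp: c_def power_mult_distrib[symmetric] sgn_mult_cnj_sgn norm_power norm_sgn)
  have rot: "cmod (mob (c * cnj x) (c * cnj y)) = cmod (mob x y)" for x y
  proof -
    have "1 - cnj (c * cnj x) * (c * cnj y) = cnj (1 - cnj x * y)"
      using c(1) by (simp add: mult_ac)
    moreover have "c * cnj y - c * cnj x = c * cnj (y - x)" by (simp add: algebra_simps)
    ultimately show ?thesis by (simp only: mob_eq norm_divide norm_mult complex_mod_cnj c mult_1)
  qed
  have "cmod (mob (preflect a b z) (preflect a b w)) = cmod (mob (mob a (preflect a b z)) (mob a (preflect a b w)))"
    using assms by (intro mob_isometry[symmetric] preflect_disc)
  also have "\<dots> = cmod (mob (mob a z) (mob a w))"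
    using assms by (simp add: mob_preflect rot flip: c_def)
  also have "\<dots> = cmod (mob z w)" using assms by (intro mob_isometry)
  finally show ?thesis by (simp add: hdist_def)
qed

text \<open>Relative to the direction m of the line the reflection is conjugation, so the imaginary
  part in \<open>Im_mob_mob\<close> changes sign; k absorbs the positive factors on both
  sides.\<close>

lemma tdet_preflect:
  assumes "cmod a < 1" "cmod b < 1" "a \<noteq> b" "cmod z < 1"
  shows "\<exists>k>0. tdet a b (preflect a b z) = - k * tdet a b z"
proof -
  define m where "m = mob a b"
  have "cnj m * ((sgn m)\<^sup>2 * cnj w) = m * cnj w" for w
    using sgn_square_mult_cnj[of m] by (metis mult.assoc mult.commute)
  then have "cnj m * mob a (preflect a b z) = cnj (cnj m * mob a z)"
    unfolding mob_preflect[OF assms(1,4)] m_def[symmetric] complex_cnj_mult complex_cnj_cnj .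
  then have "Im (cnj m * mob a (preflect a b z)) = - Im (cnj m * mob a z)"
    by (simp only: cnj.sel)
  moreover obtain k where "k > 0" "Im (cnj m * mob a (preflect a b z)) = k * tdet a b (preflect a b z)"
    using Im_mob_mob[of a b "preflect a b z"] assms preflect_disc by (auto simp: m_def)
  moreover obtain l where "l > 0" "Im (cnj m * mob a z) = l * tdet a b z"
    using Im_mob_mob[of a b z] assms by (auto simp: m_def)
  ultimately show ?thesis by (intro exI[of _ "l / k"]) (auto simp: field_simps)
qed

context nondegenerate_triangle
begin

text \<open>Developing across side j puts the second copy on the nonpositive side of coordinate j.
  Hence a chart value in the open triangle always comes from the first copy.\<close>

lemma R_triangle_not_open:
  assumes "z \<in> triangle V"
  shows "R j z \<notin> open_triangle"
proof -
  obtain k where "k > 0" "tdet (V (j + 1)) (V (j + 2)) (R j z) = - k * tdet (V (j + 1)) (V (j + 2)) z"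
    using tdet_preflect[of "V (j + 1)" "V (j + 2)" z] vertex_disc vertices_distinct triangle_bary(1)[OF assms] by blast
  then have "bary j (R j z) = - k * bary j z" by (simp add: bary_def)
  then have "bary j (R j z) \<le> 0" using \<open>k > 0\<close> triangle_bary(2)[OF assms, of j] by simp
  then show ?thesis using open_triangleD(2)[of "R j z" j] by auto
qed

text \<open>The sides leaving vertex i are opposite to i + 2 and i + 1, so these two coordinates
  measure on which side of each of them the direction to z lies.\<close>

lemma Im_vertex_coords:
  assumes "cmod z < 1"
  shows "\<exists>k>0. sg * Im (cnj (mob (V i) (V (i + 1))) * mob (V i) z) = k * bary (i + 2) z"
    "\<exists>k>0. sg * Im (cnj (mob (V i) z) * mob (V i) (V (i + 2))) = k * bary (i + 1) z"
proof -
  obtain k where "k > 0" "Im (cnj (mob (V i) (V (i + 1))) * mob (V i) z) = k * tdet (V i) (V (i + 1)) z"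
    using Im_mob_mob[of "V i" "V (i + 1)" z] vertex_disc assms by blast
  then show "\<exists>k>0. sg * Im (cnj (mob (V i) (V (i + 1))) * mob (V i) z) = k * bary (i + 2) z"
    by (intro exI[of _ k]) (simp add: bary_def add_3)
  obtain k where "k > 0" "Im (cnj (mob (V i) z) * mob (V i) (V (i + 2))) = k * tdet (V i) z (V (i + 2))"
    using Im_mob_mob[of "V i" z "V (i + 2)"] vertex_disc assms by blast
  then show "\<exists>k>0. sg * Im (cnj (mob (V i) z) * mob (V i) (V (i + 2))) = k * bary (i + 1) z"
    using tdet_cyclic[of "V i" z "V (i + 2)"] by (intro exI[of _ k]) (simp add: bary_def add_3)
qed

end

section \<open>Metric derivatives and a Dini-type mean value theorem\<close>

lemma artanh_quotient_tendsto: "((\<lambda>x::real. if x = 0 then 1 else artanh x / x) \<longlongrightarrow> 1) (at 0)"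
proof -
  have "(artanh has_field_derivative 1) (at (0::real))"
    using artanh_real_has_field_derivative[of 0 UNIV] by simp
  then have "((\<lambda>x::real. artanh x / x) \<longlongrightarrow> 1) (at 0)" by (simp add: has_field_derivative_iff)
  then show ?thesis by (rule Lim_transform_eventually) (auto simp: eventually_at_filter)
qed

lemma mob_has_field_derivative:
  assumes "cmod a < 1" "cmod z < 1"
  shows "(mob a has_field_derivative (1 - (cmod a)\<^sup>2) / (1 - cnj a * z)\<^sup>2) (at z within S)"
proof -
  have nz: "1 - cnj a * z \<noteq> 0" by (rule mob_denom_nz[OF assms])
  have "complex_of_real ((cmod a)\<^sup>2) = a * cnj a" by (rule complex_norm_square)
  then have "((1 - cnj a * z) + (z - a) * cnj a) / (1 - cnj a * z)\<^sup>2
      = of_real (1 - (cmod a)\<^sup>2) / (1 - cnj a * z)\<^sup>2"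
    by (simp add: algebra_simps)
  moreover have "((\<lambda>z. (z - a) / (1 - cnj a * z)) has_field_derivative
      ((1 - cnj a * z) + (z - a) * cnj a) / (1 - cnj a * z)\<^sup>2) (at z within S)"
    using nz by (auto intro!: derivative_eq_intros simp: power2_eq_square)
  moreover have "mob a = (\<lambda>z. (z - a) / (1 - cnj a * z))" by (rule ext) (rule mob_eq)
  ultimately show ?thesis by (simp only: of_real_diff of_real_1)
qed

lemma has_vector_derivative_eventually:
  assumes "(f has_vector_derivative D) (at t)" and ev: "\<forall>\<^sub>F s in nhds t. f s = g s"
  shows "(g has_vector_derivative D) (at t)"
  using assms has_vector_derivative_cong_ev[of UNIV f g t D] eventually_nhds_x_imp_x[OF ev] by simp

text \<open>The Riemannian norm of a velocity is the metric speed. Expressed by distances alone, it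
  can be compared between charts and survives folding.\<close>

lemma hdist_has_speed:
  assumes h: "(h has_vector_derivative D) (at t)" and t: "cmod (h t) < 1"
  shows "((\<lambda>s. hdist (h t) (h s) / \<bar>s - t\<bar>) \<longlongrightarrow> 2 * cmod D / (1 - (cmod (h t))\<^sup>2)) (at t)"
proof -
  \<comment> \<open>With the singularity of artanh x / x filled in, the factorisation of the
    quotient below also holds at times s with \<open>h s = h t\<close>.\<close>
  define \<psi> :: "real \<Rightarrow> real" where "\<psi> x = (if x = 0 then 1 else artanh x / x)" for x
  define k where "k s = mob (h t) (h s)" for s
  have A: "1 - (cmod (h t))\<^sup>2 > 0" using t by (simp add: abs_square_less_1)
  have e: "1 - cnj (h t) * h t = of_real (1 - (cmod (h t))\<^sup>2)"
    by (simp only: of_real_diff of_real_1 complex_norm_square mult.commute)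
  have "((mob (h t) \<circ> h) has_vector_derivative
      (D * ((1 - (cmod (h t))\<^sup>2) / (1 - cnj (h t) * h t)\<^sup>2))) (at t)"
    using h mob_has_field_derivative[OF t t]
    by (intro field_vector_diff_chain_at)
  also have "D * ((1 - (cmod (h t))\<^sup>2) / (1 - cnj (h t) * h t)\<^sup>2) = D / of_real (1 - (cmod (h t))\<^sup>2)"
    using A unfolding e by (simp add: power2_eq_square)
  finally have k: "(k has_vector_derivative D / of_real (1 - (cmod (h t))\<^sup>2)) (at t)"
    by (simp add: k_def[abs_def] o_def)
  have k0: "k t = 0" by (simp add: k_def mob_eq)
  define D' where "D' = D / of_real (1 - (cmod (h t))\<^sup>2)"
  have "((\<lambda>s. ((k s - k t) - (s - t) *\<^sub>R D') /\<^sub>R norm (s - t)) \<longlongrightarrow> 0) (at t)"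
    using k unfolding has_vector_derivative_def has_derivative_at_within D'_def by blast
  then have lim0: "((\<lambda>s. norm (((k s - k t) - (s - t) *\<^sub>R D') /\<^sub>R norm (s - t))) \<longlongrightarrow> 0) (at t)"
    by (rule tendsto_norm_zero)
  have "((\<lambda>s. cmod (k s) / \<bar>s - t\<bar> - cmod D') \<longlongrightarrow> 0) (at t)"
  proof (rule Lim_null_comparison[OF _ lim0])
    show "\<forall>\<^sub>F s in at t. norm (cmod (k s) / \<bar>s - t\<bar> - cmod D')
        \<le> norm (((k s - k t) - (s - t) *\<^sub>R D') /\<^sub>R norm (s - t))"
      unfolding eventually_at_filter
    proof (intro always_eventually allI impI)
      fix s assume st: "s \<noteq> t"
      have "cmod (k s) / \<bar>s - t\<bar> - cmod D' = (cmod (k s) - cmod ((s - t) *\<^sub>R D')) / \<bar>s - t\<bar>"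
        using st by (simp add: diff_divide_distrib)
      then have "norm (cmod (k s) / \<bar>s - t\<bar> - cmod D')
          = \<bar>cmod (k s) - cmod ((s - t) *\<^sub>R D')\<bar> / \<bar>s - t\<bar>" by simp
      also have "\<dots> \<le> cmod (k s - (s - t) *\<^sub>R D') / \<bar>s - t\<bar>"
        by (intro divide_right_mono norm_triangle_ineq3) simp
      finally show "norm (cmod (k s) / \<bar>s - t\<bar> - cmod D')
        \<le> norm (((k s - k t) - (s - t) *\<^sub>R D') /\<^sub>R norm (s - t))"
        by (simp add: k0 divide_inverse mult.commute)
    qed
  qed
  then have "((\<lambda>s. cmod (k s) / \<bar>s - t\<bar>) \<longlongrightarrow> cmod D') (at t)" by (rule LIM_zero_cancel)
  moreover have "cmod D' = cmod D / (1 - (cmod (h t))\<^sup>2)"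
    using A unfolding D'_def norm_divide norm_of_real by simp
  ultimately have 1: "((\<lambda>s. cmod (k s) / \<bar>s - t\<bar>) \<longlongrightarrow> cmod D / (1 - (cmod (h t))\<^sup>2)) (at t)" by simp
  have "isCont \<psi> 0"
    unfolding isCont_def using artanh_quotient_tendsto by (simp add: \<psi>_def[abs_def])
  moreover have "isCont k t" using k by (rule has_vector_derivative_continuous)
  then have "isCont (\<lambda>s. cmod (k s)) t" by (intro continuous_intros)
  ultimately have "isCont (\<lambda>s. \<psi> (cmod (k s))) t"
    using k0 by (intro isCont_o2[of t "\<lambda>s. cmod (k s)" \<psi>]) auto
  then have 2: "((\<lambda>s. \<psi> (cmod (k s))) \<longlongrightarrow> 1) (at t)"
    by (simp add: isCont_def k0 \<psi>_def)
  have "((\<lambda>s. 2 * (\<psi> (cmod (k s)) * (cmod (k s) / \<bar>s - t\<bar>))) \<longlongrightarrow> 2 * (1 * (cmod D / (1 - (cmod (h t))\<^sup>2)))) (at t)"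
    by (intro tendsto_intros 1 2)
  moreover have "2 * (\<psi> (cmod (k s)) * (cmod (k s) / \<bar>s - t\<bar>)) = hdist (h t) (h s) / \<bar>s - t\<bar>" for s
    by (simp add: \<psi>_def hdist_def k_def)
  ultimately show ?thesis by (simp only: mult_1 times_divide_eq_right)
qed

text \<open>The hypothesis says that the lower right Dini derivative is nowhere negative. After
  adding a slope e, the last point whose value is at least the initial one can only be b.\<close>

lemma Dini_mono_aux:
  fixes G :: "real \<Rightarrow> real"
  assumes cont: "continuous_on {a..b} G" and ab: "a \<le> b"
    and dini: "\<And>t e. a \<le> t \<Longrightarrow> t < b \<Longrightarrow> e > 0 \<Longrightarrow> \<forall>\<^sub>F s in at_right t. G s \<ge> G t - e * (s - t)"
  shows "G a \<le> G b"
proof (rule field_le_epsilon)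
  fix e0 :: real assume e0: "e0 > 0"
  \<comment> \<open>Chosen so that the added slope costs at most e0 over the interval; the summand 1
    keeps the denominator positive when a = b.\<close>
  define e where "e = e0 / (b - a + 1)"
  have e: "e > 0" "e * (b - a) \<le> e0" using e0 ab by (auto simp: e_def field_simps)
  define \<phi> where "\<phi> x = G x + e * x" for x
  define S where "S = {x \<in> {a..b}. \<phi> a \<le> \<phi> x}"
  have c\<phi>: "continuous_on {a..b} \<phi>" unfolding \<phi>_def by (intro continuous_intros cont)
  have "closed S" unfolding S_def
    by (intro continuous_on_closed_Collect_le continuous_intros c\<phi>)
  then have "compact S" unfolding S_def
    by (rule compact_Int_closed[of "{a..b}", THEN back_subst[of compact], rotated]) auto
  moreover have "a \<in> S" using ab by (simp add: S_def)
  ultimately obtain x where x: "x \<in> S" "\<And>y. y \<in> S \<Longrightarrow> y \<le> x"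
    using compact_attains_sup[of S] by auto
  have "x = b"
  proof (rule ccontr)
    assume "x \<noteq> b"
    then have xb: "a \<le> x" "x < b" using x(1) by (auto simp: S_def)
    have "\<forall>\<^sub>F s in at_right x. s \<in> {x<..<b}"
      by (rule eventually_at_right_real[OF xb(2)])
    with dini[OF xb e(1)] have "\<forall>\<^sub>F s in at_right x. G s \<ge> G x - e * (s - x) \<and> s \<in> {x<..<b}"
      by (rule eventually_conj)
    then obtain s where s: "G s \<ge> G x - e * (s - x)" "x < s" "s < b"
      using eventually_happens'[of "at_right x"] by auto
    then have "\<phi> s \<ge> \<phi> x" by (simp add: \<phi>_def algebra_simps)
    then have "s \<in> S" using s xb x(1) by (auto simp: S_def)
    then show False using x(2)[of s] s by auto
  qed
  then have "\<phi> a \<le> \<phi> b" using x(1) by (simp add: S_def)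
  then show "G a \<le> G b + e0" using e by (simp add: \<phi>_def algebra_simps)
qed

text \<open>F will hold the times at which a curve meets a vertex or fails to be C^1. The interval
  is cut at these points; on a piece only interior times are controlled, and the endpoints are
  reached by continuity.\<close>

lemma Dini_mono:
  fixes G :: "real \<Rightarrow> real"
  assumes "finite F" "continuous_on {a..b} G" "a \<le> b"
    and "\<And>t e. a < t \<Longrightarrow> t < b \<Longrightarrow> t \<notin> F \<Longrightarrow> e > 0 \<Longrightarrow> \<forall>\<^sub>F s in at_right t. G s \<ge> G t - e * (s - t)"
  shows "G a \<le> G b"
  using assms
proof (induction F arbitrary: a b rule: finite_induct)
  case empty
  show ?case
  proof (cases "a = b")
    case False
    then have ab: "a < b" using empty(2) by simp
    have mid: "G x \<le> G y" if "a < x" "x \<le> y" "y < b" for x y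
    proof (rule Dini_mono_aux[where G = G])
      show "continuous_on {x..y} G" using that by (intro continuous_on_subset[OF empty(1)]) auto
      show "\<forall>\<^sub>F s in at_right t. G t - e * (s - t) \<le> G s" if "x \<le> t" "t < y" "e > 0" for t e
        by (rule empty(3)) (use that \<open>a < x\<close> \<open>y < b\<close> in auto)
    qed fact
    define m where "m = (a + b) / 2"
    have m: "a < m" "m < b" using ab by (auto simp: m_def)
    have "(G \<longlongrightarrow> G a) (at_right a)" "(G \<longlongrightarrow> G b) (at_left b)"
      using continuous_on_Icc_at_rightD[OF empty(1) ab] continuous_on_Icc_at_leftD[OF empty(1) ab] by auto
    moreover have "\<forall>\<^sub>F x in at_right a. G x \<le> G m"
      using eventually_at_right_real[OF m(1)] by eventually_elim (use mid m in auto)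
    moreover have "\<forall>\<^sub>F x in at_left b. G m \<le> G x"
      using eventually_at_left_real[OF m(2)] by eventually_elim (use mid m in auto)
    ultimately have "G a \<le> G m" "G m \<le> G b"
      using tendsto_upperbound[of G "G a" "at_right a" "G m"] tendsto_lowerbound[of G "G b" "at_left b" "G m"]
      by simp_all
    then show ?thesis by simp
  qed simp
next
  case (insert x F)
  have le: "G c \<le> G d" if cd: "a \<le> c" "c \<le> d" "d \<le> b" "x \<notin> {c<..<d}" for c d
  proof (rule insert.IH[OF _ cd(2)])
    show "continuous_on {c..d} G" using cd by (intro continuous_on_subset[OF insert.prems(1)]) auto
    show "\<forall>\<^sub>F s in at_right t. G t - e * (s - t) \<le> G s" if "c < t" "t < d" "t \<notin> F" "e > 0" for t e
      by (rule insert.prems(3)) (use that cd in auto)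
  qed
  show ?case
  proof (cases "a < x \<and> x < b")
    case True
    then have "G a \<le> G x" "G x \<le> G b" by (auto intro!: le)
    then show ?thesis by simp
  next
    case False
    then show ?thesis using insert.prems(2) by (intro le) auto
  qed
qed

lemma preflect_differentiable:
  assumes "cmod a < 1" "cmod z < 1"
  shows "preflect a b differentiable (at z)"
proof -
  have 1: "mob a differentiable (at z)"
    using mob_has_field_derivative[OF assms] field_differentiable_def field_differentiable_imp_differentiable by blast
  have c: "cmod ((sgn (mob a b))\<^sup>2 * cnj (mob a z)) < 1"
    using mob_lt_1[OF assms] by (simp add: norm_mult norm_power norm_sgn)
  have 2: "mob (- a) differentiable (at ((sgn (mob a b))\<^sup>2 * cnj (mob a z)))"
    using mob_has_field_derivative[of "-a", OF _ c] assms field_differentiable_def field_differentiable_imp_differentiable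
    by (metis norm_minus_cancel)
  have 3: "(\<lambda>z. (sgn (mob a b))\<^sup>2 * cnj z) differentiable (at (mob a z))"
    by (intro bounded_linear_imp_differentiable bounded_linear_mult_const bounded_linear_const_mult bounded_linear_cnj)
  have "(mob (- a) \<circ> ((\<lambda>z. (sgn (mob a b))\<^sup>2 * cnj z) \<circ> mob a)) differentiable (at z)"
    by (intro differentiable_chain_at 1 3) (use 2 in simp)
  then show ?thesis by (simp add: preflect_def[abs_def] o_def)
qed

section \<open>The double\<close>

context nondegenerate_triangle
begin

abbreviation sides :: "complex set" where "sides \<equiv> (\<Union>j. side V j)"

lemma closed_sides: "closed sides"
  using closed_side by (intro closed_UN) auto

lemma open_triangle_not_sides: "z \<in> open_triangle \<Longrightarrow> z \<notin> sides"
  using open_triangle_not_side by auto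

lemma proj_eq: "z \<in> triangle V \<Longrightarrow> proj V s z = {(s', z) | s'. s' = s \<or> z \<in> sides}"
  by (auto simp: proj_def glue_def)

lemma surface_iff: "p \<in> surface V \<longleftrightarrow> (\<exists>s z. z \<in> triangle V \<and> p = proj V s z)"
  by (auto simp: surface_def quotient_def proj_def)

lemma footprint_proj: "z \<in> triangle V \<Longrightarrow> footprint (proj V s z) = z"
proof -
  assume "z \<in> triangle V"
  then have "snd ` proj V s z = {z}" by (force simp: proj_eq)
  then show ?thesis by (simp add: footprint_def)
qed

lemma sheet_proj: "z \<in> triangle V \<Longrightarrow> sheet (proj V s z) \<longleftrightarrow> s \<or> z \<in> sides"
  unfolding sheet_def by (drule proj_eq[of z s], erule ssubst) (auto simp: image_iff)

lemma proj_side: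
  assumes "z \<in> sides"
  shows "proj V s z = proj V s' z"
proof -
  have "z \<in> triangle V" using assms side_subset_triangle by blast
  then show ?thesis using assms proj_eq[of z s] proj_eq[of z s'] by simp
qed

lemma proj_in_surface: "z \<in> triangle V \<Longrightarrow> proj V s z \<in> surface V"
  by (auto simp: surface_iff)

lemma footprint_in_triangle: "p \<in> surface V \<Longrightarrow> footprint p \<in> triangle V"
  by (auto simp: surface_iff footprint_proj)

lemma footprint_disc: "p \<in> surface V \<Longrightarrow> cmod (footprint p) < 1"
  using footprint_in_triangle triangle_bary(1) by blast

lemma proj_sheet_footprint: "p \<in> surface V \<Longrightarrow> proj V (sheet p) (footprint p) = p"
proof -
  assume "p \<in> surface V"
  then obtain s z where z: "z \<in> triangle V" "p = proj V s z" by (auto simp: surface_iff)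
  then show ?thesis
    using proj_side[of z] by (cases "z \<in> sides") (auto simp: footprint_proj sheet_proj)
qed

lemma vertex_in_sides: "V i \<in> sides"
proof -
  have "psegpt (V (i + 1 + 1)) (V (i + 1 + 2)) 1 \<in> side V (i + 1)"
    by (auto simp: side_def pseg_psegpt)
  moreover have "psegpt (V (i + 1 + 1)) (V (i + 1 + 2)) 1 = V i"
    using mob_minus_mob vertex_disc by (simp add: psegpt_def add_3)
  ultimately show ?thesis by auto
qed

lemma vertex_surface: "vertex V i \<in> surface V" "footprint (vertex V i) = V i"
  by (simp_all add: vertex_def proj_in_surface footprint_proj vertex_in_triangle)

lemma footprint_vertex: "p \<in> surface V \<Longrightarrow> footprint p = V i \<Longrightarrow> p = vertex V i"
  using proj_sheet_footprint[of p] proj_side[OF vertex_in_sides] unfolding vertex_def by metis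

lemma topspace_surface: "topspace (surface_top V) = surface V"
proof
  show "topspace (surface_top V) \<subseteq> surface V"
    using openin_surface_top[of V "topspace (surface_top V)"] openin_topspace by blast
  have "{x \<in> UNIV \<times> triangle V. glue V `` {x} \<in> surface V} = UNIV \<times> triangle V"
    by (auto simp: surface_def quotient_def)
  then have "openin (surface_top V) (surface V)" by (simp add: openin_surface_top)
  then show "surface V \<subseteq> topspace (surface_top V)" by (rule openin_subset)
qed

lemma openin_surfaceI:
  assumes "open W" "\<And>s z. z \<in> triangle V \<Longrightarrow> proj V s z \<in> U \<longleftrightarrow> (s, z) \<in> W" "U \<subseteq> surface V"
  shows "openin (surface_top V) U"
proof -
  have "{x \<in> UNIV \<times> triangle V. glue V `` {x} \<in> U} = (UNIV \<times> triangle V) \<inter> W"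
    using assms(2) by (auto simp: proj_def)
  then show ?thesis using assms by (auto simp: openin_surface_top)
qed

lemma continuous_map_footprint: "continuous_map (surface_top V) euclidean footprint"
  unfolding continuous_map_def topspace_surface
proof (intro conjI allI impI)
  fix U :: "complex set" assume "openin euclidean U"
  then have "open (UNIV \<times> U :: (bool \<times> complex) set)" by (auto intro: open_Times)
  then show "openin (surface_top V) {p \<in> surface V. footprint p \<in> U}"
    by (rule openin_surfaceI) (auto simp: footprint_proj proj_in_surface)
qed auto

lemma openin_sheet_interior:
  "openin (surface_top V) {p \<in> surface V. sheet p = b \<and> footprint p \<notin> sides}"
proof (rule openin_surfaceI)
  show "open ({b} \<times> (- sides))" by (intro open_Times open_discrete open_Compl closed_sides)
qed (auto simp: footprint_proj proj_in_surface sheet_proj)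

lemma side_chart_dom: "p \<in> fst (side_chart V j) \<longleftrightarrow> p \<in> surface V \<and> footprint p \<notin> side V (j + 1) \<union> side V (j + 2)"
  by (simp add: side_chart_def)

lemma side_chart_coord: "snd (side_chart V j) p = (if sheet p then footprint p else R j (footprint p))"
  by (simp add: side_chart_def)

lemma side_chart_disc: "p \<in> surface V \<Longrightarrow> cmod (snd (side_chart V j) p) < 1"
  using footprint_disc preflect_disc vertex_disc by (simp add: side_chart_coord)

lemma R_isometry: "cmod z < 1 \<Longrightarrow> cmod w < 1 \<Longrightarrow> hdist (R j z) (R j w) = hdist z w"
  using preflect_isometry vertex_disc vertices_distinct by blast

lemma R_side: "z \<in> side V j \<Longrightarrow> R j z = z"
  using preflect_pseg vertex_disc vertices_distinct unfolding side_def by blast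

lemma R_R: "cmod z < 1 \<Longrightarrow> R j (R j z) = z"
  using preflect_preflect vertex_disc vertices_distinct by blast

lemma side_chart_two:
  assumes "p \<in> fst (side_chart V j)" "p \<in> fst (side_chart V j')" "j \<noteq> j'"
  shows "footprint p \<notin> sides"
proof
  assume "footprint p \<in> sides"
  then obtain k where k: "footprint p \<in> side V k" by blast
  have "k = j + 1 \<or> k = j + 2 \<or> k = j' + 1 \<or> k = j' + 2"
    using three_cases[of k] three_cases[of j] three_cases[of j'] assms(3) by (auto simp: num_3)
  then show False using k assms(1,2) unfolding side_chart_dom by blast
qed

lemma side_chart_not_sides:
  assumes "p \<in> fst (side_chart V j)" "footprint p \<in> sides"
  shows "footprint p \<in> side V j"
proof -
  obtain k where k: "footprint p \<in> side V k" using assms(2) by blast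
  have "k = j \<or> k = j + 1 \<or> k = j + 2"
    using three_cases[of k] three_cases[of j] by (auto simp: num_3)
  then show ?thesis using k assms(1) unfolding side_chart_dom by blast
qed

text \<open>Off the sides a curve stays in one sheet, and on side \<open>j\<close> the reflection used by
  \<open>side_chart V j\<close> fixes the point; so folding the double onto the triangle preserves the distance
  from \<open>c t\<close> in either case.\<close>

lemma hdist_footprint_chart:
  assumes t: "c t \<in> fst (side_chart V j)"
    and near: "\<forall>\<^sub>F s in at t. c s \<in> surface V"
    and sh: "footprint (c t) \<notin> sides \<Longrightarrow> \<forall>\<^sub>F s in at t. sheet (c s) = sheet (c t)"
  shows "\<forall>\<^sub>F s in at t. hdist (footprint (c t)) (footprint (c s))
      = hdist (snd (side_chart V j) (c t)) (snd (side_chart V j) (c s))"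
proof (cases "footprint (c t) \<in> sides")
  case True
  then have "footprint (c t) \<in> side V j" using side_chart_not_sides t by blast
  moreover have "c t \<in> surface V" using t side_chart_dom by blast
  ultimately have "hdist (footprint (c t)) (footprint (c s))
      = hdist (snd (side_chart V j) (c t)) (snd (side_chart V j) (c s))" if "c s \<in> surface V" for s
    using that R_isometry[of "footprint (c t)" "footprint (c s)" j] R_side footprint_disc
    by (auto simp: side_chart_coord)
  then show ?thesis using near by (auto elim: eventually_mono)
next
  case False
  have ct: "c t \<in> surface V" using t side_chart_dom by blast
  show ?thesis using near sh[OF False]
    by eventually_elim (use ct in \<open>simp add: side_chart_coord R_isometry footprint_disc\<close>)
qed

lemma chart_at_surface:
  assumes "p \<in> fst (side_chart V j)"
  obtains j' where "chart_at V p = side_chart V j'" "p \<in> fst (side_chart V j')"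
proof -
  have "\<exists>\<kappa>. \<kappa> \<in> surface_atlas V \<and> p \<in> fst \<kappa>" using assms by (auto simp: surface_atlas_def)
  from someI_ex[OF this] show ?thesis using that by (auto simp: surface_atlas_def chart_at_def)
qed

text \<open>\<open>riem_norm\<close> is evaluated in a chosen chart. In that chart and in chart j
  the expression is the metric speed of the same folded curve, so uniqueness of limits identifies
  them.\<close>

lemma riem_norm_velocity:
  assumes t: "c t \<in> fst (side_chart V j)"
    and D: "((snd (side_chart V j) \<circ> c) has_vector_derivative D) (at t)"
    and near: "\<forall>\<^sub>F s in at t. c s \<in> surface V"
    and sh: "footprint (c t) \<notin> sides \<Longrightarrow> \<forall>\<^sub>F s in at t. sheet (c s) = sheet (c t)"
  shows "riem_norm V (c t) (velocity (surface_atlas V) c t)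
    = 2 * cmod D / (1 - (cmod (snd (side_chart V j) (c t)))\<^sup>2)"
proof -
  define h where "h = snd (side_chart V j) \<circ> c"
  obtain j' where j': "chart_at V (c t) = side_chart V j'" "c t \<in> fst (side_chart V j')"
    using chart_at_surface[OF t] by blast
  define k where "k = snd (side_chart V j') \<circ> c"
  have ct: "c t \<in> surface V" using t side_chart_dom by blast
  have D': "(h has_vector_derivative D) (at t)" using D by (simp only: h_def)
  have ht: "cmod (h t) < 1" using side_chart_disc[OF ct] by (simp add: h_def)
  have lim_h: "((\<lambda>s. hdist (h t) (h s) / \<bar>s - t\<bar>) \<longlongrightarrow> 2 * cmod D / (1 - (cmod (h t))\<^sup>2)) (at t)"
    by (rule hdist_has_speed[OF D' ht])
  \<comment> \<open>Only existence matters here. Two different charts meet off the sides, where the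
    sheet is locally constant and the change of chart is the identity or a composition of two
    reflections.\<close>
  have "\<exists>E. (k has_vector_derivative E) (at t)"
  proof (cases "j' = j")
    case True
    then show ?thesis using D by (auto simp: k_def)
  next
    case False
    then have ns: "footprint (c t) \<notin> sides" using side_chart_two t j'(2) by metis
    define b where "b = sheet (c t)"
    have ev: "\<forall>\<^sub>F s in nhds t. c s \<in> surface V \<and> sheet (c s) = b"
      using eventually_conj[OF near sh[OF ns]] ct by (simp add: eventually_nhds_conv_at b_def)
    show ?thesis
    proof (cases b)
      case True
      have "\<forall>\<^sub>F s in nhds t. h s = k s"
        using ev by eventually_elim (auto simp: h_def k_def side_chart_coord True)
      with D' show ?thesis by (blast intro: has_vector_derivative_eventually)
    next
      case False
      have Rk: "\<forall>\<^sub>F s in nhds t. (R j' \<circ> (R j \<circ> h)) s = k s"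
        using ev by eventually_elim (auto simp: h_def k_def side_chart_coord False R_R footprint_disc)
      have "(R j' \<circ> (R j \<circ> h)) differentiable (at t)"
        by (intro differentiable_chain_at differentiableI_vector[OF D'])
          (use preflect_differentiable preflect_disc vertex_disc ht in auto)
      then show ?thesis
        using has_vector_derivative_eventually[OF _ Rk] vector_derivative_works by blast
    qed
  qed
  then obtain E where E: "(k has_vector_derivative E) (at t)" by blast
  have lim_k: "((\<lambda>s. hdist (k t) (k s) / \<bar>s - t\<bar>) \<longlongrightarrow> 2 * cmod E / (1 - (cmod (k t))\<^sup>2)) (at t)"
    by (rule hdist_has_speed[OF E]) (use side_chart_disc[OF ct] in \<open>simp add: k_def\<close>)
  have "\<forall>\<^sub>F s in at t. hdist (h t) (h s) / \<bar>s - t\<bar> = hdist (k t) (k s) / \<bar>s - t\<bar>"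
  proof -
    have "\<forall>\<^sub>F s in at t. hdist (footprint (c t)) (footprint (c s)) = hdist (h t) (h s)"
      unfolding h_def o_def by (rule hdist_footprint_chart[OF t near]) (rule sh)
    moreover have "\<forall>\<^sub>F s in at t. hdist (footprint (c t)) (footprint (c s)) = hdist (k t) (k s)"
      unfolding k_def o_def by (rule hdist_footprint_chart[OF j'(2) near]) (rule sh)
    ultimately show ?thesis by eventually_elim simp
  qed
  with lim_h have "((\<lambda>s. hdist (k t) (k s) / \<bar>s - t\<bar>) \<longlongrightarrow> 2 * cmod D / (1 - (cmod (h t))\<^sup>2)) (at t)"
    by (rule Lim_transform_eventually)
  with lim_k have "2 * cmod E / (1 - (cmod (k t))\<^sup>2) = 2 * cmod D / (1 - (cmod (h t))\<^sup>2)"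
    by (rule tendsto_unique[OF trivial_limit_at])
  moreover have "vector_derivative k (at t) = E" using E by (rule vector_derivative_at)
  ultimately show ?thesis using j'
    by (simp add: riem_norm_def velocity_def surface_atlas_def h_def k_def)
qed

end

section \<open>Geodesics and the distance to a vertex\<close>

lemma continuous_on_mob: "continuous_on {z. cmod z < 1} (mob a)" if "cmod a < 1"
  unfolding mob_eq[abs_def] by (intro continuous_intros) (use that mob_denom_nz in auto)

lemma continuous_on_hdist: "continuous_on {z. cmod z < 1} (hdist a)" if a: "cmod a < 1"
proof -
  have *: "cmod (mob a z) \<in> {-1<..<1}" if "z \<in> {z. cmod z < 1}" for z
  proof -
    have "cmod (mob a z) < 1" using mob_lt_1[OF a] that by simp
    moreover have "cmod (mob a z) \<ge> 0" by simp
    ultimately show ?thesis unfolding greaterThanLessThan_iff by linarith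
  qed
  have "continuous_on {z. cmod z < 1} (\<lambda>z. artanh (cmod (mob a z)))"
    by (rule continuous_on_compose2[where t = "{-1<..<1}" and g = artanh])
      (intro continuous_on_artanh order.refl, intro continuous_on_norm continuous_on_mob a, use * in blast)
  then show ?thesis unfolding hdist_def[abs_def] by (intro continuous_intros)
qed

section \<open>Unit speed geodesics and their images under isometries\<close>

definition pgeod_deriv :: "complex \<Rightarrow> complex \<Rightarrow> real \<Rightarrow> complex" where
  "pgeod_deriv a u t = of_real ((1 - (tanh (t / 2))\<^sup>2) / 2) * u * of_real (1 - (cmod a)\<^sup>2)
     / (1 + cnj a * (of_real (tanh (t / 2)) * u))\<^sup>2"

lemma has_real_derivative_tanh_half:
  "((\<lambda>t. tanh (t / 2)) has_real_derivative (1 - (tanh (t / 2))\<^sup>2) / 2) (at t within S)"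
  by (rule derivative_eq_intros refl | simp add: cosh_real_pos less_imp_neq[symmetric])+

lemma tanh_unit_lt_1: "cmod (of_real (tanh (t / 2)) * u) < 1" if "cmod u = 1" for t :: real
proof -
  have "\<bar>tanh (t / 2)\<bar> < 1" using tanh_real_bounds[of "t / 2"] by auto
  then show ?thesis using that by (simp add: norm_mult)
qed

lemma pgeod_disc: "cmod (pgeod a u t) < 1" if "cmod a < 1" "cmod u = 1"
  unfolding pgeod_def using that tanh_unit_lt_1 by (intro mob_lt_1) auto

lemma pgeod_has_vector_derivative:
  assumes a: "cmod a < 1" and u: "cmod u = 1"
  shows "(pgeod a u has_vector_derivative pgeod_deriv a u t) (at t within S)"
proof -
  define x where "x = of_real (tanh (t / 2)) * u"
  have x: "cmod x < 1" unfolding x_def by (rule tanh_unit_lt_1[OF u])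
  have "((\<lambda>t. of_real (tanh (t / 2)) * u) has_vector_derivative of_real ((1 - (tanh (t / 2))\<^sup>2) / 2) * u) (at t within S)"
    by (intro has_vector_derivative_mult_left has_vector_derivative_of_real has_real_derivative_tanh_half)
  moreover have "(mob (- a) has_field_derivative (1 - (cmod (- a))\<^sup>2) / (1 - cnj (- a) * x)\<^sup>2)
      (at x within (\<lambda>t. of_real (tanh (t / 2)) * u) ` S)"
    using a x by (intro mob_has_field_derivative) auto
  ultimately have "(mob (- a) \<circ> (\<lambda>t. of_real (tanh (t / 2)) * u) has_vector_derivative
      (of_real ((1 - (tanh (t / 2))\<^sup>2) / 2) * u) * ((1 - (cmod (- a))\<^sup>2) / (1 - cnj (- a) * x)\<^sup>2)) (at t within S)"
    by (intro field_vector_diff_chain_within) (simp_all add: x_def)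
  then show ?thesis
    by (simp add: pgeod_def[abs_def] o_def pgeod_deriv_def x_def)
qed

lemma pgeod_unit_speed:
  assumes a: "cmod a < 1" and u: "cmod u = 1"
  shows "2 * cmod (pgeod_deriv a u t) / (1 - (cmod (pgeod a u t))\<^sup>2) = 1"
proof -
  define T where "T = tanh (t / 2)"
  define x where "x = of_real T * u"
  have T: "T\<^sup>2 < 1" using tanh_real_bounds[of "t / 2"] by (auto simp: T_def abs_square_less_1)
  have x: "cmod x < 1" unfolding x_def T_def by (rule tanh_unit_lt_1[OF u])
  have X: "(cmod x)\<^sup>2 = T\<^sup>2" using u by (simp add: x_def norm_mult)
  have A: "1 - (cmod a)\<^sup>2 > 0" using a by (simp add: abs_square_less_1)
  have nz: "cmod (1 + cnj a * x) > 0" using mob_denom_nz'[OF a x] by simp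
  have 1: "1 - (cmod (pgeod a u t))\<^sup>2 = (1 - (cmod a)\<^sup>2) * (1 - T\<^sup>2) / (cmod (1 + cnj a * x))\<^sup>2"
    using one_minus_mob[of "-a" x] a x X by (simp add: pgeod_def flip: T_def x_def)
  have "cmod (pgeod_deriv a u t) = ((1 - T\<^sup>2) / 2) * (1 - (cmod a)\<^sup>2) / (cmod (1 + cnj a * x))\<^sup>2"
    unfolding pgeod_deriv_def T_def[symmetric] x_def[symmetric] norm_divide norm_mult norm_power norm_of_real u
    using T A by simp
  then have "2 * cmod (pgeod_deriv a u t) = (1 - (cmod a)\<^sup>2) * (1 - T\<^sup>2) / (cmod (1 + cnj a * x))\<^sup>2"
    by simp
  then show ?thesis unfolding 1 using nz A T by simp
qed

lemma pgeod_hdist: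
  assumes "cmod a < 1" "cmod z < 1"
  shows "pgeod a (sgn (mob a z)) (hdist a z) = z"
proof -
  have "of_real (cmod (mob a z)) * sgn (mob a z) = mob a z" by (simp add: sgn_eq)
  then show ?thesis using assms by (simp add: pgeod_def tanh_half_hdist mob_minus_mob)
qed

text \<open>The unit factor of \<open>mob_mob\<close>. It equals the derivative of
  \<open>mob A\<close> at z divided by its modulus, so it turns directions at z into directions at
  \<open>mob A z\<close>.\<close>

definition mob_rot :: "complex \<Rightarrow> complex \<Rightarrow> complex" where
  "mob_rot A z = (1 - A * cnj z) / (1 - cnj A * z)"

lemma mob_pgeod:
  assumes "cmod A < 1" "cmod z < 1" "cmod u = 1"
  shows "mob A (pgeod z u t) = pgeod (mob A z) (mob_rot A z * u) t"
  unfolding pgeod_def mob_rot_def using mob_mob[OF assms(1,2) tanh_unit_lt_1[OF assms(3)], of t]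
  by (simp add: mult_ac)

lemma cnj_pgeod: "cnj (pgeod a u t) = pgeod (cnj a) (cnj u) t"
  by (simp add: pgeod_def mob_minus_eq)

lemma mult_pgeod: "c * pgeod a u t = pgeod (c * a) (c * u) t" if "cmod c = 1"
proof -
  have "cnj c * c = 1" using that by (simp add: complex_norm_square[symmetric] mult.commute)
  then have "cnj (c * a) * (of_real (tanh (t / 2)) * (c * u)) = cnj a * (of_real (tanh (t / 2)) * u)"
    by (simp add: mult_ac)
  then show ?thesis by (simp add: pgeod_def mob_minus_eq algebra_simps)
qed

lemma preflect_pgeod:
  assumes p: "cmod p < 1" "cmod q < 1" "p \<noteq> q" and a: "cmod a < 1" and u: "cmod u = 1"
  shows "\<exists>a' u'. cmod a' < 1 \<and> cmod u' = 1 \<and> (\<forall>t. preflect p q (pgeod a u t) = pgeod a' u' t)"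
proof -
  define c where "c = (sgn (mob p q))\<^sup>2"
  have c: "cmod c = 1" using mob_eq_0_iff[OF p(1,2)] p(3) by (auto simp: c_def norm_power norm_sgn)
  define b where "b = c * cnj (mob p a)"
  define v where "v = c * cnj (mob_rot p a * u)"
  have b: "cmod b < 1" using mob_lt_1[OF p(1) a] c by (simp add: b_def norm_mult)
  have v: "cmod v = 1" using c rotation_unit[OF p(1) a] u
    unfolding v_def norm_mult complex_mod_cnj mob_rot_def by simp
  have p': "cmod (- p) < 1" using p by simp
  have "preflect p q (pgeod a u t) = pgeod (mob (- p) b) (mob_rot (- p) b * v) t" for t
    unfolding preflect_def mob_pgeod[OF p(1) a u] cnj_pgeod c_def[symmetric] mult_pgeod[OF c]
      b_def[symmetric] v_def[symmetric] by (rule mob_pgeod[OF p' b v])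
  moreover have "cmod (mob (- p) b) < 1" by (rule mob_lt_1[OF p' b])
  moreover have "cmod (mob_rot (- p) b * v) = 1"
    unfolding norm_mult mob_rot_def rotation_unit[OF p' b] v by simp
  ultimately show ?thesis by blast
qed

context nondegenerate_triangle
begin

text \<open>Each copy without its sides is open in the quotient, so a curve can change sheets only
  on a side.\<close>

lemma is_curve_footprint:
  fixes c :: "real \<Rightarrow> spoint" and t :: real
  assumes c: "continuous_map (top_of_set {0..1}) (surface_top V) c"
  shows "t \<in> {0..1} \<Longrightarrow> c t \<in> surface V" "continuous_on {0..1} (\<lambda>t. footprint (c t))"
    "t \<in> {0<..<1} \<Longrightarrow> footprint (c t) \<notin> sides \<Longrightarrow> \<forall>\<^sub>F s in nhds t. sheet (c s) = sheet (c t)"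
proof -
  show s: "c t \<in> surface V" if "t \<in> {0..1}" for t
    using continuous_map_image_subset_topspace[OF c] that unfolding topspace_surface by auto
  show "continuous_on {0..1} (\<lambda>t. footprint (c t))"
    using continuous_map_compose[OF c continuous_map_footprint] by (simp add: o_def)
  assume t: "t \<in> {0<..<1}" and ns: "footprint (c t) \<notin> sides"
  define W where "W = {p \<in> surface V. sheet p = sheet (c t) \<and> footprint p \<notin> sides}"
  have "openin (top_of_set {0..1}) {s \<in> topspace (top_of_set {0..1}). c s \<in> W}"
    using c openin_sheet_interior unfolding continuous_map_def W_def by blast
  then obtain T where T: "open T" "{s \<in> {0..1}. c s \<in> W} = {0..1} \<inter> T"
    unfolding openin_open by auto
  have "open (T \<inter> {0<..<1})" using T(1) by (intro open_Int) auto
  moreover have "t \<in> T \<inter> {0<..<1}"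
  proof -
    have "t \<in> {s \<in> {0..1}. c s \<in> W}" using t ns s[of t] by (auto simp: W_def)
    then show ?thesis using t unfolding T(2) by auto
  qed
  moreover have "sheet (c s) = sheet (c t)" if "s \<in> T \<inter> {0<..<1}" for s
  proof -
    have "s \<in> {s \<in> {0..1}. c s \<in> W}" unfolding T(2) using that by auto
    then show ?thesis by (simp add: W_def)
  qed
  ultimately show "\<forall>\<^sub>F s in nhds t. sheet (c s) = sheet (c t)"
    unfolding eventually_nhds by blast
qed

text \<open>The folded curve may have corners on the sides. Its metric speed is nevertheless that of
  c, by \<open>hdist_footprint_chart\<close>, and with the triangle inequality for
  \<open>hdist\<close> this gives the one-sided bounds that \<open>Dini_mono\<close> asks
  for.\<close>

lemma curve_length_ge:
  assumes c: "is_curve V c" and a: "cmod a < 1"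
  shows "hdist a (footprint (c 0)) \<le> curve_length V c + hdist a (footprint (c 1))"
proof -
  define f where "f t = footprint (c t)" for t
  define g where "g t = riem_norm V (c t) (velocity (surface_atlas V) c t)" for t
  obtain F where F: "finite F" "\<And>t. t \<in> {0..1} - F \<Longrightarrow> \<exists>\<kappa>\<in>surface_atlas V. \<exists>\<delta>>0.
        c ` ball t \<delta> \<subseteq> fst \<kappa> \<and> (snd \<kappa> \<circ> c) C1_differentiable_on ball t \<delta>"
    using c unfolding is_curve_def by blast
  have cm: "continuous_map (top_of_set {0..1}) (surface_top V) c" and gi: "g integrable_on {0..1}"
    using c unfolding is_curve_def g_def by blast+
  note cs = is_curve_footprint(1)[OF cm] and sh = is_curve_footprint(3)[OF cm]
  have fd: "cmod (f t) < 1" if "t \<in> {0..1}" for t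
    unfolding f_def using cs[OF that] by (rule footprint_disc)
  have near: "\<forall>\<^sub>F s in nhds t. c s \<in> surface V" if "t \<in> {0<..<1}" for t
  proof -
    have "\<forall>\<^sub>F s in nhds t. s \<in> {0<..<1}" using that by (intro eventually_nhds_in_open) auto
    then show ?thesis by eventually_elim (use cs in auto)
  qed
  \<comment> \<open>The length used up to time t plus the distance from the folded point to a; the
    claim is that G does not decrease overall.\<close>
  define G where "G t = integral {0..t} g + hdist a (f t)" for t
  have "G 0 \<le> G 1"
  proof (rule Dini_mono[where F = F and G = G])
    show "finite F" "(0::real) \<le> 1" using F by auto
    have "continuous_on {0..1} (\<lambda>t. hdist a (f t))"
      by (rule continuous_on_compose2[OF continuous_on_hdist[OF a]])
        (use is_curve_footprint(2)[OF cm] fd in \<open>auto simp: f_def\<close>)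
    then show "continuous_on {0..1} G"
      unfolding G_def by (intro continuous_on_add indefinite_integral_continuous_1 gi)
    fix t e :: real assume t: "0 < t" "t < 1" "t \<notin> F" and e: "e > 0"
    have tI: "t \<in> {0<..<1}" "t \<in> {0..1}" using t by auto
    obtain \<kappa> \<delta> where \<kappa>: "\<kappa> \<in> surface_atlas V" "\<delta> > 0" "c ` ball t \<delta> \<subseteq> fst \<kappa>"
      "(snd \<kappa> \<circ> c) C1_differentiable_on ball t \<delta>"
      using F(2)[of t] tI t(3) by blast
    obtain j where j: "\<kappa> = side_chart V j" using \<kappa>(1) by (auto simp: surface_atlas_def)
    define h where "h = snd \<kappa> \<circ> c"
    obtain D where D: "\<And>x. x \<in> ball t \<delta> \<Longrightarrow> (h has_vector_derivative D x) (at x)"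
      "continuous_on (ball t \<delta>) D"
      using \<kappa>(4) unfolding C1_differentiable_on_def h_def by blast
    define B where "B = ball t \<delta> \<inter> {0<..<1}"
    have B: "open B" "t \<in> B" using tI \<kappa>(2) by (auto simp: B_def)
    have cdom: "c s \<in> fst (side_chart V j)" if "s \<in> B" for s
      using \<kappa>(3) that unfolding j B_def by blast
    have hd: "cmod (h s) < 1" if "s \<in> B" for s
    proof -
      have "c s \<in> surface V" using that by (intro cs) (auto simp: B_def)
      then show ?thesis unfolding h_def j o_apply by (rule side_chart_disc)
    qed
    have gs: "g s = 2 * cmod (D s) / (1 - (cmod (h s))\<^sup>2)" if s: "s \<in> B" for s
    proof -
      have sI: "s \<in> {0<..<1}" using s by (simp add: B_def)
      show ?thesis unfolding g_def h_def j o_apply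
      proof (rule riem_norm_velocity[where c = c and t = s, OF cdom[OF s]])
        show "((snd (side_chart V j) \<circ> c) has_vector_derivative D s) (at s)"
          using D(1)[of s] s by (simp add: B_def h_def j)
        show "\<forall>\<^sub>F s in at s. c s \<in> surface V"
          using near[OF sI] by (simp add: eventually_nhds_conv_at)
        assume "footprint (c s) \<notin> sides"
        from sh[OF sI this] show "\<forall>\<^sub>F r in at s. sheet (c r) = sheet (c s)"
          by (simp add: eventually_nhds_conv_at)
      qed
    qed
    have "continuous_on B (\<lambda>s. 2 * cmod (D s) / (1 - (cmod (h s))\<^sup>2))"
    proof (intro continuous_intros)
      show "continuous_on B D" using D(2) by (rule continuous_on_subset) (simp add: B_def)
      show "continuous_on B h"
        using D(1) by (intro continuous_at_imp_continuous_on ballI has_vector_derivative_continuous) (auto simp: B_def)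
      show "\<forall>x\<in>B. 1 - (cmod (h x))\<^sup>2 \<noteq> 0"
        using hd by (metis abs_norm_cancel abs_square_less_1 eq_iff_diff_eq_0 less_irrefl)
    qed
    then have "continuous_on B g" by (rule continuous_on_eq) (simp add: gs)
    then have "isCont g t" using B continuous_on_eq_continuous_at by blast
    then have "((\<lambda>u. integral {0..u} g) has_vector_derivative g t) (at t within ({0..1} - {}))"
      using integral_has_vector_derivative_continuous_at[OF gi, of t "{}"] tI
      by (simp add: continuous_at_imp_continuous_at_within)
    then have "((\<lambda>u. integral {0..u} g) has_real_derivative g t) (at t)"
      using tI by (simp add: has_real_derivative_iff_has_vector_derivative at_within_Icc_at)
    then have "((\<lambda>s. (integral {0..s} g - integral {0..t} g) / (s - t)) \<longlongrightarrow> g t) (at t)"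
      by (simp add: has_field_derivative_iff)
    \<comment> \<open>Half of e is allowed for the growth of the length and half for the distance
      travelled; the speed \<open>g t\<close> cancels between them.\<close>
    then have 1: "\<forall>\<^sub>F s in at t. (integral {0..s} g - integral {0..t} g) / (s - t) > g t - e / 2"
      by (rule order_tendstoD) (use e in simp)
    have "((\<lambda>s. hdist (h t) (h s) / \<bar>s - t\<bar>) \<longlongrightarrow> 2 * cmod (D t) / (1 - (cmod (h t))\<^sup>2)) (at t)"
      using D(1)[of t] \<kappa>(2) hd[OF B(2)] by (intro hdist_has_speed) auto
    then have 2: "\<forall>\<^sub>F s in at t. hdist (h t) (h s) / \<bar>s - t\<bar> < g t + e / 2"
      by (rule order_tendstoD) (use e gs[OF B(2)] in simp)
    have 3: "\<forall>\<^sub>F s in at t. hdist (f t) (f s) = hdist (h t) (h s)"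
      unfolding h_def f_def j o_apply
    proof (rule hdist_footprint_chart[where c = c and t = t, OF cdom[OF B(2)]])
      show "\<forall>\<^sub>F s in at t. c s \<in> surface V"
        using near[OF tI(1)] by (simp add: eventually_nhds_conv_at)
      assume "footprint (c t) \<notin> sides"
      from sh[OF tI(1) this] show "\<forall>\<^sub>F r in at t. sheet (c r) = sheet (c t)"
        by (simp add: eventually_nhds_conv_at)
    qed
    have 4: "\<forall>\<^sub>F s in at t. s \<in> B" using B by (rule eventually_at_in_open')
    have "\<forall>\<^sub>F s in at t. s > t \<longrightarrow> G s \<ge> G t - e * (s - t)"
      using 1 2 3 4
    proof eventually_elim
      case (elim s)
      show ?case
      proof
        assume st: "t < s"
        have "s \<in> {0..1}" using elim(4) by (simp add: B_def)
        then have "hdist a (f t) \<le> hdist a (f s) + hdist (f s) (f t)"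
          using tI by (intro hdist_triangle a fd)
        moreover have "hdist (f s) (f t) = hdist (h t) (h s)" using elim(3) by (simp add: hdist_commute)
        moreover have "hdist (h t) (h s) < (g t + e / 2) * (s - t)"
          using elim(2) st by (simp add: pos_divide_less_eq)
        then have "hdist (h t) (h s) < g t * (s - t) + e * (s - t) / 2" by (simp add: distrib_right)
        moreover have "integral {0..s} g - integral {0..t} g > (g t - e / 2) * (s - t)"
          using elim(1) st by (simp add: pos_less_divide_eq)
        then have "integral {0..s} g - integral {0..t} g > g t * (s - t) - e * (s - t) / 2"
          by (simp add: left_diff_distrib)
        ultimately show "G s \<ge> G t - e * (s - t)" unfolding G_def by linarith
      qed
    qed
    then show "\<forall>\<^sub>F s in at_right t. G t - e * (s - t) \<le> G s"
      unfolding eventually_at_filter by (rule eventually_mono) auto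
  qed
  moreover have "G 0 = hdist a (f 0)" by (simp add: G_def)
  moreover have "G 1 = curve_length V c + hdist a (f 1)" by (simp add: G_def curve_length_def g_def[abs_def])
  ultimately show ?thesis by (simp add: f_def)
qed

lemma continuous_map_proj: "continuous_map (top_of_set (triangle V)) (surface_top V) (proj V b)"
  unfolding continuous_map_def
proof (intro conjI allI impI)
  show "proj V b \<in> topspace (top_of_set (triangle V)) \<rightarrow> topspace (surface_top V)"
    by (auto simp: topspace_surface proj_in_surface)
  fix U assume "openin (surface_top V) U"
  then have "openin (top_of_set (UNIV \<times> triangle V)) {x \<in> UNIV \<times> triangle V. glue V `` {x} \<in> U}"
    by (simp add: openin_surface_top)
  then obtain W where W: "open W" "{x \<in> UNIV \<times> triangle V. glue V `` {x} \<in> U} = (UNIV \<times> triangle V) \<inter> W"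
    unfolding openin_open by blast
  have "{z \<in> triangle V. proj V b z \<in> U} = triangle V \<inter> (Pair b -` W)"
  proof -
    have "proj V b z \<in> U \<longleftrightarrow> (b, z) \<in> W" if "z \<in> triangle V" for z
      using that W(2) by (auto simp: proj_def)
    then show ?thesis by auto
  qed
  moreover have "open (Pair b -` W)" by (intro open_vimage W continuous_intros)
  ultimately show "openin (top_of_set (triangle V)) {x \<in> topspace (top_of_set (triangle V)). proj V b x \<in> U}"
    by (auto simp: openin_open)
qed

text \<open>The radial segment runs inside the triangle or along a side through the vertex; in the latter case
  it may be taken in the first copy. So a single chart covers it up to its endpoints.\<close>

lemma radial_curve:
  assumes z: "z \<in> triangle V" and zi: "z \<noteq> V i" and b: "b \<or> (\<forall>j. j \<noteq> i \<longrightarrow> bary j z > 0)"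
  shows "\<exists>c. is_curve V c \<and> c 0 = proj V b z \<and> c 1 = vertex V i \<and> curve_length V c = hdist (V i) z"
proof -
  define a where "a = V i"
  define r where "r = hdist a z"
  define m where "m = mob a z"
  define u where "u = sgn m"
  have ad: "cmod a < 1" and zd: "cmod z < 1" using vertex_disc triangle_bary(1)[OF z] by (auto simp: a_def)
  have m0: "m \<noteq> 0" using mob_eq_0_iff[OF ad zd] zi by (simp add: m_def a_def)
  then have u: "cmod u = 1" by (simp add: u_def norm_sgn)
  have T: "tanh (r / 2) = cmod m" unfolding r_def m_def by (rule tanh_half_hdist[OF ad zd])
  have "tanh (r / 2) > 0" using T m0 by simp
  then have r: "r > 0" by simp
  \<comment> \<open>Run towards the vertex in unit time, hence at constant speed r.\<close>
  define \<gamma> where "\<gamma> t = pgeod a u ((1 - t) * r)" for t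
  have \<gamma>0: "\<gamma> 0 = z" unfolding \<gamma>_def u_def m_def r_def using pgeod_hdist[OF ad zd] by simp
  have \<gamma>1: "\<gamma> 1 = V i" using mob_eq by (simp add: \<gamma>_def pgeod_def a_def)
  have \<gamma>s: "\<exists>s. 0 < s \<and> s < 1 \<and> \<gamma> t = psegpt (V i) z s" if t: "t \<in> {0<..<1}" for t
  proof -
    define s where "s = tanh ((1 - t) * r / 2) / cmod m"
    have "0 < (1 - t) * r" "(1 - t) * r < r" using t r by auto
    then have "0 < tanh ((1 - t) * r / 2)" "tanh ((1 - t) * r / 2) < tanh (r / 2)" by simp_all
    then have s: "0 < s" "s < 1" using m0 by (auto simp: s_def T)
    have "\<gamma> t = psegpt a z s"
      using m0 by (simp add: \<gamma>_def pgeod_def psegpt_def u_def sgn_eq s_def m_def)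
    then show ?thesis using s by (auto simp: a_def)
  qed
  have \<gamma>T: "\<gamma> t \<in> triangle V" if t: "t \<in> {0..1}" for t
  proof -
    consider "t = 0" | "t = 1" | "t \<in> {0<..<1}" using t by fastforce
    then show ?thesis
    proof cases
      case 3
      then obtain s where "0 < s" "s < 1" "\<gamma> t = psegpt (V i) z s" using \<gamma>s by blast
      then have "\<gamma> t \<in> pseg (V i) z" by (auto simp: pseg_psegpt)
      then show ?thesis using pseg_triangle[OF vertex_in_triangle z] by blast
    qed (simp_all add: \<gamma>0 \<gamma>1 z vertex_in_triangle)
  qed
  have bpos: "bary k (\<gamma> t) > 0" if t: "t \<in> {0<..<1}" and k: "k = i \<or> bary k z > 0" for t k
  proof -
    obtain s where s: "0 < s" "s < 1" "\<gamma> t = psegpt (V i) z s" using \<gamma>s[OF t] by blast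
    obtain \<kappa> \<mu> where km: "\<kappa> > 0" "\<mu> > 0" "bary k (\<gamma> t) = \<kappa> * bary k (V i) + \<mu> * bary k z"
      unfolding s(3) using bary_psegpt[OF vertex_disc zd less_imp_le[OF s(1)] less_imp_le[OF s(2)], of i] s by blast
    show ?thesis
    proof (cases "k = i")
      case True
      then have "\<kappa> * bary k (V i) > 0" "\<mu> * bary k z \<ge> 0"
        using km bary_vertex(1)[of i] triangle_bary(2)[OF z] by simp_all
      then show ?thesis unfolding km(3) by linarith
    next
      case False
      then have "\<kappa> * bary k (V i) \<ge> 0" "\<mu> * bary k z > 0"
        using km k bary_vertex_nonneg[of k i] by simp_all
      then show ?thesis unfolding km(3) by linarith
    qed
  qed
  have pos: "bary k z = 0 \<or> bary k z > 0" for k using triangle_bary(2)[OF z, of k] by linarith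
  \<comment> \<open>Chart j excludes the sides j + 1 and j + 2. If the segment runs along side i + 1
    or i + 2, that side is taken as j; otherwise both sides through the vertex are avoided and j = i
    works.\<close>
  have "\<exists>j. \<forall>k\<in>{j + 1, j + 2}. k = i \<or> bary k z > 0"
  proof (cases "bary (i + 1) z = 0")
    case True
    then have "bary (i + 2) z \<noteq> 0" using bary_zero_vertex[OF z] zi by blast
    then show ?thesis using pos[of "i + 2"] by (intro exI[of _ "i + 1"]) (simp add: add_3)
  next
    case False
    then show ?thesis
      using pos[of "i + 1"] pos[of "i + 2"]
      by (cases "bary (i + 2) z = 0") (intro exI[of _ "i + 2"], simp add: add_3, intro exI[of _ i], simp)
  qed
  then obtain j where j: "\<And>t. t \<in> {0<..<1} \<Longrightarrow> bary (j + 1) (\<gamma> t) > 0 \<and> bary (j + 2) (\<gamma> t) > 0"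
    using bpos by blast
  define c where "c t = proj V b (\<gamma> t)" for t
  have sh: "sheet (c t) = b" if t: "t \<in> {0<..<1}" for t
  proof (cases b)
    case True
    then show ?thesis using \<gamma>T[of t] t by (simp add: c_def sheet_proj)
  next
    case False
    then have "bary k z > 0" if "k \<noteq> i" for k using b that by blast
    then have "bary k (\<gamma> t) > 0" for k using bpos[OF t, of k] by blast
    then have "\<gamma> t \<in> open_triangle"
      using \<gamma>T[of t] t triangle_bary(1) by (auto simp: open_triangle_def)
    then have "\<gamma> t \<notin> sides" by (rule open_triangle_not_sides)
    then show ?thesis using \<gamma>T[of t] t by (simp add: c_def sheet_proj)
  qed
  have fp: "footprint (c t) = \<gamma> t" if "t \<in> {0<..<1}" for t
    using \<gamma>T[of t] that by (simp add: c_def footprint_proj)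
  \<comment> \<open>In the first copy the chart shows the radial geodesic itself, in the second its
    mirror image, which is again a unit speed geodesic.\<close>
  obtain a' u' where a': "cmod a' < 1" "cmod u' = 1"
    and coord: "\<And>t. t \<in> {0<..<1} \<Longrightarrow> snd (side_chart V j) (c t) = pgeod a' u' ((1 - t) * r)"
  proof (cases b)
    case True
    show ?thesis
      by (rule that[OF ad u]) (simp add: side_chart_coord sh fp True \<gamma>_def)
  next
    case False
    obtain a' u' where *: "cmod a' < 1" "cmod u' = 1" "\<And>t. R j (pgeod a u t) = pgeod a' u' t"
      using preflect_pgeod[OF vertex_disc vertex_disc vertices_distinct ad u] by blast
    show ?thesis
      by (rule that[OF *(1,2)]) (simp add: side_chart_coord sh fp False *(3) \<gamma>_def)
  qed
  define h where "h t = pgeod a' u' ((1 - t) * r)" for t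
  have shift: "((\<lambda>t. (1 - t) * r) has_vector_derivative - r) (at t)" for t
    by (auto intro!: derivative_eq_intros)
  have hd: "(h has_vector_derivative - r *\<^sub>R pgeod_deriv a' u' ((1 - t) * r)) (at t)" for t
  proof -
    have "(pgeod a' u' \<circ> (\<lambda>t. (1 - t) * r) has_vector_derivative - r *\<^sub>R pgeod_deriv a' u' ((1 - t) * r)) (at t)"
      by (intro vector_diff_chain_at pgeod_has_vector_derivative a' shift)
    then show ?thesis by (simp add: h_def[abs_def] o_def)
  qed
  have dom: "c t \<in> fst (side_chart V j)" if "t \<in> {0<..<1}" for t
  proof -
    have "\<gamma> t \<notin> side V (j + 1)" "\<gamma> t \<notin> side V (j + 2)" using j[OF that] side_bary by force+
    then show ?thesis using fp[OF that] \<gamma>T[of t] that by (simp add: side_chart_dom c_def proj_in_surface)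
  qed
  have cd: "((snd (side_chart V j) \<circ> c) has_vector_derivative - r *\<^sub>R pgeod_deriv a' u' ((1 - t) * r)) (at t)"
    if t: "t \<in> {0<..<1}" for t
    by (rule has_vector_derivative_transform_within_open[OF hd _ t]) (use coord in \<open>auto simp: h_def\<close>)
  have speed: "riem_norm V (c t) (velocity (surface_atlas V) c t) = r" if t: "t \<in> {0<..<1}" for t
  proof -
    have ev: "\<forall>\<^sub>F s in at t. s \<in> {0<..<1}" using t by (intro eventually_at_in_open') auto
    have "riem_norm V (c t) (velocity (surface_atlas V) c t)
        = 2 * cmod (- r *\<^sub>R pgeod_deriv a' u' ((1 - t) * r)) / (1 - (cmod (snd (side_chart V j) (c t)))\<^sup>2)"
    proof (rule riem_norm_velocity[where c = c and t = t, OF dom[OF t] cd[OF t]])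
      show "\<forall>\<^sub>F s in at t. c s \<in> surface V"
        using ev by eventually_elim (use \<gamma>T in \<open>auto simp: c_def proj_in_surface\<close>)
      show "\<forall>\<^sub>F s in at t. sheet (c s) = sheet (c t)"
        using ev by eventually_elim (use sh t in auto)
    qed
    also have "\<dots> = r * (2 * cmod (pgeod_deriv a' u' ((1 - t) * r)) / (1 - (cmod (pgeod a' u' ((1 - t) * r)))\<^sup>2))"
      using r coord[OF t] by simp
    also have "\<dots> = r" using pgeod_unit_speed[OF a', of "(1 - t) * r"] by (simp only: mult_1_right)
    finally show ?thesis .
  qed
  have int: "((\<lambda>t. riem_norm V (c t) (velocity (surface_atlas V) c t)) has_integral r) {0..1}"
  proof (rule has_integral_spike_finite[of "{0, 1}"])
    show "((\<lambda>t::real. r) has_integral r) {0..1}" using has_integral_const_real[of r 0 1] by simp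
  qed (use speed in auto)
  have "is_curve V c" unfolding is_curve_def
  proof (intro conjI)
    have "continuous_on {0..1} \<gamma>" unfolding \<gamma>_def
    proof (rule continuous_on_compose2[where g = "pgeod a u" and t = UNIV])
      show "continuous_on UNIV (pgeod a u)"
        using pgeod_has_vector_derivative[OF ad u]
        by (intro continuous_at_imp_continuous_on ballI has_vector_derivative_continuous)
    qed (auto intro!: continuous_intros)
    then have "continuous_map (top_of_set {0..1}) (top_of_set (triangle V)) \<gamma>"
      using \<gamma>T by (auto simp: continuous_map_in_subtopology)
    from continuous_map_compose[OF this continuous_map_proj[of b]]
    show "continuous_map (top_of_set {0..1}) (surface_top V) c" by (simp add: o_def c_def[abs_def])
    show "\<exists>F. finite F \<and> (\<forall>t\<in>{0..1} - F. \<exists>\<kappa>\<in>surface_atlas V. \<exists>\<delta>>0.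
        c ` ball t \<delta> \<subseteq> fst \<kappa> \<and> (snd \<kappa> \<circ> c) C1_differentiable_on ball t \<delta>)"
    proof (intro exI[of _ "{0, 1}"] conjI ballI)
      fix t :: real assume "t \<in> {0..1} - {0, 1}"
      then have "t \<in> {0<..<1}" by auto
      then obtain \<delta> where \<delta>: "\<delta> > 0" "ball t \<delta> \<subseteq> {0<..<1}"
        using open_contains_ball[of "{0<..<1::real}"] open_greaterThanLessThan[of 0 "1::real"] by blast
      have "c ` ball t \<delta> \<subseteq> fst (side_chart V j)" using dom \<delta>(2) by blast
      moreover have "(snd (side_chart V j) \<circ> c) C1_differentiable_on ball t \<delta>"
        unfolding C1_differentiable_on_def
      proof (intro exI[of _ "\<lambda>t. - r *\<^sub>R pgeod_deriv a' u' ((1 - t) * r)"] conjI ballI)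
        show "continuous_on (ball t \<delta>) (\<lambda>t. - r *\<^sub>R pgeod_deriv a' u' ((1 - t) * r))"
          unfolding pgeod_deriv_def
        proof (intro continuous_intros)
          show "\<forall>s\<in>ball t \<delta>. (1 + cnj a' * (of_real (tanh ((1 - s) * r / 2)) * u'))\<^sup>2 \<noteq> 0"
            using mob_denom_nz'[OF a'(1) tanh_unit_lt_1[OF a'(2)]] by simp
        qed (use cosh_real_pos in \<open>auto simp: less_imp_neq[symmetric]\<close>)
      qed (use cd \<delta>(2) in blast)
      ultimately show "\<exists>\<kappa>\<in>surface_atlas V. \<exists>\<delta>>0. c ` ball t \<delta> \<subseteq> fst \<kappa> \<and> (snd \<kappa> \<circ> c) C1_differentiable_on ball t \<delta>"
        using \<delta>(1) unfolding surface_atlas_def by blast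
    qed simp
    show "(\<lambda>t. riem_norm V (c t) (velocity (surface_atlas V) c t)) integrable_on {0..1}"
      using int by blast
  qed
  moreover have "curve_length V c = r" unfolding curve_length_def using int by (rule integral_unique)
  moreover have "c 1 = vertex V i"
    unfolding c_def \<gamma>1 vertex_def by (rule proj_side[OF vertex_in_sides])
  ultimately show ?thesis using \<gamma>0 by (auto simp: c_def r_def a_def)
qed

text \<open>The radial curve attains the infimum, and \<open>curve_length_ge\<close> with the vertex
  as a shows that no curve is shorter.\<close>

lemma sdist_eq:
  assumes z: "z \<in> triangle V" and zi: "z \<noteq> V i"
  shows "sdist V (proj V b z) (vertex V i) = hdist (V i) z"
proof -
  define L where "L = {curve_length V c | c. is_curve V c \<and> c 0 = proj V b z \<and> c 1 = vertex V i}"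
  \<comment> \<open>On a side the representative can be moved to the first copy; off the sides all
    coordinates are positive. In both cases \<open>radial_curve\<close> applies.\<close>
  have "\<exists>b'. proj V b z = proj V b' z \<and> (b' \<or> (\<forall>j. j \<noteq> i \<longrightarrow> bary j z > 0))"
  proof (cases "z \<in> sides")
    case True
    then show ?thesis using proj_side by blast
  next
    case False
    have "bary j z > 0" for j
    proof -
      have "bary j z \<noteq> 0" using False bary_zero_side[OF z, of j] by auto
      then show ?thesis using triangle_bary(2)[OF z, of j] by linarith
    qed
    then show ?thesis by blast
  qed
  then obtain c where "is_curve V c" "c 0 = proj V b z" "c 1 = vertex V i" "curve_length V c = hdist (V i) z"
    using radial_curve[OF z zi] by metis
  then have in_L: "hdist (V i) z \<in> L" unfolding L_def mem_Collect_eq by (intro exI[of _ c]) simp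
  have lower: "hdist (V i) z \<le> x" if x: "x \<in> L" for x
  proof -
    obtain c where c: "x = curve_length V c" "is_curve V c" "c 0 = proj V b z" "c 1 = vertex V i"
      using x by (auto simp: L_def)
    have "hdist (V i) (V i) = 0" by (simp add: hdist_def mob_eq)
    then show ?thesis
      using curve_length_ge[OF c(2) vertex_disc[of i]] c z by (simp add: footprint_proj vertex_surface)
  qed
  have "Inf L = hdist (V i) z" using in_L lower by (rule cInf_eq_minimum)
  then show ?thesis by (simp add: sdist_def L_def)
qed

end

section \<open>Geodesics at interior points\<close>

text \<open>\<open>is_geodesic\<close> asks at each time for a description based at that time. The
  addition formula of tanh shifts the parameter along a diameter, and \<open>mob_mob\<close> carries
  this to a general base point.\<close>

lemma pgeod_translate:
  assumes a: "cmod a < 1" and u: "cmod u = 1"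
  shows "\<exists>u'. cmod u' = 1 \<and> (\<forall>s. pgeod a u (t + s) = pgeod (pgeod a u t) u' s)"
proof (intro exI[of _ "mob_rot (- a) (of_real (tanh (t / 2)) * u) * u"] conjI allI)
  define z where "z = of_real (tanh (t / 2)) * u"
  have z: "cmod z < 1" unfolding z_def by (rule tanh_unit_lt_1[OF u])
  have a': "cmod (- a) < 1" using a by simp
  show "cmod (mob_rot (- a) (of_real (tanh (t / 2)) * u) * u) = 1"
    unfolding z_def[symmetric] norm_mult mob_rot_def rotation_unit[OF a' z] u by simp
  fix s
  have uu: "cnj u * u = 1" using u by (simp add: complex_norm_square[symmetric] mult.commute)
  have "mob (- z) (of_real (tanh (s / 2)) * u)
      = (of_real (tanh (s / 2)) * u + of_real (tanh (t / 2)) * u) / (1 + of_real (tanh (t / 2) * tanh (s / 2)) * (cnj u * u))"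
    by (simp add: mob_minus_eq z_def mult_ac)
  also have "\<dots> = of_real ((tanh (t / 2) + tanh (s / 2)) / (1 + tanh (t / 2) * tanh (s / 2))) * u"
    unfolding uu by (simp add: algebra_simps)
  also have "(tanh (t / 2) + tanh (s / 2)) / (1 + tanh (t / 2) * tanh (s / 2)) = tanh ((t + s) / 2)"
    by (subst add_divide_distrib, subst tanh_add) (auto simp: cosh_real_pos less_imp_neq[symmetric])
  finally have "pgeod a u (t + s) = mob (- a) (mob (- z) (of_real (tanh (s / 2)) * u))"
    by (simp add: pgeod_def)
  also have "\<dots> = pgeod (pgeod a u t) (mob_rot (- a) z * u) s"
    using mob_mob[OF a' z tanh_unit_lt_1[OF u]] by (simp add: pgeod_def mob_rot_def z_def mult_ac)
  finally show "pgeod a u (t + s) = pgeod (pgeod a u t) (mob_rot (- a) (of_real (tanh (t / 2)) * u) * u) s"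
    by (simp add: z_def)
qed

lemma pgeod_0 [simp]: "pgeod a u 0 = a"
  by (simp add: pgeod_def mob_minus_eq)

lemma pgeod_deriv_0: "pgeod_deriv a u 0 = of_real ((1 - (cmod a)\<^sup>2) / 2) * u"
  by (simp add: pgeod_deriv_def)

lemma isCont_pgeod: "isCont (pgeod a u) t" if "cmod a < 1" "cmod u = 1"
  using pgeod_has_vector_derivative[OF that] by (rule has_vector_derivative_continuous)

lemma sinh_hdist:
  assumes "cmod a < 1" "cmod z < 1"
  shows "sinh (hdist a z) = 2 * cmod (mob a z) / (1 - (cmod (mob a z))\<^sup>2)"
proof -
  define x where "x = hdist a z / 2"
  have t: "cmod (mob a z) = sinh x / cosh x"
    using tanh_half_hdist[OF assms] by (simp add: x_def tanh_def)
  have c: "cosh x \<noteq> 0" using cosh_real_pos[of x] by simp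
  have s: "(sinh x)\<^sup>2 = (cosh x)\<^sup>2 - 1" by (rule sinh_square_eq)
  have "1 - (cmod (mob a z))\<^sup>2 = ((cosh x)\<^sup>2 - (sinh x)\<^sup>2) / (cosh x)\<^sup>2"
    using c by (simp add: t power_divide diff_divide_distrib)
  also have "\<dots> = 1 / (cosh x)\<^sup>2" unfolding s by simp
  finally have "2 * cmod (mob a z) / (1 - (cmod (mob a z))\<^sup>2) = 2 * sinh x * cosh x"
    using c by (simp add: t power2_eq_square)
  also have "\<dots> = sinh (2 * x)" by (simp add: sinh_double)
  finally show ?thesis by (simp add: x_def)
qed

context nondegenerate_triangle
begin

text \<open>The tangent vector at an interior point of the first copy with the same expression \<open>\<eta>\<close> in all
  three charts, which agree near this point.\<close>

definition tvec :: "complex \<Rightarrow> stangent" where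
  "tvec \<eta> = (\<lambda>\<kappa>. if \<kappa> \<in> surface_atlas V then \<eta> else 0)"

lemma open_triangle_chart:
  assumes "z \<in> open_triangle"
  shows "proj V True z \<in> fst (side_chart V j)" "snd (side_chart V j) (proj V True z) = z"
    "footprint (proj V True z) = z" "sheet (proj V True z)" "proj V True z \<in> surface V"
  using assms open_triangle_subset open_triangle_not_side[OF assms]
  by (auto simp: side_chart_dom side_chart_coord footprint_proj sheet_proj proj_in_surface subset_iff)

lemma open_triangle_reg: "z \<in> open_triangle \<Longrightarrow> proj V True z \<in> surface_reg V"
proof -
  assume z: "z \<in> open_triangle"
  have "proj V True z \<noteq> vertex V i" for i
    using open_triangle_chart(3)[OF z] vertex_surface(2)[of i] vertex_in_sides[of i] open_triangle_not_sides[OF z] by auto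
  then show ?thesis using open_triangle_chart(5)[OF z] by (auto simp: surface_reg_def)
qed

lemma chart_coord_open_triangle:
  assumes "q \<in> fst (side_chart V j)" "snd (side_chart V j) q \<in> open_triangle"
  shows "q = proj V True (snd (side_chart V j) q)"
proof -
  have q: "q \<in> surface V" using assms(1) side_chart_dom by blast
  have "sheet q"
    using R_triangle_not_open[OF footprint_in_triangle[OF q], of j] assms(2)
    by (simp add: side_chart_coord split: if_splits)
  then show ?thesis using proj_sheet_footprint[OF q] by (simp add: side_chart_coord)
qed

text \<open>\<open>from_chart\<close> returns some preimage; this one is unique because a point of
  the second copy cannot have its coordinate in the open triangle.\<close>

lemma from_chart_open_triangle:
  assumes z: "z \<in> open_triangle"
  shows "from_chart (side_chart V j) z = proj V True z"
proof -
  define q where "q = from_chart (side_chart V j) z"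
  have "z \<in> snd (side_chart V j) ` fst (side_chart V j)"
    using open_triangle_chart(1,2)[OF z, of j] by (metis imageI)
  then have "q \<in> fst (side_chart V j)" "snd (side_chart V j) q = z"
    unfolding q_def from_chart_def by (rule inv_into_into, rule f_inv_into_f)
  then show ?thesis using chart_coord_open_triangle[of q j] z by (simp add: q_def)
qed

lemma tangent_space_open_triangle:
  assumes z: "z \<in> open_triangle"
  shows "tangent_space (surface_atlas V) (proj V True z) = range tvec"
proof -
  have fd: "frechet_derivative (snd (side_chart V j') \<circ> from_chart (side_chart V j)) (at (snd (side_chart V j) (proj V True z))) = (\<lambda>x. x)" for j j'
  proof -
    have "((\<lambda>x. x) has_derivative (\<lambda>x. x)) (at z)" by (rule has_derivative_ident)
    then have "((snd (side_chart V j') \<circ> from_chart (side_chart V j)) has_derivative (\<lambda>x. x)) (at z)"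
      by (rule has_derivative_transform_within_open[OF _ open_open_triangle z])
        (simp add: from_chart_open_triangle open_triangle_chart)
    then show ?thesis using frechet_derivative_at z by (metis open_triangle_chart(2))
  qed
  have dom: "\<kappa> \<in> surface_atlas V \<Longrightarrow> proj V True z \<in> fst \<kappa>" for \<kappa>
    using open_triangle_chart(1)[OF z] by (auto simp: surface_atlas_def)
  have atl: "\<kappa> \<in> surface_atlas V \<longleftrightarrow> (\<exists>j. \<kappa> = side_chart V j)" for \<kappa>
    by (auto simp: surface_atlas_def)
  have atlI: "side_chart V j \<in> surface_atlas V" for j by (simp add: surface_atlas_def)
  show ?thesis
  proof (intro set_eqI iffI)
    fix \<xi> assume "\<xi> \<in> tangent_space (surface_atlas V) (proj V True z)"
    then have 1: "\<And>\<kappa>. \<kappa> \<notin> surface_atlas V \<Longrightarrow> \<xi> \<kappa> = 0"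
      and 2: "\<And>\<kappa> \<kappa>'. \<kappa> \<in> surface_atlas V \<Longrightarrow> \<kappa>' \<in> surface_atlas V \<Longrightarrow>
        \<xi> \<kappa>' = frechet_derivative (snd \<kappa>' \<circ> from_chart \<kappa>) (at (snd \<kappa> (proj V True z))) (\<xi> \<kappa>)"
      unfolding tangent_space_def using dom by blast+
    have "\<xi> (side_chart V j) = \<xi> (side_chart V 0)" for j
      using 2[OF atlI atlI, of j 0] by (simp only: fd)
    then have "\<xi> = tvec (\<xi> (side_chart V 0))"
      using 1 atl by (intro ext) (auto simp: tvec_def)
    then show "\<xi> \<in> range tvec" by blast
  next
    fix \<xi> assume "\<xi> \<in> range tvec"
    then obtain \<eta> where \<eta>: "\<xi> = tvec \<eta>" by blast
    show "\<xi> \<in> tangent_space (surface_atlas V) (proj V True z)"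
      unfolding tangent_space_def mem_Collect_eq
    proof (intro conjI allI ballI impI)
      fix \<kappa> assume "\<not> (\<kappa> \<in> surface_atlas V \<and> proj V True z \<in> fst \<kappa>)"
      then show "\<xi> \<kappa> = 0" using dom by (auto simp: \<eta> tvec_def)
    next
      fix \<kappa> \<kappa>' assume "\<kappa> \<in> surface_atlas V" "\<kappa>' \<in> surface_atlas V"
      then show "\<xi> \<kappa>' = frechet_derivative (snd \<kappa>' \<circ> from_chart \<kappa>) (at (snd \<kappa> (proj V True z))) (\<xi> \<kappa>)"
        using atl fd by (auto simp: \<eta> tvec_def)
    qed
  qed
qed

lemma chart_at_open_triangle:
  assumes z: "z \<in> open_triangle"
  shows "chart_at V (proj V True z) \<in> surface_atlas V" "snd (chart_at V (proj V True z)) (proj V True z) = z"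
proof -
  obtain j where "chart_at V (proj V True z) = side_chart V j"
    using chart_at_surface[OF open_triangle_chart(1)[OF z]] by blast
  then show "chart_at V (proj V True z) \<in> surface_atlas V" "snd (chart_at V (proj V True z)) (proj V True z) = z"
    using open_triangle_chart(2)[OF z] by (auto simp: surface_atlas_def)
qed

lemma riem_norm_tvec: "z \<in> open_triangle \<Longrightarrow> riem_norm V (proj V True z) (tvec \<eta>) = 2 * cmod \<eta> / (1 - (cmod z)\<^sup>2)"
  by (simp add: riem_norm_def Let_def chart_at_open_triangle tvec_def)

lemma oriented_angle_tvec:
  "z \<in> open_triangle \<Longrightarrow> oriented_angle V ori (proj V True z) (tvec \<xi>) (tvec \<eta>) = orient ori (sgn (\<eta> / \<xi>))"
  by (simp add: oriented_angle_def Let_def chart_at_open_triangle tvec_def)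

lemma eventually_open_triangle:
  assumes "isCont \<gamma> s" "\<gamma> s \<in> open_triangle"
  shows "\<forall>\<^sub>F r in nhds s. \<gamma> r \<in> open_triangle"
  using assms open_open_triangle by (auto simp: continuous_at_open eventually_nhds)

lemma velocity_open_triangle:
  assumes ev: "\<forall>\<^sub>F r in nhds s. c r = proj V True (\<gamma> r)" and \<gamma>s: "\<gamma> s \<in> open_triangle"
    and D: "(\<gamma> has_vector_derivative D) (at s)"
  shows "velocity (surface_atlas V) c s = tvec D"
proof -
  from ev eventually_open_triangle[OF has_vector_derivative_continuous[OF D] \<gamma>s] have ev2: "\<forall>\<^sub>F r in nhds s. \<gamma> r = (snd (side_chart V j) \<circ> c) r" for j
    by eventually_elim (simp add: open_triangle_chart)
  have cs: "c s = proj V True (\<gamma> s)" using ev by (rule eventually_nhds_x_imp_x)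
  have "((snd (side_chart V j) \<circ> c) has_vector_derivative D) (at s)" for j
    by (rule has_vector_derivative_eventually[OF D ev2])
  then have "vector_derivative (snd (side_chart V j) \<circ> c) (at s) = D" for j
    by (rule vector_derivative_at)
  then have "\<kappa> \<in> surface_atlas V \<Longrightarrow> c s \<in> fst \<kappa> \<and> vector_derivative (snd \<kappa> \<circ> c) (at s) = D" for \<kappa>
    using cs open_triangle_chart(1)[OF \<gamma>s] unfolding surface_atlas_def by fastforce
  then show ?thesis unfolding velocity_def tvec_def by (intro ext) simp
qed

text \<open>The explicit geodesic shows that the choice in \<open>geodesic_of\<close> is not
  vacuous. Any chosen curve is near 0 some \<open>pgeod a w\<close> in a chart, where its position
  forces a = z and its velocity forces w = u.\<close>

lemma geodesic_of_open_triangle: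
  assumes z: "z \<in> open_triangle" and u: "cmod u = 1"
  shows "\<forall>\<^sub>F s in nhds 0. geodesic_of V (proj V True z) (tvec (pgeod_deriv z u 0)) s = proj V True (pgeod z u s)"
proof -
  define p where "p = proj V True z"
  define \<xi> where "\<xi> = tvec (pgeod_deriv z u 0)"
  define Pc where "Pc c \<longleftrightarrow> (\<exists>\<delta>>0. is_geodesic V \<delta> c) \<and> c 0 = p \<and> velocity (surface_atlas V) c 0 = \<xi>" for c
  have zd: "cmod z < 1" using z by (rule open_triangleD)
  have evO: "\<forall>\<^sub>F s in nhds 0. pgeod z u s \<in> open_triangle"
    by (rule eventually_open_triangle[OF isCont_pgeod[OF zd u]]) (simp add: z)
  then obtain \<delta> where \<delta>: "\<delta> > 0" "\<And>s. \<bar>s\<bar> < \<delta> \<Longrightarrow> pgeod z u s \<in> open_triangle"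
    unfolding eventually_nhds_metric by auto
  have "Pc (\<lambda>s. proj V True (pgeod z u s))" unfolding Pc_def
  proof (intro conjI exI[of _ \<delta>])
    show "is_geodesic V \<delta> (\<lambda>s. proj V True (pgeod z u s))" unfolding is_geodesic_def
    proof
      fix t assume t: "t \<in> {-\<delta><..<\<delta>}"
      obtain u' where u': "cmod u' = 1" "\<And>s. pgeod z u (t + s) = pgeod (pgeod z u t) u' s"
        using pgeod_translate[OF zd u] by blast
      have "\<forall>\<^sub>F s in nhds t. s \<in> {-\<delta><..<\<delta>}" using t by (intro eventually_nhds_in_open) auto
      then have "\<forall>\<^sub>F s in nhds t. proj V True (pgeod z u s) \<in> fst (side_chart V 0) \<and>
          snd (side_chart V 0) (proj V True (pgeod z u s)) = pgeod (pgeod z u t) u' (s - t)"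
      proof eventually_elim
        case (elim s)
        then have "pgeod z u s \<in> open_triangle" by (intro \<delta>(2)) auto
        then show ?case using u'(2)[of "s - t"] by (simp add: open_triangle_chart)
      qed
      then show "\<exists>\<kappa>\<in>surface_atlas V. \<exists>a u'. cmod a < 1 \<and> cmod u' = 1 \<and>
          (\<forall>\<^sub>F s in nhds t. proj V True (pgeod z u s) \<in> fst \<kappa> \<and> snd \<kappa> (proj V True (pgeod z u s)) = pgeod a u' (s - t))"
        using u'(1) pgeod_disc[OF zd u] unfolding surface_atlas_def by blast
    qed
    show "velocity (surface_atlas V) (\<lambda>s. proj V True (pgeod z u s)) 0 = \<xi>"
      unfolding \<xi>_def by (rule velocity_open_triangle[where \<gamma> = "pgeod z u"])
        (use z pgeod_has_vector_derivative[OF zd u] in auto)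
  qed (use \<delta>(1) in \<open>simp_all add: p_def\<close>)
  then have "Pc (SOME c. Pc c)" by (rule someI[of Pc])
  moreover define c where "c = geodesic_of V p \<xi>"
  ultimately have "Pc c" by (simp only: c_def geodesic_of_def Pc_def)
  then obtain \<delta>' where c: "\<delta>' > 0" "is_geodesic V \<delta>' c" "c 0 = p" "velocity (surface_atlas V) c 0 = \<xi>"
    unfolding Pc_def by blast
  then have "0 \<in> {-\<delta>'<..<\<delta>'}" by simp
  then obtain \<kappa> a w where k: "\<kappa> \<in> surface_atlas V" "cmod a < 1" "cmod w = 1"
    "\<forall>\<^sub>F s in nhds 0. c s \<in> fst \<kappa> \<and> snd \<kappa> (c s) = pgeod a w (s - 0)"
    using c(2) unfolding is_geodesic_def by blast
  obtain j where j: "\<kappa> = side_chart V j" using k(1) by (auto simp: surface_atlas_def)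
  have 0: "c 0 \<in> fst \<kappa> \<and> snd \<kappa> (c 0) = pgeod a w (0 - 0)"
    using k(4) by (rule eventually_nhds_x_imp_x)
  then have az: "a = z" using open_triangle_chart(2)[OF z] by (simp add: c(3) p_def j)
  have ev: "\<forall>\<^sub>F s in nhds 0. pgeod a w s = (snd \<kappa> \<circ> c) s" using k(4) by eventually_elim simp
  have "((snd \<kappa> \<circ> c) has_vector_derivative pgeod_deriv a w 0) (at 0)"
    by (rule has_vector_derivative_eventually[OF pgeod_has_vector_derivative[OF k(2,3)] ev])
  then have "vector_derivative (snd \<kappa> \<circ> c) (at 0) = pgeod_deriv a w 0" by (rule vector_derivative_at)
  then have "pgeod_deriv a w 0 = velocity (surface_atlas V) c 0 \<kappa>"
    using k(1) 0 by (simp add: velocity_def)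
  also have "\<dots> = pgeod_deriv z u 0" using k(1) by (simp add: c(4) \<xi>_def tvec_def)
  finally have "of_real ((1 - (cmod z)\<^sup>2) / 2) * w = of_real ((1 - (cmod z)\<^sup>2) / 2) * u"
    by (simp only: az pgeod_deriv_0)
  moreover have "(1 - (cmod z)\<^sup>2) / 2 \<noteq> 0" using zd by (simp add: abs_square_eq_1)
  ultimately have wu: "w = u" by (simp only: mult_left_cancel of_real_eq_0_iff not_False_eq_True)
  show ?thesis using k(4) evO
  proof eventually_elim
    case (elim s)
    then have "c s = proj V True (pgeod z u s)"
      using chart_coord_open_triangle[of "c s" j] by (simp add: j az wu)
    then show ?case by (simp add: c_def p_def \<xi>_def)
  qed
qed

lemma vertex_not_open: "z \<in> open_triangle \<Longrightarrow> z \<noteq> V i"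
  using vertex_in_sides open_triangle_not_sides by blast

lemma sdist_open_triangle: "z \<in> open_triangle \<Longrightarrow> sdist V (proj V True z) (vertex V i) = hdist (V i) z"
  using sdist_eq[of z i True] open_triangle_subset vertex_not_open by blast

lemma outward_open_triangle:
  assumes z: "z \<in> open_triangle"
  shows "outward V i (proj V True z) = tvec (pgeod_deriv (V i) (sgn (mob (V i) z)) (hdist (V i) z))"
proof -
  have zd: "cmod z < 1" using z by (rule open_triangleD)
  have "mob (V i) z \<noteq> 0" using mob_eq_0_iff[OF vertex_disc zd] vertex_not_open[OF z] by auto
  then have u: "cmod (sgn (mob (V i) z)) = 1" by (simp add: norm_sgn)
  show ?thesis unfolding outward_def sdist_open_triangle[OF z]
  proof (rule velocity_open_triangle)
    show "\<forall>\<^sub>F r in nhds (hdist (V i) z). radial V i (proj V True z) r = proj V True (pgeod (V i) (sgn (mob (V i) z)) r)"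
      using open_triangle_chart[OF z] by (simp add: radial_def)
    show "pgeod (V i) (sgn (mob (V i) z)) (hdist (V i) z) \<in> open_triangle"
      using pgeod_hdist[OF vertex_disc zd] z by simp
  qed (rule pgeod_has_vector_derivative[OF vertex_disc u])
qed

end

section \<open>The geodesic field in the charts at the singular fibers\<close>

definition sing_field :: "real \<Rightarrow> complex \<Rightarrow> real \<Rightarrow> complex \<times> real" where
  "sing_field k w b = (w * (of_real (sqrt (1 + (cmod w)\<^sup>2) * cos b) + \<i> * of_real (k * sin b)),
     - (sqrt (1 + (cmod w)\<^sup>2) * sin b))"

definition saddle :: "real \<Rightarrow> complex \<times> real \<Rightarrow> complex \<times> real" where
  "saddle e = (\<lambda>(w, s). (of_real e * w, - e * s))"

definition orsign :: "bool \<Rightarrow> real" where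
  "orsign ori = (if ori then 1 else -1)"

lemma orient_simps:
  "orient ori (x * y) = orient ori x * orient ori y"
  "orient ori (x / y) = orient ori x / orient ori y"
  "orient ori (of_real r) = of_real r"
  "cmod (orient ori x) = cmod x"
  "Re (orient ori x) = Re x" "Im (orient ori x) = orsign ori * Im x"
  "orient ori (sgn x) = sgn (orient ori x)"
  "orient ori x = 0 \<longleftrightarrow> x = 0"
  by (auto simp: orient_def orsign_def sgn_eq)

lemma orient_orient: "orient ori (orient ori x) = x"
  by (simp add: orient_def)

lemma bounded_linear_orient: "bounded_linear (orient ori)"
  unfolding orient_def[abs_def] by (cases ori) (simp_all add: bounded_linear_ident bounded_linear_cnj)

lemma sgn_pos_mult: "sgn (of_real r * x) = sgn x" if "r > 0" for x :: complex
  using that by (simp add: sgn_mult sgn_of_real)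

lemma has_real_derivative_Arg:
  assumes f: "(f has_vector_derivative f') (at t)" and nz: "f t \<notin> \<real>\<^sub>\<le>\<^sub>0"
  shows "((\<lambda>s. Arg (f s)) has_real_derivative Im (f' / f t)) (at t)"
proof -
  have "((Ln \<circ> f) has_vector_derivative f' * inverse (f t)) (at t)"
    using f has_field_derivative_Ln[OF nz] by (intro field_vector_diff_chain_at)
  then have "((\<lambda>s. Im ((Ln \<circ> f) s)) has_vector_derivative Im (f' * inverse (f t))) (at t)"
    by (rule bounded_linear.has_vector_derivative[OF bounded_linear_Im])
  then have d: "((\<lambda>s. Im ((Ln \<circ> f) s)) has_real_derivative Im (f' / f t)) (at t)"
    by (simp add: has_real_derivative_iff_has_vector_derivative divide_inverse)
  have "f t \<noteq> 0" using nz by auto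
  moreover have "isCont f t" using f by (rule has_vector_derivative_continuous)
  ultimately have "\<exists>S. open S \<and> t \<in> S \<and> (\<forall>s\<in>S. f s \<in> - {0})"
    using open_Compl[OF closed_singleton[of "0::complex"]] unfolding continuous_at_open by blast
  then have "\<forall>\<^sub>F s in nhds t. f s \<noteq> 0" unfolding eventually_nhds by auto
  then have "\<forall>\<^sub>F s in nhds t. Im ((Ln \<circ> f) s) = Arg (f s)"
    by eventually_elim (simp add: Arg_eq_Im_Ln)
  then show ?thesis using d DERIV_cong_ev[of t t "\<lambda>s. Im ((Ln \<circ> f) s)" "\<lambda>s. Arg (f s)"] by simp
qed

lemma has_vector_derivative_polar:
  assumes R: "(R has_real_derivative R') (at t)" and \<phi>: "(\<phi> has_real_derivative \<phi>') (at t)"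
  shows "((\<lambda>s. of_real (R s) * cis (\<phi> s)) has_vector_derivative
    (of_real R' + \<i> * of_real (R t * \<phi>')) * cis (\<phi> t)) (at t)"
proof -
  have "((\<lambda>s. \<i> * of_real (\<phi> s)) has_vector_derivative \<i> * of_real \<phi>') (at t)"
    by (intro has_vector_derivative_mult_right has_vector_derivative_of_real \<phi>)
  then have "(exp \<circ> (\<lambda>s. \<i> * of_real (\<phi> s)) has_vector_derivative (\<i> * of_real \<phi>') * exp (\<i> * of_real (\<phi> t))) (at t)"
    by (intro field_vector_diff_chain_at DERIV_exp)
  then have "((\<lambda>s. cis (\<phi> s)) has_vector_derivative (\<i> * of_real \<phi>') * cis (\<phi> t)) (at t)"
    by (simp add: o_def cis_conv_exp)
  then have "((\<lambda>s. of_real (R s) * cis (\<phi> s)) has_vector_derivative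
      of_real (R t) * ((\<i> * of_real \<phi>') * cis (\<phi> t)) + of_real R' * cis (\<phi> t)) (at t)"
    by (intro has_vector_derivative_mult has_vector_derivative_of_real R)
  then show ?thesis by (simp add: algebra_simps)
qed

text \<open>Here y is meant as the image of the base point under \<open>mob (V i)\<close>, so m =
  tanh (r/2), the quotient 2m / (1 - m^2) is sinh r and (1 + m^2) / (1 - m^2) is cosh r. The unit
  number e is the direction u relative to the outward radial one. The result is the overview's
  formula for w', divided by sinh r.\<close>

lemma has_vector_derivative_vertex_coord:
  fixes y u a :: complex and k d :: real
  defines "m \<equiv> cmod y" and "e \<equiv> of_real (cmod y) * u / y"
  defines "W0 \<equiv> of_real (2 * m / (1 - m\<^sup>2)) * cis (k * (Arg (y / a) - d))"
  assumes y: "y \<noteq> 0" "cmod y < 1" and u: "cmod u = 1" and a: "a \<noteq> 0" "y / a \<notin> \<real>\<^sub>\<le>\<^sub>0"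
  shows "((\<lambda>s. of_real (2 * cmod (pgeod y u s) / (1 - (cmod (pgeod y u s))\<^sup>2))
        * cis (k * (Arg (pgeod y u s / a) - d))) has_vector_derivative
      of_real ((1 - m\<^sup>2) / (2 * m)) *
        (W0 * (of_real ((1 + m\<^sup>2) / (1 - m\<^sup>2) * Re e) + \<i> * of_real (k * Im e)))) (at 0)"
proof -
  have m: "0 < m" "m < 1" "m\<^sup>2 < 1" using y by (auto simp: m_def abs_square_less_1)
  define Y where "Y = pgeod y u"
  have Y0: "Y 0 = y" by (simp add: Y_def)
  define Y' where "Y' = pgeod_deriv y u 0"
  have Y'_eq: "Y' = of_real ((1 - m\<^sup>2) / 2) * u" by (simp add: Y'_def pgeod_deriv_0 m_def)
  have dY: "(Y has_vector_derivative Y') (at 0)"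
    unfolding Y_def Y'_def by (rule pgeod_has_vector_derivative[OF y(2) u])
  \<comment> \<open>The logarithmic derivative of the position: its real part drives the modulus,
    its imaginary part the angle.\<close>
  define L where "L = of_real ((1 - m\<^sup>2) / (2 * m)) * e"
  have Y'L: "Y' / y = L" using m y by (simp add: Y'_eq L_def e_def flip: m_def)
  have "((\<lambda>s. Y s / a) has_vector_derivative Y' / a) (at 0)"
    using dY by (rule has_vector_derivative_divide)
  then have "((\<lambda>s. Arg (Y s / a)) has_real_derivative Im ((Y' / a) / (Y 0 / a))) (at 0)"
    by (rule has_real_derivative_Arg) (use a Y0 in simp)
  moreover have "(Y' / a) / (Y 0 / a) = L" using a Y'L by (simp add: Y0)
  ultimately have dA: "((\<lambda>s. Arg (Y s / a)) has_real_derivative Im L) (at 0)" by simp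
  have dN: "((\<lambda>s. cmod (Y s)) has_real_derivative m * Re L) (at 0)"
  proof -
    have "(norm has_derivative (\<lambda>h. h \<bullet> sgn (Y 0))) (at (Y 0))"
      using y by (intro has_derivative_norm) (simp add: Y0)
    then have "((norm \<circ> Y) has_derivative ((\<lambda>h. h \<bullet> sgn (Y 0)) \<circ> (\<lambda>h. h *\<^sub>R Y'))) (at 0)"
      using dY unfolding has_vector_derivative_def by (intro diff_chain_at)
    then have "((norm \<circ> Y) has_derivative (\<lambda>h. h * (Y' \<bullet> sgn y))) (at 0)"
      by (simp add: o_def Y0)
    then have "((norm \<circ> Y) has_real_derivative (Y' \<bullet> sgn y)) (at 0)"
      by (simp add: has_field_derivative_def mult.commute[of _ "Y' \<bullet> sgn y"] o_def)
    moreover have "Y' \<bullet> sgn y = m * Re L"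
    proof -
      have "Y' = L * y" using Y'L y by (simp add: field_simps)
      then have "Y' \<bullet> y = Re L * m\<^sup>2"
        by (simp add: inner_complex_def m_def cmod_power2) (simp add: power2_eq_square algebra_simps)
      then show ?thesis using m by (simp add: sgn_div_norm power2_eq_square flip: m_def)
    qed
    ultimately show ?thesis by (simp add: o_def)
  qed
  have "((\<lambda>s. 2 * cmod (Y s) / (1 - (cmod (Y s))\<^sup>2)) has_real_derivative
      (2 * (m * Re L) * (1 - m\<^sup>2) - 2 * m * (- (2 * m * (m * Re L)))) / ((1 - m\<^sup>2) * (1 - m\<^sup>2))) (at 0)"
    using m by (auto intro!: derivative_eq_intros dN simp: Y0 m_def[symmetric])
  moreover have "(2 * (m * Re L) * (1 - m\<^sup>2) - 2 * m * (- (2 * m * (m * Re L)))) / ((1 - m\<^sup>2) * (1 - m\<^sup>2))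
      = (1 + m\<^sup>2) / (1 - m\<^sup>2) * Re e"
  proof -
    have "2 * (m * Re L) = (1 - m\<^sup>2) * Re e" using m by (simp add: L_def)
    then have "2 * (m * Re L) * (1 - m\<^sup>2) - 2 * m * (- (2 * m * (m * Re L)))
        = ((1 - m\<^sup>2) * Re e) * (1 - m\<^sup>2) + 2 * m * m * ((1 - m\<^sup>2) * Re e)" by algebra
    also have "\<dots> = (1 - m\<^sup>2) * ((1 + m\<^sup>2) * Re e)" by (simp add: power2_eq_square algebra_simps)
    finally show ?thesis using m by simp
  qed
  ultimately have dR: "((\<lambda>s. 2 * cmod (Y s) / (1 - (cmod (Y s))\<^sup>2)) has_real_derivative
      (1 + m\<^sup>2) / (1 - m\<^sup>2) * Re e) (at 0)" by simp
  have d\<phi>: "((\<lambda>s. k * (Arg (Y s / a) - d)) has_real_derivative k * Im L) (at 0)"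
    by (auto intro!: derivative_eq_intros dA)
  have val: "(of_real ((1 + m\<^sup>2) / (1 - m\<^sup>2) * Re e) + \<i> * of_real (2 * m / (1 - m\<^sup>2) * (k * Im L)))
      * cis (k * (Arg (y / a) - d))
    = of_real ((1 - m\<^sup>2) / (2 * m)) *
        (W0 * (of_real ((1 + m\<^sup>2) / (1 - m\<^sup>2) * Re e) + \<i> * of_real (k * Im e)))"
  proof -
    have h1: "2 * m / (1 - m\<^sup>2) * (k * Im L) = k * Im e" using m by (simp add: L_def)
    have h2: "of_real ((1 - m\<^sup>2) / (2 * m)) * W0 = cis (k * (Arg (y / a) - d))"
      using m unfolding W0_def mult.assoc[symmetric] of_real_mult[symmetric] by simp
    show ?thesis unfolding h1 h2[symmetric] by (simp only: mult_ac)
  qed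
  show ?thesis
    using has_vector_derivative_polar[OF dR d\<phi>] unfolding Y0 m_def[symmetric] val by (simp only: Y_def)
qed

text \<open>Up to a positive factor, the velocity of \<open>pgeod y u\<close> divided by its
  position. Seen from the origin the outward direction is the position itself, so the argument is
  the angle with the radial direction. Dropping the factor leaves a rational function of tanh
  (s/2).\<close>

definition turn :: "complex \<Rightarrow> complex \<Rightarrow> real \<Rightarrow> complex" where
  "turn y u s = u / ((1 + cnj y * (of_real (tanh (s / 2)) * u)) * (y + of_real (tanh (s / 2)) * u))"

lemma turn_0: "turn y u 0 = u / y"
  by (simp add: turn_def)

text \<open>The equation b' = - coth r sin b, with (1 + m^2) / (2m) = coth r. It is the imaginary
  part of the logarithmic derivative of \<open>turn\<close>, which is -(1 + m^2) / (2m) times e at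
  0.\<close>

lemma has_real_derivative_turn:
  fixes y u :: complex
  defines "m \<equiv> cmod y" and "e \<equiv> of_real (cmod y) * u / y"
  assumes y: "y \<noteq> 0" and u: "u \<noteq> 0" and nz: "orient ori (u / y) * cis (- b) \<notin> \<real>\<^sub>\<le>\<^sub>0"
  shows "((\<lambda>s. b + Arg (orient ori (turn y u s) * cis (- b))) has_real_derivative
    - ((1 + m\<^sup>2) / (2 * m) * (orsign ori * Im e))) (at 0)"
proof -
  define D where "D = - (of_real ((1 + m\<^sup>2) / 2) * (u / y)\<^sup>2)"
  have m: "m > 0" using y by (simp add: m_def)
  have T: "((\<lambda>s. tanh (s / 2)) has_real_derivative 1 / 2) (at 0)"
    using has_real_derivative_tanh_half[of 0 UNIV] by simp
  have Tu: "((\<lambda>s. of_real (tanh (s / 2)) * u) has_vector_derivative of_real (1 / 2) * u) (at 0)"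
    by (intro has_vector_derivative_mult_left has_vector_derivative_of_real T)
  define f where "f x = u / ((1 + cnj y * x) * (y + x))" for x
  have "(f has_field_derivative - (u * (cnj y * y + 1)) / (y * y)) (at 0)"
    unfolding f_def using y by (auto intro!: derivative_eq_intros)
  then have "(f has_field_derivative - (u * (cnj y * y + 1)) / (y * y)) (at (of_real (tanh (0 / 2)) * u))" by simp
  with Tu have "(f \<circ> (\<lambda>s. of_real (tanh (s / 2)) * u) has_vector_derivative
      of_real (1 / 2) * u * (- (u * (cnj y * y + 1)) / (y * y))) (at 0)"
    by (rule field_vector_diff_chain_at)
  moreover have "of_real (1 / 2) * u * (- (u * (cnj y * y + 1)) / (y * y)) = D"
  proof -
    have "cnj y * y = of_real (m\<^sup>2)" unfolding m_def by (simp only: complex_norm_square mult.commute)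
    then show ?thesis using y by (simp add: D_def power2_eq_square field_simps)
  qed
  moreover have "f \<circ> (\<lambda>s. of_real (tanh (s / 2)) * u) = turn y u"
    by (simp add: f_def turn_def fun_eq_iff)
  ultimately have "(turn y u has_vector_derivative D) (at 0)" by simp
  then have "((\<lambda>s. orient ori (turn y u s)) has_vector_derivative orient ori D) (at 0)"
    by (rule bounded_linear.has_vector_derivative[OF bounded_linear_orient])
  then have "((\<lambda>s. orient ori (turn y u s) * cis (- b)) has_vector_derivative orient ori D * cis (- b)) (at 0)"
    by (rule has_vector_derivative_mult_left)
  then have "((\<lambda>s. Arg (orient ori (turn y u s) * cis (- b))) has_real_derivative
      Im ((orient ori D * cis (- b)) / (orient ori (turn y u 0) * cis (- b)))) (at 0)"
    by (rule has_real_derivative_Arg) (use nz in \<open>simp add: turn_0\<close>)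
  moreover have "(orient ori D * cis (- b)) / (orient ori (turn y u 0) * cis (- b)) = orient ori (D / (u / y))"
    by (simp add: turn_0 orient_simps)
  moreover have "D / (u / y) = of_real (- ((1 + m\<^sup>2) / (2 * m))) * e"
    using y u m by (simp add: D_def e_def power2_eq_square field_simps flip: m_def)
  then have "Im (orient ori (D / (u / y))) = - ((1 + m\<^sup>2) / (2 * m) * (orsign ori * Im e))"
    by (simp add: orient_simps)
  ultimately have "((\<lambda>s. Arg (orient ori (turn y u s) * cis (- b))) has_real_derivative
    - ((1 + m\<^sup>2) / (2 * m) * (orsign ori * Im e))) (at 0)" by simp
  then show ?thesis by (auto intro!: derivative_eq_intros)
qed

context nondegenerate_triangle
begin

lemma mob_vertex_nz: "z \<in> open_triangle \<Longrightarrow> mob (V i) z \<noteq> 0"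
  using mob_eq_0_iff[OF vertex_disc open_triangleD(1)] vertex_not_open by blast

lemma adjacent_vertex_nz: "mob (V i) (V (i + 1)) \<noteq> 0" "mob (V i) (V (i + 2)) \<noteq> 0"
  using mob_eq_0_iff[OF vertex_disc vertex_disc, of i] vertices_distinct[of "i + 1"] vertices_distinct[of "i + 2"]
  by (auto simp: add_3)

text \<open>The angle is computed after applying \<open>mob (V i)\<close>: its complex derivative k
  multiplies both velocities and cancels in their quotient, and positive factors disappear under
  \<open>sgn\<close>.\<close>

lemma oriented_angle_outward:
  assumes z: "z \<in> open_triangle" and u: "cmod u = 1" and s: "pgeod z u s \<in> open_triangle"
  shows "oriented_angle V ori (proj V True (pgeod z u s)) (outward V i (proj V True (pgeod z u s)))
      (tvec (pgeod_deriv z u s)) = sgn (orient ori (turn (mob (V i) z) (mob_rot (V i) z * u) s))"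
proof -
  define A where "A = V i"
  define x where "x = pgeod z u s"
  define y where "y = mob A z"
  define v where "v = mob_rot A z * u"
  define Y where "Y = mob A x"
  define w where "w = sgn Y"
  define r where "r = hdist A x"
  have d: "cmod A < 1" "cmod z < 1" "cmod x < 1"
    using vertex_disc open_triangleD(1)[OF z] open_triangleD(1)[OF s] by (auto simp: A_def x_def)
  have yd: "cmod y < 1" unfolding y_def by (rule mob_lt_1[OF d(1,2)])
  have v: "cmod v = 1" unfolding v_def norm_mult mob_rot_def rotation_unit[OF d(1,2)] u by simp
  have Y0: "Y \<noteq> 0" using mob_vertex_nz[OF s] by (simp add: Y_def A_def x_def)
  then have w: "cmod w = 1" by (simp add: w_def norm_sgn)
  define k where "k = (1 - (cmod A)\<^sup>2) / (1 - cnj A * x)\<^sup>2"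
  have dk: "(mob A has_field_derivative k) (at x)"
    unfolding k_def by (rule mob_has_field_derivative[OF d(1,3)])
  have e1: "pgeod_deriv y v s = pgeod_deriv z u s * k"
  proof -
    have "(mob A \<circ> pgeod z u has_vector_derivative pgeod_deriv z u s * k) (at s)"
      using dk unfolding x_def by (rule field_vector_diff_chain_at[OF pgeod_has_vector_derivative[OF d(2) u]])
    moreover have "mob A \<circ> pgeod z u = pgeod y v"
      using mob_pgeod[OF d(1,2) u] by (auto simp: y_def v_def)
    ultimately show ?thesis
      using pgeod_has_vector_derivative[OF yd v] vector_derivative_unique_at by metis
  qed
  have e2: "of_real ((1 - (tanh (r / 2))\<^sup>2) / 2) * w = pgeod_deriv A w r * k"
  proof -
    have px: "pgeod A w r = x" unfolding w_def Y_def r_def by (rule pgeod_hdist[OF d(1,3)])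
    have "(mob A \<circ> pgeod A w has_vector_derivative pgeod_deriv A w r * k) (at r)"
      using dk unfolding px[symmetric] by (rule field_vector_diff_chain_at[OF pgeod_has_vector_derivative[OF d(1) w]])
    moreover have "mob A \<circ> pgeod A w = (\<lambda>t. of_real (tanh (t / 2)) * w)"
      using mob_mob_minus[OF d(1) tanh_unit_lt_1[OF w]] by (auto simp: pgeod_def)
    moreover have "((\<lambda>t. of_real (tanh (t / 2)) * w) has_vector_derivative of_real ((1 - (tanh (r / 2))\<^sup>2) / 2) * w) (at r)"
      by (intro has_vector_derivative_mult_left has_vector_derivative_of_real has_real_derivative_tanh_half)
    ultimately show ?thesis using vector_derivative_unique_at by metis
  qed
  have T: "0 < (1 - (tanh (r / 2))\<^sup>2) / 2"
    using tanh_real_bounds[of "r / 2"] by (auto simp: abs_square_less_1)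
  have "cmod (of_real ((1 - (tanh (r / 2))\<^sup>2) / 2) * w) > 0"
    unfolding norm_mult norm_of_real w using T by simp
  then have k0: "k \<noteq> 0" unfolding e2 by auto
  define T0 where "T0 = tanh (s / 2)"
  define c1 where "c1 = (1 - T0\<^sup>2) / 2 * (1 - (cmod y)\<^sup>2)"
  have c1: "c1 > 0" unfolding c1_def T0_def
    using tanh_real_bounds[of "s / 2"] yd by (intro mult_pos_pos) (auto simp: abs_square_less_1)
  define g where "g = 1 + cnj y * (of_real T0 * v)"
  have g: "g \<noteq> 0" unfolding g_def T0_def by (rule mob_denom_nz'[OF yd tanh_unit_lt_1[OF v]])
  have pd: "pgeod_deriv y v s = of_real c1 * v / g\<^sup>2"
    by (simp add: pgeod_deriv_def c1_def g_def T0_def mult_ac)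
  have Yg: "Y = (y + of_real T0 * v) / g"
    using mob_pgeod[OF d(1,2) u, of s]
    by (simp add: Y_def x_def y_def v_def pgeod_def[of "mob A z"] mob_minus_eq g_def T0_def add.commute)
  have num: "y + of_real T0 * v \<noteq> 0" using Y0 Yg by auto
  define c2 where "c2 = (1 - (tanh (r / 2))\<^sup>2) / 2"
  have wY: "w = Y / of_real (cmod Y)" by (simp add: w_def sgn_eq)
  have tn: "turn y v s = v / (g * (y + of_real T0 * v))" by (simp add: turn_def g_def T0_def)
  have "pgeod_deriv z u s / pgeod_deriv A w r = pgeod_deriv y v s / (of_real c2 * w)"
    unfolding e1 c2_def e2 using k0 by simp
  also have "\<dots> = of_real (c1 * cmod Y / c2) * turn y v s"
    unfolding pd wY tn Yg using g num by (simp add: power2_eq_square mult_ac)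
  finally have ratio: "pgeod_deriv z u s / pgeod_deriv A w r = of_real (c1 * cmod Y / c2) * turn y v s" .
  have pos: "c1 * cmod Y / c2 > 0" using c1 T Y0 by (simp add: c2_def)
  have "oriented_angle V ori (proj V True x) (outward V i (proj V True x)) (tvec (pgeod_deriv z u s))
      = orient ori (sgn (pgeod_deriv z u s / pgeod_deriv A w r))"
    using s unfolding x_def[symmetric]
    by (simp add: outward_open_triangle oriented_angle_tvec A_def Y_def w_def r_def)
  also have "\<dots> = sgn (orient ori (turn y v s))"
    unfolding ratio sgn_pos_mult[OF pos] orient_simps ..
  finally show ?thesis by (simp add: x_def y_def v_def A_def)
qed

lemma vertex_coord_open_triangle:
  assumes z: "z \<in> open_triangle"
  shows "vertex_coord V l ori i (proj V True z) =
    of_real (2 * cmod (mob (V i) z) / (1 - (cmod (mob (V i) z))\<^sup>2)) *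
      cis (orsign ori * pi / angle_at V i * (Arg (mob (V i) z / mob (V i) (V (i + 1))) - direction V i (l i)))"
proof -
  have "proj V True z \<noteq> vertex V i"
    using open_triangle_reg[OF z] by (auto simp: surface_reg_def)
  moreover have "direction V i (proj V True z) = Arg (mob (V i) z / mob (V i) (V (i + 1)))"
    using open_triangle_chart[OF z] by (simp add: direction_def)
  ultimately show ?thesis
    using sinh_hdist[OF vertex_disc open_triangleD(1)[OF z], of i]
    by (simp add: vertex_coord_def sdist_open_triangle[OF z] polar_angle_def orsign_def mult_ac)
qed

text \<open>Keeps the quotient off the branch cut, so that \<open>Arg\<close> can be differentiated.
  It would be real only on the geodesic line through \<open>V i\<close> and
  \<open>V (i + 1)\<close>, where coordinate i + 2 vanishes.\<close>

lemma open_triangle_arg: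
  assumes z: "z \<in> open_triangle"
  shows "mob (V i) z / mob (V i) (V (i + 1)) \<notin> \<real>\<^sub>\<le>\<^sub>0"
proof
  define a where "a = mob (V i) (V (i + 1))"
  assume "mob (V i) z / mob (V i) (V (i + 1)) \<in> \<real>\<^sub>\<le>\<^sub>0"
  then obtain t where t: "mob (V i) z / a = of_real t"
    unfolding a_def by (metis complex_is_Real_iff complex_nonpos_Reals_iff Reals_cases)
  then have "mob (V i) z = of_real t * a"
    using adjacent_vertex_nz(1)[of i] by (simp add: a_def field_simps)
  then have "Im (cnj a * mob (V i) z) = 0" by simp
  moreover obtain k where "k > 0" "sg * Im (cnj a * mob (V i) z) = k * bary (i + 2) z"
    using Im_vertex_coords(1)[OF open_triangleD(1)[OF z]] unfolding a_def by blast
  ultimately show False using open_triangleD(2)[OF z, of "i + 2"] by simp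
qed

lemma cis_arg_near:
  assumes "cmod w = 1"
  shows "cis (arg_near b0 w) = w"
proof -
  have "w * cis (- b0) \<noteq> 0" "cmod (w * cis (- b0)) = 1" using assms by (auto simp: norm_mult)
  then have "cis (Arg (w * cis (- b0))) = w * cis (- b0)" by (simp add: cis_Arg sgn_eq)
  then have "cis (arg_near b0 w) = cis b0 * (w * cis (- b0))" by (simp add: arg_near_def cis_mult[symmetric])
  also have "\<dots> = w * (cis b0 * cis (- b0))" by (simp only: mult_ac)
  also have "\<dots> = w" by (simp add: cis_mult)
  finally show ?thesis .
qed

text \<open>The geodesic through the vector is explicit, so its lift has an explicit chart
  expression F, and differentiating F yields the geodesic equations. The statement holds for
  whichever unit vector at this base point has chart value (w, b), which allows its use for a chosen
  preimage.\<close>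

lemma geodesic_field_sing_chart:
  fixes \<tau> b0 b :: real and l :: "3 \<Rightarrow> spoint" and ori :: bool and i :: 3 and z \<eta> w :: complex
  assumes z: "z \<in> open_triangle" and \<eta>: "2 * cmod \<eta> / (1 - (cmod z)\<^sup>2) = 1"
  defines "q \<equiv> Reg (proj V True z) (tvec \<eta>)" and "\<kappa> \<equiv> sing_chart V \<tau> l ori i b0"
  assumes dom: "q \<in> fst \<kappa>" and co: "snd \<kappa> q = (w, b)"
  shows "sinh (hdist (V i) z) *\<^sub>R geodesic_field V (M_atlas V \<tau> l ori) (proj V True z) (tvec \<eta>) \<kappa> =
    sing_field (pi / angle_at V i) w b"
proof -
  define A where "A = V i"
  define a where "a = mob A (V (i + 1))"
  define y where "y = mob A z"
  define m where "m = cmod y"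
  have d: "cmod A < 1" "cmod z < 1" using vertex_disc open_triangleD(1)[OF z] by (auto simp: A_def)
  have y: "y \<noteq> 0" "cmod y < 1" using mob_vertex_nz[OF z] mob_lt_1[OF d] by (auto simp: y_def A_def)
  have m: "0 < m" "m < 1" "m\<^sup>2 < 1" using y by (auto simp: m_def abs_square_less_1)
  have Z: "1 - (cmod z)\<^sup>2 > 0" using d by (simp add: abs_square_less_1)
  define u where "u = \<eta> / of_real ((1 - (cmod z)\<^sup>2) / 2)"
  have u: "cmod u = 1" using \<eta> Z by (simp add: u_def norm_divide)
  have "complex_of_real ((1 - (cmod z)\<^sup>2) / 2) \<noteq> 0" using Z unfolding of_real_eq_0_iff by simp
  then have \<eta>u: "\<eta> = pgeod_deriv z u 0"
    unfolding pgeod_deriv_0 u_def by (simp only: times_divide_eq_right nonzero_mult_div_cancel_left not_False_eq_True)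
  define v where "v = mob_rot A z * u"
  have v: "cmod v = 1" unfolding v_def norm_mult mob_rot_def rotation_unit[OF d] u by simp
  have v0: "v \<noteq> 0" using v by auto
  define e where "e = of_real (cmod y) * v / y"
  define k where "k = orsign ori * pi / angle_at V i"
  define dl where "dl = direction V i (l i)"
  define c where "c = geodesic_of V (proj V True z) (tvec \<eta>)"
  have ev: "\<forall>\<^sub>F s in nhds 0. c s = proj V True (pgeod z u s)"
    unfolding c_def \<eta>u by (rule geodesic_of_open_triangle[OF z u])
  have evO: "\<forall>\<^sub>F s in nhds 0. pgeod z u s \<in> open_triangle"
    by (rule eventually_open_triangle[OF isCont_pgeod[OF d(2) u]]) (simp add: z)
  \<comment> \<open>The lift involves the velocity at all times near 0, hence the equality of curves
    is used as an equality of germs at each such time.\<close>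
  have evv: "\<forall>\<^sub>F s in nhds 0. velocity (surface_atlas V) c s = tvec (pgeod_deriv z u s)"
  proof -
    have "\<forall>\<^sub>F s in nhds 0. \<forall>\<^sub>F r in nhds s. c r = proj V True (pgeod z u r)"
      using ev by (simp add: eventually_eventually)
    then show ?thesis using evO
      by eventually_elim (rule velocity_open_triangle[OF _ _ pgeod_has_vector_derivative[OF d(2) u]])
  qed
  define F where "F s = (of_real (2 * cmod (pgeod y v s) / (1 - (cmod (pgeod y v s))\<^sup>2))
        * cis (k * (Arg (pgeod y v s / a) - dl)), b0 + Arg (orient ori (turn y v s) * cis (- b0)))" for s
  have evF: "\<forall>\<^sub>F s in nhds 0. (snd \<kappa> \<circ> vel_lift V c) s = F s"
    using ev evO evv
  proof eventually_elim
    case (elim s)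
    have t0: "turn y v s \<noteq> 0"
    proof -
      have "pgeod y v s \<noteq> 0"
        using mob_vertex_nz[OF elim(2), of i] mob_pgeod[OF d u, of s] by (simp add: A_def y_def v_def)
      then have "y + of_real (tanh (s / 2)) * v \<noteq> 0" by (auto simp: pgeod_def mob_minus_eq add.commute)
      then show ?thesis using v0 mob_denom_nz'[OF y(2) tanh_unit_lt_1[OF v]] by (simp add: turn_def)
    qed
    define o1 where "o1 = orient ori (turn y v s)"
    have o1: "o1 \<noteq> 0" using t0 by (simp add: o1_def orient_simps)
    have "Phi V l ori i (vel_lift V c s) = (vertex_coord V l ori i (proj V True (pgeod z u s)),
        oriented_angle V ori (proj V True (pgeod z u s)) (outward V i (proj V True (pgeod z u s))) (tvec (pgeod_deriv z u s)))"
      by (simp add: vel_lift_def Phi_def elim)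
    also have "\<dots> = (fst (F s), sgn o1)"
      using mob_pgeod[OF d u, of s]
      by (simp add: vertex_coord_open_triangle[OF elim(2)] oriented_angle_outward[OF z u elim(2)]
          F_def k_def dl_def a_def y_def v_def A_def o1_def)
    finally have P: "Phi V l ori i (vel_lift V c s) = (fst (F s), sgn o1)" .
    have "sgn o1 * cis (- b0) = (o1 * cis (- b0)) / of_real (cmod o1)" by (simp add: sgn_eq)
    then have "Arg (sgn o1 * cis (- b0)) = Arg (o1 * cis (- b0))"
      using o1 Arg_divide_of_real[of "cmod o1" "o1 * cis (- b0)"] by simp
    then show ?case using P by (simp add: \<kappa>_def sing_chart_def arg_near_def F_def o1_def)
  qed
  have q0: "vel_lift V c 0 = q"
    using eventually_nhds_x_imp_x[OF ev] eventually_nhds_x_imp_x[OF evv] by (simp add: vel_lift_def q_def \<eta>u)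
  then have F0: "F 0 = (w, b)" using eventually_nhds_x_imp_x[OF evF] co by simp
  have Phi_q: "snd (Phi V l ori i q) = sgn (orient ori (turn y v 0))"
    using oriented_angle_outward[OF z u, of 0 ori i] z
    by (simp add: q_def Phi_def \<eta>u y_def v_def A_def)
  have e1: "cmod e = 1" using y v by (simp add: e_def norm_divide norm_mult)
  have ang: "sgn (orient ori (turn y v 0)) = orient ori e"
  proof -
    have "orient ori (turn y v 0) = orient ori (of_real (inverse m) * e)"
      using m y by (intro arg_cong[where f = "orient ori"]) (simp add: turn_0 e_def field_simps flip: m_def)
    also have "\<dots> = of_real (inverse m) * orient ori e" by (simp only: orient_simps(1,3))
    finally have "sgn (orient ori (turn y v 0)) = sgn (orient ori e)"
      using m by (simp only: sgn_pos_mult positive_imp_inverse_positive)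
    then show ?thesis using e1 by (simp add: sgn_eq orient_simps(4))
  qed
  have nzq: "orient ori e * cis (- b0) \<notin> \<real>\<^sub>\<le>\<^sub>0"
    using dom Phi_q ang by (simp add: \<kappa>_def sing_chart_def)
  have nz: "orient ori (v / y) * cis (- b0) \<notin> \<real>\<^sub>\<le>\<^sub>0"
  proof
    assume *: "orient ori (v / y) * cis (- b0) \<in> \<real>\<^sub>\<le>\<^sub>0"
    have "of_real m \<in> \<real>\<^sub>\<ge>\<^sub>0" using m by simp
    then have "of_real m * (orient ori (v / y) * cis (- b0)) \<in> \<real>\<^sub>\<le>\<^sub>0"
      using * by (simp add: complex_nonpos_Reals_iff mult_nonneg_nonpos)
    moreover have "of_real m * (orient ori (v / y) * cis (- b0)) = orient ori e * cis (- b0)"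
      by (simp add: e_def orient_simps m_def)
    ultimately show False using nzq by simp
  qed
  have b: "cis b = orient ori e"
  proof -
    have "b = arg_near b0 (orient ori e)"
      using co Phi_q ang by (simp add: \<kappa>_def sing_chart_def)
    then show ?thesis using cis_arg_near[of "orient ori e" b0] e1 by (simp add: orient_simps)
  qed
  have cosb: "Re e = cos b" and sinb: "orsign ori * Im e = sin b"
    using arg_cong[OF b, of Re] arg_cong[OF b, of Im] by (simp_all add: orient_simps)
  define sr where "sr = 2 * m / (1 - m\<^sup>2)"
  have sr: "sr > 0" "sinh (hdist (V i) z) = sr"
    using m sinh_hdist[OF d] by (simp_all add: sr_def m_def y_def A_def)
  have w: "w = of_real sr * cis (k * (Arg (y / a) - dl))"
    using F0 by (simp add: F_def sr_def m_def)
  have nw: "cmod w = sr" using sr(1) by (simp add: w norm_mult)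
  \<comment> \<open>As \<open>sr\<close> is sinh r, so \<open>cr\<close> is cosh r; cosh^2 = 1 +
    sinh^2 turns it into the square root of \<open>sing_field\<close>.\<close>
  define cr where "cr = (1 + m\<^sup>2) / (1 - m\<^sup>2)"
  have "1 + sr\<^sup>2 = cr\<^sup>2"
  proof -
    have "1 + sr\<^sup>2 = ((1 - m\<^sup>2)\<^sup>2 + (2 * m)\<^sup>2) / (1 - m\<^sup>2)\<^sup>2"
      using m by (simp add: sr_def power_divide add_divide_distrib)
    also have "(1 - m\<^sup>2)\<^sup>2 + (2 * m)\<^sup>2 = (1 + m\<^sup>2)\<^sup>2" by (simp add: power2_eq_square algebra_simps)
    finally show ?thesis by (simp add: cr_def power_divide)
  qed
  then have cr: "sqrt (1 + (cmod w)\<^sup>2) = cr" using m by (simp add: nw cr_def)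
  define D1 where "D1 = of_real ((1 - m\<^sup>2) / (2 * m)) * (w * (of_real (cr * Re e) + \<i> * of_real (k * Im e)))"
  define D2 where "D2 = - ((1 + m\<^sup>2) / (2 * m) * (orsign ori * Im e))"
  have ya: "y / a \<notin> \<real>\<^sub>\<le>\<^sub>0" using open_triangle_arg[OF z] by (simp add: y_def a_def A_def)
  have a0: "a \<noteq> 0" using adjacent_vertex_nz by (simp add: a_def A_def)
  have "((\<lambda>s. fst (F s)) has_vector_derivative D1) (at 0)"
    using has_vector_derivative_vertex_coord[OF y v a0 ya, of k dl]
    unfolding F_def fst_conv D1_def w sr_def cr_def e_def m_def .
  moreover have "((\<lambda>s. snd (F s)) has_vector_derivative D2) (at 0)"
    using has_real_derivative_turn[OF y(1) v0 nz]
    unfolding F_def snd_conv D2_def e_def m_def has_real_derivative_iff_has_vector_derivative .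
  ultimately have "((\<lambda>s. (fst (F s), snd (F s))) has_vector_derivative (D1, D2)) (at 0)"
    by (rule has_vector_derivative_Pair)
  then have "(F has_vector_derivative (D1, D2)) (at 0)" by simp
  then have "((snd \<kappa> \<circ> vel_lift V c) has_vector_derivative (D1, D2)) (at 0)"
    by (rule has_vector_derivative_eventually) (use evF in \<open>simp add: eq_commute\<close>)
  then have "vector_derivative (snd \<kappa> \<circ> vel_lift V c) (at 0) = (D1, D2)" by (rule vector_derivative_at)
  moreover have "\<kappa> \<in> M_atlas V \<tau> l ori" by (auto simp: \<kappa>_def M_atlas_def)
  ultimately have gf: "geodesic_field V (M_atlas V \<tau> l ori) (proj V True z) (tvec \<eta>) \<kappa> = (D1, D2)"
    using dom q0 by (simp add: geodesic_field_def velocity_def c_def)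
  have "of_real sr * D1 = w * (of_real (cr * cos b) + \<i> * of_real (pi / angle_at V i * sin b))"
  proof -
    \<comment> \<open>The orientation sign occurs in the polar angle and in the angle b, and the two
      cancel; the field has the same form for both orientations.\<close>
    have "k * Im e = pi / angle_at V i * sin b" unfolding sinb[symmetric] k_def by simp
    moreover have "of_real sr * D1 = w * (of_real (cr * Re e) + \<i> * of_real (k * Im e))"
      using m unfolding D1_def sr_def mult.assoc[symmetric] of_real_mult[symmetric] by simp
    ultimately show ?thesis by (simp add: cosb)
  qed
  moreover have "sr * D2 = - (cr * sin b)"
    using m unfolding D2_def sinb sr_def cr_def by (simp add: field_simps)
  ultimately show ?thesis
    unfolding sing_field_def cr gf sr(2) by (simp add: scaleR_conv_of_real)
qed

end

section \<open>The singular fibers\<close>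

lemma Im_divide_cnj: "Im (x / a) = Im (cnj a * x) / (cmod a)\<^sup>2" for x a :: complex
  by (simp add: Im_divide cmod_power2 algebra_simps)

lemma Arg_lt_pi_iff: "z \<notin> \<real>\<^sub>\<le>\<^sub>0 \<Longrightarrow> \<bar>Arg z\<bar> < pi"
  using mpi_less_Arg[of z] Arg_le_pi[of z] Arg_eq_pi[of z]
  by (auto simp: complex_nonpos_Reals_iff abs_less_iff less_le)

lemma cis_nonpos: "\<bar>x\<bar> < pi \<Longrightarrow> cis x \<notin> \<real>\<^sub>\<le>\<^sub>0"
proof
  assume x: "\<bar>x\<bar> < pi" and "cis x \<in> \<real>\<^sub>\<le>\<^sub>0"
  then have "Arg (cis x) = pi"
    unfolding Arg_eq_pi complex_nonpos_Reals_iff using cis_neq_zero[of x] complex_eq_iff[of "cis x" 0] by auto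
  moreover have "Arg (cis x) = x" using x by (intro Arg_cis) auto
  ultimately show False using x by simp
qed

text \<open>An eigenvalue of an involution satisfies \<mu>^2 = 1. In real form, a purely imaginary
  one would give (1 + (Im \<mu>)^2) u = 0, and then v = 0 as well.\<close>

lemma no_imaginary_eigenvalue:
  fixes L :: "'a::real_vector \<Rightarrow> 'a"
  assumes "linear L" "\<And>x. L (L x) = x" "complex_eigenvalue L \<mu>"
  shows "Re \<mu> \<noteq> 0"
proof
  assume 0: "Re \<mu> = 0"
  obtain u v where uv: "(u, v) \<noteq> (0, 0)" "L u = - (Im \<mu> *\<^sub>R v)" "L v = Im \<mu> *\<^sub>R u"
    using assms(3) 0 unfolding complex_eigenvalue_def by auto
  have "u = L (L u)" by (simp add: assms(2))
  also have "\<dots> = - (Im \<mu> *\<^sub>R Im \<mu> *\<^sub>R u)"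
    using assms(1) by (simp add: uv linear_scale linear_neg)
  finally have "(1 + (Im \<mu>)\<^sup>2) *\<^sub>R u = 0"
    by (simp add: scaleR_add_left power2_eq_square eq_neg_iff_add_eq_0)
  then have u: "u = 0" by (simp add: add_nonneg_eq_0_iff)
  have "v = L (L v)" by (simp add: assms(2))
  also have "\<dots> = 0" using assms(1) by (simp add: uv(3) u linear_0)
  finally show False using uv(1) u by simp
qed

context nondegenerate_triangle
begin

lemma sg_sin: "sg * sin (sg * x) = sin x" and sg_sg: "sg * (sg * y) = y"
  using sg_cases by auto

lemma vertex_angle:
  defines "\<eta> i \<equiv> mob (V i) (V (i + 2)) / mob (V i) (V (i + 1))"
  shows "sg * Im (\<eta> i) > 0" "angle_at V i = sg * Arg (\<eta> i)" "0 < angle_at V i" "angle_at V i < pi"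
proof -
  define a where "a = mob (V i) (V (i + 1))"
  define b where "b = mob (V i) (V (i + 2))"
  have a: "a \<noteq> 0" using adjacent_vertex_nz by (simp add: a_def)
  obtain k where k: "k > 0" "sg * Im (cnj a * b) = k * bary (i + 2) (V (i + 2))"
    using Im_vertex_coords(1)[OF vertex_disc[of "i + 2"], of i] unfolding a_def b_def by blast
  then have "sg * Im (cnj a * b) > 0" using bary_vertex(1)[of "i + 2"] by simp
  moreover have "sg * Im (\<eta> i) = sg * Im (cnj a * b) / (cmod a)\<^sup>2"
    by (simp add: \<eta>_def Im_divide_cnj a_def b_def)
  ultimately show im: "sg * Im (\<eta> i) > 0" using a by simp
  have "sg * Arg (\<eta> i) > 0 \<and> \<bar>Arg (\<eta> i)\<bar> < pi"
    using sg_cases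
  proof
    assume s: "sg = 1"
    then have "Im (\<eta> i) > 0" using im by simp
    then show ?thesis using Arg_lt_pi[of "\<eta> i"] s by auto
  next
    assume s: "sg = -1"
    then have "Im (\<eta> i) < 0" using im by simp
    then show ?thesis using Arg_neg_iff[of "\<eta> i"] mpi_less_Arg[of "\<eta> i"] s by auto
  qed
  then have 1: "sg * Arg (\<eta> i) > 0" and 2: "\<bar>Arg (\<eta> i)\<bar> < pi" by auto
  show 3: "angle_at V i = sg * Arg (\<eta> i)"
    using 1 sg_cases by (auto simp: angle_at_def \<eta>_def)
  show "0 < angle_at V i" using 1 3 by simp
  show "angle_at V i < pi" using 2 by (simp add: angle_at_def \<eta>_def)
qed

text \<open>\<open>Arg_sector\<close> for the directions to z and to \<open>V (i + 2)\<close>, both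
  measured from \<open>V (i + 1)\<close>. It confines \<open>direction\<close> to
  [-\<theta>, \<theta>], one period of the cone angle.\<close>

lemma direction_range:
  assumes z: "z \<in> triangle V" and zi: "z \<noteq> V i"
  shows "0 \<le> sg * Arg (mob (V i) z / mob (V i) (V (i + 1)))"
    "sg * Arg (mob (V i) z / mob (V i) (V (i + 1))) \<le> angle_at V i"
proof -
  define a where "a = mob (V i) (V (i + 1))"
  define b where "b = mob (V i) (V (i + 2))"
  define y where "y = mob (V i) z"
  have zd: "cmod z < 1" using triangle_bary(1)[OF z] .
  have a: "a \<noteq> 0" using adjacent_vertex_nz by (simp add: a_def)
  have y: "y \<noteq> 0" using mob_eq_0_iff[OF vertex_disc zd] zi by (simp add: y_def)
  obtain k where k: "k > 0" "sg * Im (cnj a * y) = k * bary (i + 2) z"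
    using Im_vertex_coords(1)[OF zd, of i] unfolding a_def y_def by blast
  obtain k' where k': "k' > 0" "sg * Im (cnj y * b) = k' * bary (i + 1) z"
    using Im_vertex_coords(2)[OF zd, of i] unfolding b_def y_def by blast
  have 1: "sg * Im (y / a) \<ge> 0"
    using k triangle_bary(2)[OF z, of "i + 2"] by (simp add: Im_divide_cnj)
  have "cnj (y / a) * (b / a) = cnj y * b / of_real ((cmod a)\<^sup>2)"
    unfolding complex_norm_square by (simp add: mult_ac)
  then have "sg * Im (cnj (y / a) * (b / a)) = sg * Im (cnj y * b) / (cmod a)\<^sup>2"
    by (simp only: Im_divide_of_real times_divide_eq_right)
  then have 2: "sg * Im (cnj (y / a) * (b / a)) \<ge> 0"
    using k' triangle_bary(2)[OF z, of "i + 1"] by simp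
  have ya: "y / a \<noteq> 0" using y a by simp
  have ba: "sg * Im (b / a) > 0" "angle_at V i = sg * Arg (b / a)"
    using vertex_angle[of i] by (simp_all add: a_def b_def)
  from Arg_sector[OF sg_cases ba(1) ya 1 2]
  show "0 \<le> sg * Arg (mob (V i) z / mob (V i) (V (i + 1)))"
    "sg * Arg (mob (V i) z / mob (V i) (V (i + 1))) \<le> angle_at V i"
    unfolding ba(2) by (simp_all add: a_def y_def)
qed

text \<open>The parameter t is the Euclidean radius tanh (r/2) in the coordinate
  \<open>mob (V i)\<close>, not arc length, which makes the modulus of the chart value rational in
  t. The sign \<open>sg\<close> turns the angle \<phi> into the triangle.\<close>

definition ray :: "3 \<Rightarrow> real \<Rightarrow> real \<Rightarrow> complex" where
  "ray i \<phi> t = mob (- V i) (of_real t * (sgn (mob (V i) (V (i + 1))) * cis (sg * \<phi>)))"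

lemma ray_facts:
  assumes t: "0 < t" "t < 1"
  shows "mob (V i) (ray i \<phi> t) = of_real t * (sgn (mob (V i) (V (i + 1))) * cis (sg * \<phi>))"
    "cmod (mob (V i) (ray i \<phi> t)) = t" "cmod (ray i \<phi> t) < 1"
    "0 < \<phi> \<Longrightarrow> \<phi> < pi \<Longrightarrow> Arg (mob (V i) (ray i \<phi> t) / mob (V i) (V (i + 1))) = sg * \<phi>"
proof -
  define a where "a = mob (V i) (V (i + 1))"
  have a: "a \<noteq> 0" using adjacent_vertex_nz by (simp add: a_def)
  have n: "cmod (of_real t * (sgn a * cis (sg * \<phi>))) = t" using t a by (simp add: norm_mult norm_sgn)
  have d: "cmod (- V i) < 1" using vertex_disc by simp
  show m: "mob (V i) (ray i \<phi> t) = of_real t * (sgn (mob (V i) (V (i + 1))) * cis (sg * \<phi>))"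
    unfolding ray_def using n t by (intro mob_mob_minus vertex_disc) (simp add: a_def)
  show "cmod (mob (V i) (ray i \<phi> t)) = t" unfolding m using n by (simp add: a_def)
  show "cmod (ray i \<phi> t) < 1" unfolding ray_def using n t by (intro mob_lt_1 d) (simp add: a_def)
  assume \<phi>: "0 < \<phi>" "\<phi> < pi"
  have "mob (V i) (ray i \<phi> t) / a = rcis (t / cmod a) (sg * \<phi>)"
    using a unfolding m by (simp add: a_def[symmetric] rcis_def sgn_eq)
  moreover have "sg * \<phi> \<in> {-pi<..pi}" using sg_cases \<phi> by auto
  ultimately show "Arg (mob (V i) (ray i \<phi> t) / mob (V i) (V (i + 1))) = sg * \<phi>"
    using t a by (simp add: Arg_rcis flip: a_def)
qed

text \<open>A direction strictly between the two sides at the vertex keeps the coordinates i + 1 and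
  i + 2 positive; coordinate i is positive at the vertex and stays so nearby by continuity.\<close>

lemma ray_open_triangle:
  assumes \<phi>: "0 < \<phi>" "\<phi> < angle_at V i"
  shows "\<forall>\<^sub>F t in at_right 0. ray i \<phi> t \<in> open_triangle"
proof -
  define a where "a = mob (V i) (V (i + 1))"
  define b where "b = mob (V i) (V (i + 2))"
  have a: "a \<noteq> 0" "b \<noteq> 0" using adjacent_vertex_nz by (auto simp: a_def b_def)
  have th: "angle_at V i = sg * Arg (b / a)" "angle_at V i < pi"
    using vertex_angle[of i] by (simp_all add: a_def b_def)
  then have Arg: "Arg (b / a) = sg * angle_at V i" using sg_sg by simp
  have "rcis (cmod (b / a)) (Arg (b / a)) = b / a" by (rule rcis_cmod_Arg)
  then have ba: "b = of_real (cmod (b / a)) * cis (sg * angle_at V i) * a"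
    using a unfolding Arg rcis_def by (simp add: field_simps)
  define e where "e = sgn a * cis (sg * \<phi>)"
  have caa: "cnj a * sgn a = of_real (cmod a)"
    using a by (simp add: sgn_eq complex_norm_square[symmetric] mult.commute power2_eq_square)
  then have caa': "cnj (sgn a) * a = of_real (cmod a)"
    by (metis complex_cnj_cnj complex_cnj_complex_of_real complex_cnj_mult mult.commute)
  have 1: "sg * Im (cnj a * (of_real t * e)) = t * cmod a * sin \<phi>" for t
  proof -
    have "cnj a * (of_real t * e) = of_real t * (cnj a * sgn a) * cis (sg * \<phi>)" by (simp add: e_def mult_ac)
    also have "\<dots> = of_real (t * cmod a) * cis (sg * \<phi>)" unfolding caa by simp
    finally have "Im (cnj a * (of_real t * e)) = t * cmod a * sin (sg * \<phi>)" by (simp only:) simp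
    then show ?thesis using sg_sin[of \<phi>] by (metis mult.left_commute)
  qed
  have 2: "sg * Im (cnj (of_real t * e) * b) = t * cmod (b / a) * cmod a * sin (angle_at V i - \<phi>)" for t
  proof -
    have "cnj (of_real t * e) * b
        = of_real t * of_real (cmod (b / a)) * (cnj (sgn a) * a) * (cis (- (sg * \<phi>)) * cis (sg * angle_at V i))"
      by (subst ba) (simp add: e_def cis_cnj mult_ac)
    also have "\<dots> = of_real (t * cmod (b / a) * cmod a) * cis (sg * (angle_at V i - \<phi>))"
      unfolding caa' cis_mult by (simp add: algebra_simps)
    finally have "Im (cnj (of_real t * e) * b) = t * cmod (b / a) * cmod a * sin (sg * (angle_at V i - \<phi>))"
      by (simp only:) simp
    then show ?thesis using sg_sin[of "angle_at V i - \<phi>"] by (metis mult.left_commute)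
  qed
  have adj: "bary (i + 1) (ray i \<phi> t) > 0" "bary (i + 2) (ray i \<phi> t) > 0" if t: "0 < t" "t < 1" for t
  proof -
    note rf = ray_facts[OF t, where i = i and \<phi> = \<phi>]
    obtain k where k: "k > 0" "sg * Im (cnj a * mob (V i) (ray i \<phi> t)) = k * bary (i + 2) (ray i \<phi> t)"
      using Im_vertex_coords(1)[OF rf(3), of i] unfolding a_def by blast
    obtain k' where k': "k' > 0" "sg * Im (cnj (mob (V i) (ray i \<phi> t)) * b) = k' * bary (i + 1) (ray i \<phi> t)"
      using Im_vertex_coords(2)[OF rf(3), of i] unfolding b_def by blast
    have y: "mob (V i) (ray i \<phi> t) = of_real t * e" by (simp add: rf(1) e_def a_def)
    have "sin \<phi> > 0" "sin (angle_at V i - \<phi>) > 0" using \<phi> th(2) by (auto intro!: sin_gt_zero)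
    then have "k * bary (i + 2) (ray i \<phi> t) > 0" "k' * bary (i + 1) (ray i \<phi> t) > 0"
      unfolding k(2)[symmetric] k'(2)[symmetric] y 1 2 using t a by simp_all
    then show "bary (i + 1) (ray i \<phi> t) > 0" "bary (i + 2) (ray i \<phi> t) > 0"
      using k k' by (simp_all add: zero_less_mult_iff)
  qed
  have "isCont (ray i \<phi>) 0"
    unfolding ray_def[abs_def] mob_minus_eq by (intro continuous_intros) simp
  moreover have "isCont (bary i) (ray i \<phi> 0)"
    using continuous_on_bary[of UNIV i] by (simp add: continuous_on_eq_continuous_at)
  ultimately have "isCont (\<lambda>t. bary i (ray i \<phi> t)) 0" by (rule isCont_o2)
  moreover have "ray i \<phi> 0 = V i" by (simp add: ray_def mob_minus_eq)
  ultimately have "((\<lambda>t. bary i (ray i \<phi> t)) \<longlongrightarrow> bary i (V i)) (at_right 0)"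
    by (metis isCont_def filterlim_at_split)
  then have "\<forall>\<^sub>F t in at_right 0. bary i (ray i \<phi> t) > 0"
    by (rule order_tendstoD) (rule bary_vertex(1))
  moreover have "\<forall>\<^sub>F t in at_right (0::real). t \<in> {0<..<1}" by (rule eventually_at_right_real) simp
  ultimately show ?thesis
  proof eventually_elim
    case (elim t)
    then have t: "0 < t" "t < 1" by auto
    have "bary j (ray i \<phi> t) > 0" for j
    proof -
      have "j = i \<or> j = i + 1 \<or> j = i + 2" using three_cases[of i] three_cases[of j] by auto
      then show ?thesis using elim(1) adj[OF t] by auto
    qed
    then show ?case using ray_facts(3)[OF t] by (simp add: open_triangle_def)
  qed
qed

lemma vertex_coord_eq:
  assumes p: "p \<in> surface V" "p \<noteq> vertex V i"
  shows "vertex_coord V l ori i p = of_real (sinh (hdist (V i) (footprint p))) *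
      cis (orsign ori * pi / angle_at V i * (direction V i p - direction V i (l i)))"
    "sinh (hdist (V i) (footprint p)) > 0"
proof -
  have fi: "footprint p \<noteq> V i" using footprint_vertex[OF p(1)] p(2) by blast
  have fd: "cmod (footprint p) < 1" by (rule footprint_disc[OF p(1)])
  have sd: "sdist V p (vertex V i) = hdist (V i) (footprint p)"
    using sdist_eq[OF footprint_in_triangle[OF p(1)] fi, of "sheet p"] proj_sheet_footprint[OF p(1)] by simp
  show "vertex_coord V l ori i p = of_real (sinh (hdist (V i) (footprint p))) *
      cis (orsign ori * pi / angle_at V i * (direction V i p - direction V i (l i)))"
    using p(2) by (simp add: vertex_coord_def sd polar_angle_def orsign_def mult_ac)
  have "mob (V i) (footprint p) \<noteq> 0" using mob_eq_0_iff[OF vertex_disc fd] fi by blast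
  then have "tanh (hdist (V i) (footprint p) / 2) > 0"
    by (simp add: tanh_half_hdist[OF vertex_disc fd])
  then show "sinh (hdist (V i) (footprint p)) > 0" by simp
qed

text \<open>The modulus gives the distance to the vertex, the argument the direction modulo the cone
  angle 2\<theta>. The direction of p is at most \<theta> in absolute value and that of the ray is
  strictly less, so the integer n vanishes; the sign of the direction then decides the
  sheet.\<close>

lemma vertex_coord_inj:
  assumes p: "p \<in> surface V" "p \<noteq> vertex V i"
    and z: "z \<in> open_triangle" and \<phi>: "Arg (mob (V i) z / mob (V i) (V (i + 1))) = sg * \<phi>" "0 < \<phi>" "\<phi> < angle_at V i"
    and eq: "vertex_coord V l ori i p = vertex_coord V l ori i (proj V True z)"
  shows "p = proj V True z"
proof -
  define a where "a = mob (V i) (V (i + 1))"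
  define th where "th = angle_at V i"
  have th: "th > 0" using vertex_angle(3) by (simp add: th_def)
  define z' where "z' = footprint p"
  have z'T: "z' \<in> triangle V" unfolding z'_def by (rule footprint_in_triangle[OF p(1)])
  have z'i: "z' \<noteq> V i" using footprint_vertex[OF p(1)] p(2) unfolding z'_def by blast
  have zd: "cmod z < 1" "cmod z' < 1" using open_triangleD(1)[OF z] triangle_bary(1)[OF z'T] by auto
  have q: "proj V True z \<in> surface V" "proj V True z \<noteq> vertex V i"
    using open_triangle_chart(5)[OF z] open_triangle_reg[OF z] by (auto simp: surface_reg_def)
  define S where "S = sinh (hdist (V i) z)"
  define S' where "S' = sinh (hdist (V i) z')"
  define k where "k = orsign ori * pi / th"
  define dl where "dl = direction V i (l i)"
  have S: "S > 0" "S' > 0"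
    using vertex_coord_eq(2)[OF q] vertex_coord_eq(2)[OF p] open_triangle_chart(3)[OF z]
    by (simp_all add: S_def S'_def z'_def)
  have dz: "direction V i (proj V True z) = sg * \<phi>"
    using open_triangle_chart[OF z] \<phi>(1) by (simp add: direction_def)
  have E: "of_real S' * cis (k * (direction V i p - dl)) = of_real S * cis (k * (sg * \<phi> - dl))"
    using eq unfolding vertex_coord_eq(1)[OF p] vertex_coord_eq(1)[OF q] dz
    by (simp add: S_def S'_def z'_def k_def dl_def th_def open_triangle_chart(3)[OF z])
  from arg_cong[OF E, of cmod] have SS: "S' = S" using S by (simp add: norm_mult)
  with E S have "cis (k * (direction V i p - dl)) = cis (k * (sg * \<phi> - dl))" by simp
  then have "sin (k * (direction V i p - dl)) = sin (k * (sg * \<phi> - dl)) \<and>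
      cos (k * (direction V i p - dl)) = cos (k * (sg * \<phi> - dl))" by (simp add: complex_eq_iff)
  then obtain n :: int where n: "k * (direction V i p - dl) = k * (sg * \<phi> - dl) + 2 * pi * of_int n"
    unfolding sin_cos_eq_iff by blast
  have ok: "orsign ori * orsign ori = 1" by (simp add: orsign_def)
  have "k * (direction V i p - sg * \<phi>) = 2 * pi * of_int n" using n by (simp add: algebra_simps)
  then have "orsign ori * (k * (direction V i p - sg * \<phi>)) = orsign ori * (2 * pi * of_int n)" by simp
  then have "(orsign ori * orsign ori) * (direction V i p - sg * \<phi>) * pi = 2 * th * (orsign ori * of_int n) * pi"
    using th by (simp add: k_def field_simps)
  then have dd: "direction V i p - sg * \<phi> = 2 * th * (orsign ori * of_int n)" unfolding ok by simp
  note dr = direction_range[OF z'T z'i]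
  have dp: "direction V i p = (if sheet p then 1 else -1) * Arg (mob (V i) z' / a)"
    by (simp add: direction_def z'_def a_def)
  have "\<bar>direction V i p\<bar> \<le> th" unfolding dp using dr sg_cases by (auto simp: a_def th_def)
  moreover have "\<bar>sg * \<phi>\<bar> < th" using \<phi> sg_cases by (auto simp: th_def)
  ultimately have "\<bar>direction V i p - sg * \<phi>\<bar> < 2 * th" by linarith
  then have "2 * th * \<bar>of_int n\<bar> < 2 * th" unfolding dd using th by (simp add: abs_mult orsign_def split: if_splits)
  then have "\<bar>of_int n :: real\<bar> < 1" using th by simp
  then have "n = 0" by linarith
  then have dir: "direction V i p = sg * \<phi>" using dd by simp
  have sh: "sheet p"
  proof (rule ccontr)
    assume "\<not> sheet p"
    then have "Arg (mob (V i) z' / a) = - (sg * \<phi>)" using dir dp by simp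
    then have "sg * Arg (mob (V i) z' / a) = - \<phi>" using sg_sg[of \<phi>] by simp
    then show False using dr(1) \<phi>(2) by (simp add: a_def)
  qed
  then have Arg: "Arg (mob (V i) z' / a) = Arg (mob (V i) z / a)" using dir dp \<phi>(1) by (simp add: a_def)
  have "hdist (V i) z' = hdist (V i) z" using SS by (simp add: S_def S'_def)
  then have "cmod (mob (V i) z') = cmod (mob (V i) z)"
    using tanh_half_hdist[OF vertex_disc zd(1), of i] tanh_half_hdist[OF vertex_disc zd(2), of i] by simp
  then have "cmod (mob (V i) z' / a) = cmod (mob (V i) z / a)" by (simp add: norm_divide)
  then have "mob (V i) z' / a = mob (V i) z / a"
    using Arg rcis_cmod_Arg by metis
  then have "mob (V i) z' = mob (V i) z" using adjacent_vertex_nz(1)[of i] by (simp add: a_def)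
  then have "z' = z" using mob_inj vertex_disc zd by blast
  then show ?thesis using proj_sheet_footprint[OF p(1)] sh by (simp add: z'_def)
qed

lemma sing_chart_point:
  fixes \<tau> b0 b :: real
  assumes z: "z \<in> open_triangle" and tau: "hdist (V i) z < \<tau>" and b: "\<bar>b - b0\<bar> < pi"
  shows "\<exists>q\<in>fst (sing_chart V \<tau> l ori i b0).
    snd (sing_chart V \<tau> l ori i b0) q = (vertex_coord V l ori i (proj V True z), b)"
proof -
  define p where "p = proj V True z"
  have zd: "cmod z < 1" by (rule open_triangleD(1)[OF z])
  have Z: "1 - (cmod z)\<^sup>2 > 0" using zd by (simp add: abs_square_less_1)
  define D0 where "D0 = pgeod_deriv (V i) (sgn (mob (V i) z)) (hdist (V i) z)"
  have "cmod (sgn (mob (V i) z)) = 1" using mob_vertex_nz[OF z] by (simp add: norm_sgn)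
  from pgeod_unit_speed[OF vertex_disc this, of i "hdist (V i) z"] have D0: "D0 \<noteq> 0" by (auto simp: D0_def)
  \<comment> \<open>The vector at angle b from the outward velocity \<open>D0\<close> in the given
    orientation, scaled to hyperbolic length 1.\<close>
  define \<eta> where "\<eta> = of_real ((1 - (cmod z)\<^sup>2) / 2) * (sgn D0 * orient ori (cis b))"
  have n\<eta>: "cmod \<eta> = (1 - (cmod z)\<^sup>2) / 2"
    unfolding \<eta>_def norm_mult norm_of_real orient_simps(4) using D0 Z by (simp add: norm_sgn)
  define q where "q = Reg p (tvec \<eta>)"
  have "tvec \<eta> \<in> tangent_space (surface_atlas V) p"
    using tangent_space_open_triangle[OF z] by (simp add: p_def)
  moreover have "riem_norm V p (tvec \<eta>) = 1" using riem_norm_tvec[OF z, of \<eta>] Z by (simp add: p_def n\<eta>)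
  ultimately have qM: "q \<in> M_reg V" using open_triangle_reg[OF z] by (auto simp: M_reg_def q_def p_def)
  have "p \<in> sball V \<tau> i - {vertex V i}"
    using sdist_open_triangle[OF z, of i] tau open_triangle_chart(5)[OF z] open_triangle_reg[OF z]
    by (auto simp: sball_def p_def surface_reg_def)
  then have qU: "q \<in> U_nbhd V \<tau> i" using qM by (auto simp: U_nbhd_def q_def)
  have "\<eta> / D0 = of_real ((1 - (cmod z)\<^sup>2) / 2 / cmod D0) * orient ori (cis b)"
    using D0 by (simp add: \<eta>_def sgn_eq)
  then have "sgn (\<eta> / D0) = sgn (orient ori (cis b))"
    using sgn_pos_mult[of "(1 - (cmod z)\<^sup>2) / 2 / cmod D0"] Z D0 by simp
  also have "\<dots> = orient ori (cis b)" by (simp add: sgn_eq orient_simps)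
  finally have "orient ori (sgn (\<eta> / D0)) = cis b" by (simp add: orient_orient)
  then have Phi: "Phi V l ori i q = (vertex_coord V l ori i p, cis b)"
    using z by (simp add: Phi_def q_def p_def outward_open_triangle oriented_angle_tvec D0_def)
  have cc: "cis b * cis (- b0) = cis (b - b0)" by (simp add: cis_mult)
  have "cis (b - b0) \<notin> \<real>\<^sub>\<le>\<^sub>0" by (rule cis_nonpos[OF b])
  moreover have "arg_near b0 (cis b) = b"
    unfolding arg_near_def cc using b by (subst Arg_cis) auto
  ultimately show ?thesis
    using qU Phi by (intro bexI[of _ q]) (auto simp: sing_chart_def cc p_def)
qed

lemma from_chart_point:
  assumes "\<exists>q\<in>fst \<kappa>. snd \<kappa> q = x"
  shows "from_chart \<kappa> x \<in> fst \<kappa>" "snd \<kappa> (from_chart \<kappa> x) = x"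
proof -
  have "x \<in> snd \<kappa> ` fst \<kappa>" using assms by blast
  then show "from_chart \<kappa> x \<in> fst \<kappa>" "snd \<kappa> (from_chart \<kappa> x) = x"
    unfolding from_chart_def by (rule inv_into_into, rule f_inv_into_f)
qed

lemma sing_chart_cases:
  assumes "q \<in> fst (sing_chart V \<tau> l ori i b0)"
  obtains (Reg) p \<xi> where "q = Reg p \<xi>" "Reg p \<xi> \<in> M_reg V" "p \<in> surface V" "p \<noteq> vertex V i"
      "sdist V p (vertex V i) < \<tau>"
  | (Fib) c where "q = Fib i c" "cmod c = 1"
  using assms by (auto simp: sing_chart_def U_nbhd_def sball_def sing_fiber_def)

text \<open>The value is taken at some preimage of (w, b). It is no fiber point since w is nonzero,
  and \<open>vertex_coord_inj\<close> finds its base point; then its vector has the form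
  \<open>tvec \<eta>\<close> and \<open>geodesic_field_sing_chart\<close> applies.\<close>

lemma in_chart_ray:
  fixes \<tau> \<epsilon> b0 b :: real and l :: "3 \<Rightarrow> spoint" and ori :: bool
    and Z :: "mpoint \<Rightarrow> (mpoint, complex \<times> real) chart \<Rightarrow> complex \<times> real"
  defines "A \<equiv> M_atlas V \<tau> l ori"
  assumes \<rho>: "\<And>p \<xi> i. Reg p \<xi> \<in> M_reg V \<Longrightarrow> sdist V p (vertex V i) < \<epsilon> \<Longrightarrow>
                     \<rho> (Reg p \<xi>) = sinh (sdist V p (vertex V i))"
    and Z: "\<And>p \<xi>. Reg p \<xi> \<in> M_reg V \<Longrightarrow> Z (Reg p \<xi>) = (\<lambda>\<kappa>. \<rho> (Reg p \<xi>) *\<^sub>R geodesic_field V A p \<xi> \<kappa>)"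
    and z: "z \<in> open_triangle" and \<phi>: "Arg (mob (V i) z / mob (V i) (V (i + 1))) = sg * \<phi>" "0 < \<phi>" "\<phi> < angle_at V i"
    and tau: "hdist (V i) z < \<tau>" and eps: "hdist (V i) z < \<epsilon>" and b: "\<bar>b - b0\<bar> < pi"
  defines "w \<equiv> vertex_coord V l ori i (proj V True z)"
  shows "in_chart Z (sing_chart V \<tau> l ori i b0) (w, b) = sing_field (pi / angle_at V i) w b"
proof -
  define \<kappa> where "\<kappa> = sing_chart V \<tau> l ori i b0"
  define q where "q = from_chart \<kappa> (w, b)"
  have q: "q \<in> fst \<kappa>" "snd \<kappa> q = (w, b)"
    using from_chart_point[OF sing_chart_point[OF z tau b, of l ori]] by (simp_all add: q_def \<kappa>_def w_def)
  have pz: "proj V True z \<in> surface V" "proj V True z \<noteq> vertex V i"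
    using open_triangle_chart(5)[OF z] open_triangle_reg[OF z] by (auto simp: surface_reg_def)
  have w0: "w \<noteq> 0" unfolding w_def vertex_coord_eq(1)[OF pz] using vertex_coord_eq(2)[OF pz] by simp
  have wq: "w = fst (Phi V l ori i q)" using q(2) by (simp add: \<kappa>_def sing_chart_def)
  from q(1)[unfolded \<kappa>_def] show ?thesis
  proof (cases rule: sing_chart_cases)
    case (Reg p \<xi>)
    have "vertex_coord V l ori i p = vertex_coord V l ori i (proj V True z)"
      using wq by (simp add: Reg(1) Phi_def w_def)
    then have p: "p = proj V True z" by (rule vertex_coord_inj[OF Reg(3,4) z \<phi>])
    have "\<xi> \<in> tangent_space (surface_atlas V) p" "riem_norm V p \<xi> = 1"
      using Reg(2) by (auto simp: M_reg_def)
    then obtain \<eta> where \<eta>: "\<xi> = tvec \<eta>" "2 * cmod \<eta> / (1 - (cmod z)\<^sup>2) = 1"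
      using tangent_space_open_triangle[OF z] riem_norm_tvec[OF z] by (auto simp: p)
    have q': "q = Reg (proj V True z) (tvec \<eta>)" by (simp add: Reg(1) p \<eta>(1))
    have "\<rho> (Reg p \<xi>) = sinh (hdist (V i) z)"
      using \<rho>[OF Reg(2), of i] sdist_open_triangle[OF z, of i] eps by (simp add: p)
    then have "Z q \<kappa> = sinh (hdist (V i) z) *\<^sub>R geodesic_field V A (proj V True z) (tvec \<eta>) \<kappa>"
      using Z[OF Reg(2)] by (simp add: Reg(1)) (simp add: p \<eta>(1))
    also have "\<dots> = sing_field (pi / angle_at V i) w b"
      unfolding A_def \<kappa>_def
      by (rule geodesic_field_sing_chart[OF z \<eta>(2)]) (use q in \<open>simp_all add: q' \<kappa>_def\<close>)
    finally show ?thesis by (simp add: in_chart_def q_def \<kappa>_def)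
  next
    case (Fib c)
    then have "w = 0" using wq by (simp add: Phi_def)
    with w0 show ?thesis by simp
  qed
qed

text \<open>Away from the vertex the coordinate has modulus sinh r > 0, so a preimage of (0, b) must
  lie on the fiber, where b determines it.\<close>

lemma Fib_sing_chart:
  assumes b: "\<bar>b - b0\<bar> < pi"
  shows "Fib i (cis b) \<in> fst (sing_chart V \<tau> l ori i b0)" "snd (sing_chart V \<tau> l ori i b0) (Fib i (cis b)) = (0, b)"
    "from_chart (sing_chart V \<tau> l ori i b0) (0, b) = Fib i (cis b)"
proof -
  define \<kappa> where "\<kappa> = sing_chart V \<tau> l ori i b0"
  have cc: "cis b * cis (- b0) = cis (b - b0)" by (simp add: cis_mult)
  have arg: "arg_near b0 (cis b) = b"
    unfolding arg_near_def cc using b by (subst Arg_cis) auto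
  show 1: "Fib i (cis b) \<in> fst (sing_chart V \<tau> l ori i b0)"
    using cis_nonpos[OF b] by (auto simp: sing_chart_def U_nbhd_def sing_fiber_def Phi_def cc)
  show 2: "snd (sing_chart V \<tau> l ori i b0) (Fib i (cis b)) = (0, b)"
    using arg by (simp add: sing_chart_def Phi_def)
  define q where "q = from_chart \<kappa> (0, b)"
  have q: "q \<in> fst \<kappa>" "snd \<kappa> q = (0, b)"
    using from_chart_point[of \<kappa> "(0, b)"] 1 2 unfolding q_def \<kappa>_def by blast+
  from q(1)[unfolded \<kappa>_def] have "q = Fib i (cis b)"
  proof (cases rule: sing_chart_cases)
    case (Reg p \<xi>)
    have "vertex_coord V l ori i p = 0" using q(2) by (simp add: \<kappa>_def sing_chart_def Reg(1) Phi_def)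
    then show ?thesis using vertex_coord_eq(1)[OF Reg(3,4), of l ori] vertex_coord_eq(2)[OF Reg(3,4)] by simp
  next
    case (Fib c)
    have "b = arg_near b0 c" using q(2) by (simp add: \<kappa>_def sing_chart_def Fib(1) Phi_def)
    then show ?thesis using cis_arg_near[OF Fib(2), of b0] by (simp add: Fib(1))
  qed
  then show "from_chart (sing_chart V \<tau> l ori i b0) (0, b) = Fib i (cis b)" by (simp add: q_def \<kappa>_def)
qed

end

text \<open>Differentiability at \<open>(0, b)\<close> reduces everything to the values of \<open>F\<close> on two rays in the
  first component: they determine \<open>F (0, b)\<close> by continuity, and then the whole linearization.\<close>

lemma field_on_rays:
  fixes F :: "complex \<times> real \<Rightarrow> complex \<times> real" and S :: "real \<Rightarrow> real" and k b0 :: real and \<omega> :: "bool \<Rightarrow> complex"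
  assumes diff: "\<And>b. \<bar>b - b0\<bar> < pi \<Longrightarrow> F differentiable (at (0, b))"
    and S: "(S has_real_derivative 2) (at 0)" "S 0 = 0"
    and \<omega>: "Im (cnj (\<omega> False) * \<omega> True) \<noteq> 0" "\<And>j. cmod (\<omega> j) = 1"
    and rays: "\<And>b j. \<bar>b - b0\<bar> < pi \<Longrightarrow>
      \<forall>\<^sub>F t in at_right 0. F (of_real (S t) * \<omega> j, b) = sing_field k (of_real (S t) * \<omega> j) b"
    and b: "\<bar>b - b0\<bar> < pi"
  shows "F (0, b) = (0, - sin b)"
    and "sin b = 0 \<Longrightarrow> frechet_derivative F (at (0, b)) = saddle (cos b)"
proof -
  have contS: "isCont S 0" using S(1) by (rule DERIV_isCont)
  define G where "G b j t = sing_field k (of_real (S t) * \<omega> j) b" for b j t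
  have G: "G b j t = (of_real (S t) * \<omega> j * (of_real (sqrt (1 + (S t)\<^sup>2) * cos b) + \<i> * of_real (k * sin b)),
       - (sqrt (1 + (S t)\<^sup>2) * sin b))" for b j t
    by (simp add: G_def sing_field_def norm_mult \<omega>(2))
  \<comment> \<open>Proved for every b in the chart, because the derivative along the fiber uses
    neighbouring values.\<close>
  have zero: "F (0, b) = (0, - sin b)" if b: "\<bar>b - b0\<bar> < pi" for b
  proof (rule tendsto_unique[OF trivial_limit_at_right_real])
    have "isCont (\<lambda>t. (of_real (S t) * \<omega> True, b)) 0" by (intro continuous_intros contS)
    moreover have "isCont F (of_real (S 0) * \<omega> True, b)"
      using differentiable_imp_continuous_within[OF diff[OF b]] by (simp add: S(2))
    ultimately have "isCont (\<lambda>t. F (of_real (S t) * \<omega> True, b)) 0" by (rule isCont_o2)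
    then have "((\<lambda>t. F (of_real (S t) * \<omega> True, b)) \<longlongrightarrow> F (0, b)) (at_right 0)"
      unfolding isCont_def using S(2) filterlim_at_split by fastforce
    then show "(G b True \<longlongrightarrow> F (0, b)) (at_right 0)"
      by (rule Lim_transform_eventually) (use rays[OF b, of True] in \<open>simp add: G_def\<close>)
    have "isCont (G b True) 0" unfolding G[abs_def] by (intro continuous_intros contS)
    then have "(G b True \<longlongrightarrow> G b True 0) (at_right 0)"
      unfolding isCont_def filterlim_at_split by blast
    then show "(G b True \<longlongrightarrow> (0, - sin b)) (at_right 0)" by (simp add: G S(2))
  qed
  then show "F (0, b) = (0, - sin b)" using b by blast
  assume sb: "sin b = 0"
  define L where "L = frechet_derivative F (at (0, b))"
  have L: "(F has_derivative L) (at (0, b))"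
    unfolding L_def using diff[OF b] by (simp only: frechet_derivative_works)
  then have lin: "linear L" using has_derivative_linear by blast
  \<comment> \<open>Along the fiber F is now known to be (0, - sin s), which gives this column of
    the linearization.\<close>
  have Lb: "L (0, 1) = (0, - cos b)"
  proof -
    have "((\<lambda>s. (0::complex, s)) has_vector_derivative (0, 1)) (at b)"
      by (intro has_vector_derivative_Pair has_vector_derivative_const has_vector_derivative_id)
    then have "(F \<circ> (\<lambda>s. (0, s)) has_vector_derivative L (0, 1)) (at b)"
      by (rule vector_derivative_diff_chain_within) (rule has_derivative_at_withinI[OF L])
    moreover have "((\<lambda>s. (0::complex, - sin s)) has_vector_derivative (0, - cos b)) (at b)"
    proof (intro has_vector_derivative_Pair)
      have "((\<lambda>s. - sin s) has_real_derivative - cos b) (at b)" by (auto intro!: derivative_eq_intros)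
      then show "((\<lambda>s. - sin s) has_vector_derivative - cos b) (at b)"
        by (simp only: has_real_derivative_iff_has_vector_derivative)
    qed simp
    then have "(F \<circ> (\<lambda>s. (0, s)) has_vector_derivative (0, - cos b)) (at b)"
    proof (rule has_vector_derivative_transform_within_open[where S = "ball b0 pi"])
      show "b \<in> ball b0 pi" using b by (simp add: dist_real_def abs_minus_commute)
      fix s assume "s \<in> ball b0 pi"
      then show "(0, - sin s) = (F \<circ> (\<lambda>s. (0, s))) s"
        using zero[of s] by (simp add: dist_real_def abs_minus_commute)
    qed simp
    ultimately show ?thesis by (rule vector_derivative_unique_at)
  qed
  \<comment> \<open>The values on a ray are known for t > 0 only, so one-sided derivatives are
    compared. As sin b = 0, the rotational term of the field drops out; the factor 2 is the
    derivative of S at 0.\<close>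
  have L\<omega>: "L (\<omega> j, 0) = (of_real (cos b) * \<omega> j, 0)" for j
  proof -
    define K where "K t = (of_real (S t) * \<omega> j, b)" for t
    have dS: "(S has_real_derivative 2) (at 0 within {0..})" using S(1) by (rule has_field_derivative_at_within)
    have dK: "(K has_vector_derivative (of_real 2 * \<omega> j, 0)) (at 0 within {0..})"
      unfolding K_def by (intro has_vector_derivative_Pair has_vector_derivative_mult_left has_vector_derivative_of_real dS) simp
    have "K 0 = (0, b)" by (simp add: K_def S(2))
    with L have "(F has_derivative L) (at (K 0) within K ` {0..})" by (simp add: has_derivative_at_withinI)
    then have 1: "(F \<circ> K has_vector_derivative L (of_real 2 * \<omega> j, 0)) (at 0 within {0..})"
      by (rule vector_derivative_diff_chain_within[OF dK])
    have "((\<lambda>t. S t * sqrt (1 + (S t)\<^sup>2) * cos b) has_real_derivative 2 * cos b) (at 0 within {0..})"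
      by (auto intro!: derivative_eq_intros dS simp: S(2))
    then have "((\<lambda>t. (of_real (S t * sqrt (1 + (S t)\<^sup>2) * cos b) * \<omega> j, 0::real)) has_vector_derivative
        (of_real (2 * cos b) * \<omega> j, 0)) (at 0 within {0..})"
      by (intro has_vector_derivative_Pair has_vector_derivative_mult_left has_vector_derivative_of_real) simp_all
    moreover have "(\<lambda>t. (of_real (S t * sqrt (1 + (S t)\<^sup>2) * cos b) * \<omega> j, 0::real)) = G b j"
      by (simp add: G sb fun_eq_iff mult_ac)
    ultimately have 2: "(G b j has_vector_derivative (of_real (2 * cos b) * \<omega> j, 0)) (at 0 within {0..})" by simp
    have 0: "(F \<circ> K) 0 = G b j 0" using zero[OF b] by (simp add: K_def G S(2))
    have "\<forall>\<^sub>F t in nhds 0. t \<in> {0..} \<longrightarrow> (F \<circ> K) t = G b j t"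
    proof -
      have "\<forall>\<^sub>F t in nhds 0. t \<noteq> 0 \<longrightarrow> t \<in> {0<..} \<longrightarrow> (F \<circ> K) t = G b j t"
        using rays[OF b, of j] unfolding eventually_at_filter K_def G_def o_apply .
      then show ?thesis by eventually_elim (use 0 in \<open>auto simp: less_le\<close>)
    qed
    from iffD1[OF has_vector_derivative_cong_ev[OF this 0] 1]
    have "(G b j has_vector_derivative L (of_real 2 * \<omega> j, 0)) (at 0 within {0..})" .
    moreover have "at (0::real) within {0..} \<noteq> bot" by (simp add: at_within_Ici_at_right)
    ultimately have "L (of_real 2 * \<omega> j, 0) = (of_real (2 * cos b) * \<omega> j, 0)"
      using 2 vector_derivative_unique_within by blast
    moreover have "L (of_real 2 * \<omega> j, 0) = 2 *\<^sub>R L (\<omega> j, 0)"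
      using linear_scale[OF lin, of 2 "(\<omega> j, 0)"] by (simp add: scaleR_conv_of_real)
    ultimately have "2 *\<^sub>R L (\<omega> j, 0) = 2 *\<^sub>R (of_real (cos b) * \<omega> j, 0)"
      by (simp add: scaleR_conv_of_real mult.assoc)
    then show ?thesis by (rule scaleR_left_imp_eq[rotated]) simp
  qed
  have "L (w, s) = (of_real (cos b) * w, - cos b * s)" for w s
  proof -
    \<comment> \<open>Cramer's rule for w in the real basis formed by the two ray directions, with
      determinant D.\<close>
    define D where "D = Im (cnj (\<omega> False) * \<omega> True)"
    define P where "P = - Im (cnj (\<omega> True) * w)"
    define Q where "Q = Im (cnj (\<omega> False) * w)"
    have D: "D \<noteq> 0" using \<omega>(1) by (simp only: D_def not_False_eq_True)
    have e: "of_real D * w = of_real P * \<omega> False + of_real Q * \<omega> True"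
      unfolding D_def P_def Q_def complex_eq_iff by (simp add: algebra_simps)
    define x where "x = P / D"
    define y where "y = Q / D"
    have PQ: "P = D * x" "Q = D * y" using D by (simp_all add: x_def y_def)
    have "of_real D * w = of_real D * (of_real x * \<omega> False + of_real y * \<omega> True)"
      unfolding e PQ by (simp add: algebra_simps)
    then have w: "w = of_real x * \<omega> False + of_real y * \<omega> True"
      using D by (simp only: mult_left_cancel of_real_eq_0_iff not_False_eq_True)
    have "(w, s) = x *\<^sub>R (\<omega> False, 0) + y *\<^sub>R (\<omega> True, 0) + s *\<^sub>R (0, 1)"
      by (simp add: w scaleR_conv_of_real)
    then have "L (w, s) = x *\<^sub>R L (\<omega> False, 0) + y *\<^sub>R L (\<omega> True, 0) + s *\<^sub>R L (0, 1)"
      by (simp only: linear_add[OF lin] linear_scale[OF lin])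
    also have "\<dots> = (of_real (cos b) * w, - cos b * s)"
      unfolding L\<omega> Lb by (simp add: w scaleR_conv_of_real algebra_simps)
    finally show ?thesis .
  qed
  then show "frechet_derivative F (at (0, b)) = saddle (cos b)"
    by (auto simp: L_def saddle_def fun_eq_iff)
qed

lemma (in nondegenerate_triangle) field_at_singular_fiber:
  fixes \<tau> \<epsilon> b0 b :: real and l :: "3 \<Rightarrow> spoint" and ori :: bool
    and Z :: "mpoint \<Rightarrow> (mpoint, complex \<times> real) chart \<Rightarrow> complex \<times> real"
  defines "A \<equiv> M_atlas V \<tau> l ori" and "\<kappa> i \<equiv> sing_chart V \<tau> l ori i b0"
  assumes tau: "\<tau> > 0" and eps: "\<epsilon> > 0"
    and \<rho>: "\<And>p \<xi> i. Reg p \<xi> \<in> M_reg V \<Longrightarrow> sdist V p (vertex V i) < \<epsilon> \<Longrightarrow>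
                     \<rho> (Reg p \<xi>) = sinh (sdist V p (vertex V i))"
    and Z: "\<And>p \<xi>. Reg p \<xi> \<in> M_reg V \<Longrightarrow> Z (Reg p \<xi>) = (\<lambda>\<kappa>. \<rho> (Reg p \<xi>) *\<^sub>R geodesic_field V A p \<xi> \<kappa>)"
    and sm: "smooth_vector_field (M_space V) A Z"
    and b: "\<bar>b - b0\<bar> < pi"
  shows "Z (Fib i (cis b)) (\<kappa> i) = (0, - sin b)"
    and "sin b = 0 \<Longrightarrow> frechet_derivative (in_chart Z (\<kappa> i)) (at (0, b)) = saddle (cos b)"
proof -
  define F where "F = in_chart Z (\<kappa> i)"
  define th where "th = angle_at V i"
  have th: "0 < th" "th < pi" using vertex_angle(3,4) by (simp_all add: th_def)
  \<comment> \<open>The rays trisect the angle of the triangle. In the chart they are pi/3 apart, so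
    the determinant of their directions is plus or minus sin (pi/3).\<close>
  define \<phi> where "\<phi> j = (if j then 2 else 1) * th / 3" for j
  have \<phi>: "0 < \<phi> j" "\<phi> j < th" "\<phi> j < pi" for j using th by (auto simp: \<phi>_def)
  define k where "k = orsign ori * pi / th"
  define dl where "dl = direction V i (l i)"
  define \<omega> where "\<omega> j = cis (k * (sg * \<phi> j - dl))" for j
  \<comment> \<open>This is sinh r as a function of t = tanh (r/2), the modulus of the chart value
    along a ray.\<close>
  define S :: "real \<Rightarrow> real" where "S t = 2 * t / (1 - t\<^sup>2)" for t
  have diff: "F differentiable (at (0, b))" if "\<bar>b - b0\<bar> < pi" for b
  proof -
    have "\<kappa> i \<in> A" by (auto simp: A_def \<kappa>_def M_atlas_def)
    then have "Ck_on (Suc 0) (snd (\<kappa> i) ` fst (\<kappa> i)) F"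
      using sm unfolding smooth_vector_field_def smooth_on_def F_def by blast
    moreover have "(0, b) \<in> snd (\<kappa> i) ` fst (\<kappa> i)"
      using Fib_sing_chart(1,2)[OF that, where i = i and \<tau> = \<tau> and l = l and ori = ori] by (metis \<kappa>_def imageI)
    ultimately show ?thesis unfolding Ck_on.simps by blast
  qed
  have dS: "(S has_real_derivative 2) (at 0)" unfolding S_def by (auto intro!: derivative_eq_intros)
  have S0: "S 0 = 0" by (simp add: S_def)
  have n\<omega>: "cmod (\<omega> j) = 1" for j by (simp add: \<omega>_def)
  have \<omega>: "Im (cnj (\<omega> False) * \<omega> True) \<noteq> 0"
  proof -
    have "cnj (\<omega> False) * \<omega> True = cis (k * sg * (\<phi> True - \<phi> False))"
      by (simp add: \<omega>_def cis_cnj cis_mult algebra_simps)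
    also have "k * sg * (\<phi> True - \<phi> False) = orsign ori * sg * (pi / 3)"
      using th by (simp add: k_def \<phi>_def field_simps)
    finally have "Im (cnj (\<omega> False) * \<omega> True) = sin (orsign ori * sg * (pi / 3))" by simp
    moreover have "orsign ori * sg = 1 \<or> orsign ori * sg = -1" using sg_cases by (auto simp: orsign_def)
    ultimately show ?thesis by (auto simp: sin_60)
  qed
  have rays: "\<forall>\<^sub>F t in at_right 0. F (of_real (S t) * \<omega> j, b) = sing_field (pi / th) (of_real (S t) * \<omega> j) b" if b: "\<bar>b - b0\<bar> < pi" for b j
  proof -
    \<comment> \<open>2 artanh t is the distance from the vertex to the ray point with parameter t.
      For small t it is below \<tau> and \<epsilon>, so the chart and the prescribed form of \<rho>
      are available.\<close>
    have "((\<lambda>t::real. 2 * artanh t) \<longlongrightarrow> 2 * artanh 0) (at_right 0)"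
      by (intro tendsto_intros) auto
    then have "\<forall>\<^sub>F t in at_right (0::real). 2 * artanh t < min \<tau> \<epsilon>"
      by (rule order_tendstoD) (use tau eps in simp)
    moreover have "\<forall>\<^sub>F t in at_right (0::real). t \<in> {0<..<1}" by (rule eventually_at_right_real) simp
    moreover have "\<forall>\<^sub>F t in at_right 0. ray i (\<phi> j) t \<in> open_triangle"
      by (rule ray_open_triangle) (use \<phi>[of j] in \<open>simp_all add: th_def\<close>)
    ultimately show ?thesis
    proof eventually_elim
      case (elim t)
      then have t: "0 < t" "t < 1" by auto
      note rf = ray_facts[OF t, where i = i and \<phi> = "\<phi> j"]
      have hd: "hdist (V i) (ray i (\<phi> j) t) < \<tau>" "hdist (V i) (ray i (\<phi> j) t) < \<epsilon>"
        using elim(1) by (simp_all add: hdist_def rf(2))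
      have w: "vertex_coord V l ori i (proj V True (ray i (\<phi> j) t)) = of_real (S t) * \<omega> j"
        unfolding vertex_coord_open_triangle[OF elim(3)] rf(2) rf(4)[OF \<phi>(1,3)]
        by (simp add: S_def \<omega>_def k_def th_def dl_def)
      have \<phi>th: "\<phi> j < angle_at V i" using \<phi>(2) by (simp add: th_def)
      show ?case
        using in_chart_ray[OF \<rho> Z[unfolded A_def] elim(3) rf(4)[OF \<phi>(1,3)] \<phi>(1) \<phi>th hd b]
        unfolding F_def \<kappa>_def w th_def by blast
    qed
  qed
  have main1: "F (0, b) = (0, - sin b)"
    by (rule field_on_rays(1)[where F = F, OF _ dS S0 \<omega> n\<omega> _ b]) (erule diff, erule rays)
  have main2: "frechet_derivative F (at (0, b)) = saddle (cos b)" if "sin b = 0"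
    by (rule field_on_rays(2)[where F = F, OF _ dS S0 \<omega> n\<omega> _ b that]) (erule diff, erule rays)
  have "F (0, b) = Z (Fib i (cis b)) (\<kappa> i)"
    unfolding F_def in_chart_def \<kappa>_def Fib_sing_chart(3)[OF b] ..
  then show "Z (Fib i (cis b)) (\<kappa> i) = (0, - sin b)" using main1 by simp
  show "frechet_derivative (in_chart Z (\<kappa> i)) (at (0, b)) = saddle (cos b)"
    if "sin b = 0" using main2[OF that] by (simp add: F_def)
qed

theorem proposition3p5:
  fixes V :: "3 \<Rightarrow> complex" and \<tau> \<epsilon> :: real and l :: "3 \<Rightarrow> spoint" and ori :: bool
    and \<rho> :: "mpoint \<Rightarrow> real"
    and Z :: "mpoint \<Rightarrow> (mpoint, complex \<times> real) chart \<Rightarrow> complex \<times> real"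
  assumes nondeg: "nondegenerate V"
    and \<tau>_pos: "\<tau> > 0"
    and \<tau>_disc: "\<And>i. subtopology (surface_top V) (surface_top V closure_of sball V \<tau> i)
                     homeomorphic_space top_of_set (cball (0::complex) 1)"
    and \<tau>_vertex: "\<And>i. sball V \<tau> i \<inter> range (vertex V) = {vertex V i}"
    and l: "\<And>i. l i \<in> sball V \<tau> i - {vertex V i}"
    and \<epsilon>_pos: "\<epsilon> > 0"
    and \<rho>_pos: "\<And>v. v \<in> M_reg V \<Longrightarrow> \<rho> v > 0"
    and \<rho>_smooth: "smooth_function (M_reg_atlas V) \<rho>"
    and \<rho>_vertex: "\<And>p \<xi> i. Reg p \<xi> \<in> M_reg V \<Longrightarrow> sdist V p (vertex V i) < \<epsilon> \<Longrightarrow>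
                     \<rho> (Reg p \<xi>) = sinh (sdist V p (vertex V i))"
    and Z_smooth: "smooth_vector_field (M_space V) (M_atlas V \<tau> l ori) Z"
    and Z_extends: "\<And>p \<xi>. Reg p \<xi> \<in> M_reg V \<Longrightarrow>
                     Z (Reg p \<xi>) = (\<lambda>\<kappa>. \<rho> (Reg p \<xi>) *\<^sub>R geodesic_field V (M_atlas V \<tau> l ori) p \<xi> \<kappa>)"
  shows "\<forall>i. card {q \<in> sing_fiber i. is_zero_of Z q} = 2 \<and>
             (\<forall>q \<in> sing_fiber i. is_zero_of Z q \<longrightarrow> hyperbolic_zero (M_atlas V \<tau> l ori) Z q)"
proof
  fix i
  interpret nondegenerate_triangle V by unfold_locales (rule nondeg)
  define A where "A = M_atlas V \<tau> l ori"
  have field: "Z (Fib i (cis b)) (sing_chart V \<tau> l ori i b0) = (0, - sin b)"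
      "sin b = 0 \<Longrightarrow> frechet_derivative (in_chart Z (sing_chart V \<tau> l ori i b0)) (at (0, b))
        = saddle (cos b)"
    if "\<bar>b - b0\<bar> < pi" for b b0
    using field_at_singular_fiber[OF \<tau>_pos \<epsilon>_pos \<rho>_vertex Z_extends Z_smooth that] by blast+
  \<comment> \<open>Charts of the regular part contain no fiber points, and the neighbourhood of
    another vertex contains no point of this fiber; only the singular charts at vertex i
    remain.\<close>
  have charts: "\<exists>b0 b. \<kappa> = sing_chart V \<tau> l ori i b0 \<and> c = cis b \<and> \<bar>b - b0\<bar> < pi \<and> snd \<kappa> (Fib i c) = (0, b)"
    if \<kappa>: "\<kappa> \<in> A" "Fib i c \<in> fst \<kappa>" and c: "cmod c = 1" for \<kappa> c
  proof -
    have "\<kappa> \<notin> M_reg_atlas V" using \<kappa>(2) by (auto simp: M_reg_atlas_def reg_chart_def)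
    then obtain j b0 where j: "\<kappa> = sing_chart V \<tau> l ori j b0" using \<kappa>(1) by (auto simp: A_def M_atlas_def)
    have "i = j" using \<kappa>(2) by (auto simp: j sing_chart_def U_nbhd_def sing_fiber_def)
    have "c * cis (- b0) \<notin> \<real>\<^sub>\<le>\<^sub>0" using \<kappa>(2) by (simp add: j sing_chart_def Phi_def)
    then have "\<bar>arg_near b0 c - b0\<bar> < pi" using Arg_lt_pi_iff by (simp add: arg_near_def)
    moreover have "snd \<kappa> (Fib i c) = (0, arg_near b0 c)" by (simp add: j sing_chart_def Phi_def)
    ultimately show ?thesis using j \<open>i = j\<close> cis_arg_near[OF c, of b0] by metis
  qed
  \<comment> \<open>The chart centred at \<open>Arg c\<close> detects a nonzero value. Conversely a
    zero must vanish in all charts: singular charts around the point give - sin b, and on every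
    other chart a tangent vector is 0 by convention.\<close>
  have zero: "is_zero_of Z (Fib i c) \<longleftrightarrow> Im c = 0" if c: "cmod c = 1" for c
  proof
    assume "is_zero_of Z (Fib i c)"
    then have "Z (Fib i c) (sing_chart V \<tau> l ori i (Arg c)) = 0" by (simp add: is_zero_of_def)
    moreover have "c \<noteq> 0" using c by auto
    then have cis: "cis (Arg c) = c" using c by (simp add: cis_Arg sgn_eq)
    ultimately have "sin (Arg c) = 0" using field(1)[of "Arg c" "Arg c"] by (simp add: zero_prod_def)
    then show "Im c = 0" using cis by (metis cis.sel(2))
  next
    assume im: "Im c = 0"
    have "Fib i c \<in> sing_fiber i" using c by (simp add: sing_fiber_def)
    then have "Fib i c \<in> M_space V" unfolding M_space_def by blast
    then have tan: "Z (Fib i c) \<in> tangent_space A (Fib i c)"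
      using Z_smooth by (simp add: smooth_vector_field_def A_def)
    have "Z (Fib i c) \<kappa> = 0" for \<kappa>
    proof (cases "\<kappa> \<in> A \<and> Fib i c \<in> fst \<kappa>")
      case True
      then obtain b0 b where "\<kappa> = sing_chart V \<tau> l ori i b0" "c = cis b" "\<bar>b - b0\<bar> < pi"
        using charts[OF _ _ c] by blast
      then show ?thesis using field(1)[of b b0] im by (simp add: zero_prod_def)
    next
      case False
      then show ?thesis using tan unfolding tangent_space_def by blast
    qed
    then show "is_zero_of Z (Fib i c)" by (simp add: is_zero_of_def fun_eq_iff)
  qed
  have unit: "cmod c = 1 \<and> Im c = 0 \<longleftrightarrow> c = 1 \<or> c = -1" for c
    by (auto simp: complex_eq_iff cmod_def power2_eq_1_iff)
  have "{q \<in> sing_fiber i. is_zero_of Z q} = Fib i ` {c. cmod c = 1 \<and> Im c = 0}"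
    using zero by (auto simp: sing_fiber_def)
  also have "\<dots> = {Fib i 1, Fib i (-1)}" by (auto simp: unit)
  finally have "card {q \<in> sing_fiber i. is_zero_of Z q} = 2" by simp
  moreover have "hyperbolic_zero A Z q" if q: "q \<in> sing_fiber i" "is_zero_of Z q" for q
    unfolding hyperbolic_zero_def
  proof (intro conjI ballI impI allI)
    show "is_zero_of Z q" by fact
    fix \<kappa> \<mu> assume \<kappa>: "\<kappa> \<in> A" "q \<in> fst \<kappa>"
      and ev: "complex_eigenvalue (frechet_derivative (in_chart Z \<kappa>) (at (snd \<kappa> q))) \<mu>"
    obtain c where c: "q = Fib i c" "cmod c = 1" using q(1) by (auto simp: sing_fiber_def)
    obtain b0 b where b: "\<kappa> = sing_chart V \<tau> l ori i b0" "c = cis b" "\<bar>b - b0\<bar> < pi" "snd \<kappa> (Fib i c) = (0, b)"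
      using charts[OF \<kappa>(1) _ c(2)] \<kappa>(2) c(1) by blast
    have "sin b = 0" using zero[OF c(2)] q(2) c(1) b(2) by simp
    define L where "L = saddle (cos b)"
    have "frechet_derivative (in_chart Z \<kappa>) (at (snd \<kappa> q)) = L"
      using field(2)[OF b(3) \<open>sin b = 0\<close>] b(4) by (simp add: c(1) b(1) L_def)
    moreover have "linear L"
      by (rule linearI) (auto simp: L_def saddle_def algebra_simps)
    \<comment> \<open>With cos b equal to 1 or -1 the linearization is an involution.\<close>
    moreover have "cos b * cos b = 1" using sin_cos_squared_add[of b] \<open>sin b = 0\<close> by (simp add: power2_eq_square)
    then have "L (L x) = x" for x
      by (cases x) (simp add: L_def saddle_def mult.assoc[symmetric] flip: of_real_mult)
    ultimately show "Re \<mu> \<noteq> 0" using no_imaginary_eigenvalue[of L \<mu>] ev by simp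
  qed
  ultimately show "card {q \<in> sing_fiber i. is_zero_of Z q} = 2 \<and>
      (\<forall>q \<in> sing_fiber i. is_zero_of Z q \<longrightarrow> hyperbolic_zero (M_atlas V \<tau> l ori) Z q)"
    unfolding A_def by blast
qed

end
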